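(* Let $n\ge2$, $\kappa>0$, set $M=M_{-\kappa}^n$, let $p_0\in M$, and consider $f,g\colon M\to\mathbb{R}$ defined by $f(p)=d(p,p_0)^2$ and $g(p)=d(p,p_0)$. One has the following estimates for all $p\in M$ and $u,w\in T_pM$ (with $p\ne p_0$ in expressions involving $dg_p$): (i) $\displaystyle|(\nabla^3f)_p(w,u,u)|\le\sqrt{\frac\kappa2}\sqrt{(\nabla^2f)_p(w,w)}\,(\nabla^2f)_p(u,u)$, so $f$ is $\frac8\kappa$-self-concordant, and this constant cannot be improved (i.e. $f$ is not $\alpha$-self-concordant for any $\alpha>\frac8\kappa$). (ii) $\displaystyle|(\nabla^3f)_p(u,u,u)|\le\sqrt{\frac{8\kappa}{27}}\,((\nabla^2f)_p(u,u))^{3/2}$, so $f$ is $\frac{27}{2\kappa}$-self-concordant along geodesics, and this constant cannot be improved (i.e. $f$ is not $\alpha$-self-concordant along geodesics for any $\alpha>\frac{27}{2\kappa}$). (iii) $$\begin{aligned}|(\nabla^3f)_p(w,u,u)|&\le2\zeta\sqrt\kappa\,|dg_p(w)|\left((\nabla^2f)_p(u,u)-2\,dg_p(u)^2\right)\\&\quad+2\sqrt\kappa\,|dg_p(u)|\sqrt{(\nabla^2f)_p(u,u)-2\,dg_p(u)^2}\sqrt{(\nabla^2f)_p(w,w)-2\,dg_p(w)^2}\\&\le2\zeta\sqrt\kappa\,\|w\|_p(\nabla^2f)_p(u,u)+2\sqrt\kappa\,\|u\|_p\sqrt{(\nabla^2f)_p(u,u)}\sqrt{(\nabla^2f)_p(w,w)},\end{aligned}$$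 where $\zeta=\sup_{x\in\mathbb{R}\setminus\{0\}}\left|\frac{1}{\sinh(x)}-\frac1x\right|\le\frac12$.
   Context: $M_{-\kappa}^n$ is the $n$-dimensional model space of constant sectional curvature $-\kappa$, i.e. the simply connected complete Riemannian manifold of dimension $n$ and constant sectional curvature $-\kappa<0$ (so $M_{-1}^n=\mathbb{H}^n$); $d$ is its Riemannian distance and $\|\cdot\|_p$ the Riemannian norm on $T_pM$. $\nabla$ is the Levi-Civita connection, $\nabla^2f$ the Hessian, $\nabla^3f=\nabla(\nabla^2f)$ with $(\nabla^3f)_p(u,v,w)=(\nabla_u(\nabla^2f))_p(v,w)$. For $\alpha>0$, a smooth convex function $f\colon M\to\mathbb{R}$ is $\alpha$-self-concordant if $|(\nabla^3f)_p(u,v,w)|\le\frac{2}{\sqrt\alpha}\sqrt{(\nabla^2f)_p(u,u)}\sqrt{(\nabla^2f)_p(v,v)}\sqrt{(\nabla^2f)_p(w,w)}$ for all $p\in M$, $u,v,w\in T_pM$, and $\alpha$-self-concordant along geodesics if $|(\nabla^3f)_p(u,u,u)|\le\frac{2}{\sqrt\alpha}((\nabla^2f)_p(u,u))^{3/2}$ for all $p\in M$, $u\in T_pM$. *)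

theory Defs
  imports "HOL-Analysis.Analysis"
begin

section \<open>Riemannian geometry in a global chart\<close>

text \<open>
  A Riemannian manifold is given by an open set \<open>U\<close> of a Euclidean space \<open>'a\<close> together with a
  metric tensor \<open>G\<close>: \<open>G p u v\<close> is the inner product at \<open>p\<close> of the tangent vectors \<open>u\<close> and \<open>v\<close>,
  and every tangent space is identified with \<open>'a\<close>. The Euclidean structure of \<open>'a\<close> only provides
  coordinates; lengths, distances, geodesics and covariant derivatives are those of \<open>G\<close>.
\<close>

type_synonym 'a metric_tensor = "'a \<Rightarrow> 'a \<Rightarrow> 'a \<Rightarrow> real"

text \<open>
  On an open set of a finite-dimensional space, \<open>Ck_on\<close> is the usual class \<open>C\<^sup>k\<close>, expressed through
  iterated derivatives in constant directions.
\<close>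

primrec Ck_on :: "nat \<Rightarrow> 'a::euclidean_space set \<Rightarrow> ('a \<Rightarrow> real) \<Rightarrow> bool" where
  "Ck_on 0 U f \<longleftrightarrow> continuous_on U f"
| "Ck_on (Suc k) U f \<longleftrightarrow> (\<forall>x\<in>U. f differentiable (at x)) \<and>
     (\<forall>v. Ck_on k U (\<lambda>x. frechet_derivative f (at x) v))"

definition smooth_on :: "'a::euclidean_space set \<Rightarrow> ('a \<Rightarrow> real) \<Rightarrow> bool" where
  "smooth_on U f \<longleftrightarrow> (\<forall>k. Ck_on k U f)"

definition riemannian_metric_on :: "'a::euclidean_space set \<Rightarrow> 'a metric_tensor \<Rightarrow> bool" where
  "riemannian_metric_on U G \<longleftrightarrow> open U \<and>
     (\<forall>p\<in>U. bilinear (G p) \<and> (\<forall>u v. G p u v = G p v u) \<and> (\<forall>u. u \<noteq> 0 \<longrightarrow> G p u u > 0)) \<and>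
     (\<forall>u v. smooth_on U (\<lambda>p. G p u v))"

definition riem_norm :: "'a metric_tensor \<Rightarrow> 'a \<Rightarrow> 'a \<Rightarrow> real" where
  "riem_norm G p u = sqrt (G p u u)"

text \<open>
  The length is required to exist through \<open>has_integral\<close>: a piecewise \<open>C1\<close> path in the sense
  of \<open>valid_path\<close> may have an unbounded derivative near its finitely many exceptional points, and
  then the operator \<open>integral\<close> could return the junk value 0.
\<close>

definition has_riem_length :: "'a::euclidean_space metric_tensor \<Rightarrow> (real \<Rightarrow> 'a) \<Rightarrow> real \<Rightarrow> bool" where
  "has_riem_length G \<gamma> L \<longleftrightarrow>
     ((\<lambda>t. riem_norm G (\<gamma> t) (vector_derivative \<gamma> (at t))) has_integral L) {0..1}"

definition riem_dist :: "'a::euclidean_space set \<Rightarrow> 'a metric_tensor \<Rightarrow> 'a \<Rightarrow> 'a \<Rightarrow> real" where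
  "riem_dist U G p q = Inf {L. \<exists>\<gamma>. valid_path \<gamma> \<and> path_image \<gamma> \<subseteq> U \<and>
     pathstart \<gamma> = p \<and> pathfinish \<gamma> = q \<and> has_riem_length G \<gamma> L}"

text \<open>
  Christoffel symbols of the Levi-Civita connection, as a vector-valued bilinear form: for
  vector fields \<open>X\<close>, \<open>Y\<close> the connection is \<open>\<nabla>\<^sub>X Y = D\<^sub>X Y + levi_civita G p X Y\<close>. The two
  conditions after bilinearity are torsion-freeness and compatibility with the metric, both
  evaluated on coordinate vector fields.
\<close>

definition is_levi_civita ::
  "'a::euclidean_space metric_tensor \<Rightarrow> 'a \<Rightarrow> ('a \<Rightarrow> 'a \<Rightarrow> 'a) \<Rightarrow> bool" where
  "is_levi_civita G p B \<longleftrightarrow> bilinear B \<and> (\<forall>u v. B u v = B v u) \<and>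
     (\<forall>u v w. frechet_derivative (\<lambda>x. G x v w) (at p) u = G p (B u v) w + G p v (B u w))"

definition levi_civita :: "'a::euclidean_space metric_tensor \<Rightarrow> 'a \<Rightarrow> 'a \<Rightarrow> 'a \<Rightarrow> 'a" where
  "levi_civita G p = (THE B. is_levi_civita G p B)"

text \<open>
  Covariant derivatives \<open>(\<nabla>\<^sub>u \<omega>)\<^sub>p(v)\<close> of a 1-form and \<open>(\<nabla>\<^sub>u T)\<^sub>p(v,w)\<close> of a covariant
  2-tensor; the direction of differentiation is the first vector argument.
\<close>

definition cov_deriv_form ::
  "'a::euclidean_space metric_tensor \<Rightarrow> ('a \<Rightarrow> 'a \<Rightarrow> real) \<Rightarrow> 'a \<Rightarrow> 'a \<Rightarrow> 'a \<Rightarrow> real" where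
  "cov_deriv_form G \<omega> p u v =
     frechet_derivative (\<lambda>x. \<omega> x v) (at p) u - \<omega> p (levi_civita G p u v)"

definition cov_deriv_tensor ::
  "'a::euclidean_space metric_tensor \<Rightarrow> ('a \<Rightarrow> 'a \<Rightarrow> 'a \<Rightarrow> real)
     \<Rightarrow> 'a \<Rightarrow> 'a \<Rightarrow> 'a \<Rightarrow> 'a \<Rightarrow> real" where
  "cov_deriv_tensor G T p u v w =
     frechet_derivative (\<lambda>x. T x v w) (at p) u
       - T p (levi_civita G p u v) w - T p v (levi_civita G p u w)"

definition diff_form :: "('a::euclidean_space \<Rightarrow> real) \<Rightarrow> 'a \<Rightarrow> 'a \<Rightarrow> real" where
  "diff_form f p = frechet_derivative f (at p)"

definition hessian ::
  "'a::euclidean_space metric_tensor \<Rightarrow> ('a \<Rightarrow> real) \<Rightarrow> 'a \<Rightarrow> 'a \<Rightarrow> 'a \<Rightarrow> real" where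
  "hessian G f = cov_deriv_form G (diff_form f)"

definition nabla3 ::
  "'a::euclidean_space metric_tensor \<Rightarrow> ('a \<Rightarrow> real) \<Rightarrow> 'a \<Rightarrow> 'a \<Rightarrow> 'a \<Rightarrow> 'a \<Rightarrow> real" where
  "nabla3 G f = cov_deriv_tensor G (hessian G f)"

definition geodesic_in ::
  "'a::euclidean_space set \<Rightarrow> 'a metric_tensor \<Rightarrow> (real \<Rightarrow> 'a) \<Rightarrow> bool" where
  "geodesic_in U G \<gamma> \<longleftrightarrow> (\<exists>\<gamma>'. \<forall>t\<in>{0..1}. \<gamma> t \<in> U \<and>
     (\<gamma> has_vector_derivative \<gamma>' t) (at t within {0..1}) \<and>
     (\<gamma>' has_vector_derivative - levi_civita G (\<gamma> t) (\<gamma>' t) (\<gamma>' t)) (at t within {0..1}))"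

definition geodesically_convex_on ::
  "'a::euclidean_space set \<Rightarrow> 'a metric_tensor \<Rightarrow> ('a \<Rightarrow> real) \<Rightarrow> bool" where
  "geodesically_convex_on U G f \<longleftrightarrow>
     (\<forall>\<gamma>. geodesic_in U G \<gamma> \<longrightarrow> convex_on {0..1} (\<lambda>t. f (\<gamma> t)))"

definition self_concordant ::
  "'a::euclidean_space set \<Rightarrow> 'a metric_tensor \<Rightarrow> real \<Rightarrow> ('a \<Rightarrow> real) \<Rightarrow> bool" where
  "self_concordant U G \<alpha> f \<longleftrightarrow> \<alpha> > 0 \<and> smooth_on U f \<and> geodesically_convex_on U G f \<and>
     (\<forall>p\<in>U. \<forall>u v w. \<bar>nabla3 G f p u v w\<bar> \<le> 2 / sqrt \<alpha> *
        sqrt (hessian G f p u u) * sqrt (hessian G f p v v) * sqrt (hessian G f p w w))"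

definition self_concordant_along_geodesics ::
  "'a::euclidean_space set \<Rightarrow> 'a metric_tensor \<Rightarrow> real \<Rightarrow> ('a \<Rightarrow> real) \<Rightarrow> bool" where
  "self_concordant_along_geodesics U G \<alpha> f \<longleftrightarrow>
     \<alpha> > 0 \<and> smooth_on U f \<and> geodesically_convex_on U G f \<and>
     (\<forall>p\<in>U. \<forall>u. \<bar>nabla3 G f p u u u\<bar> \<le> 2 / sqrt \<alpha> * hessian G f p u u powr (3/2))"


section \<open>The model space of constant sectional curvature \<open>-\<kappa>\<close>\<close>

text \<open>
  Curvature operator \<open>R(u,v)w = \<nabla>\<^sub>u\<nabla>\<^sub>v w - \<nabla>\<^sub>v\<nabla>\<^sub>u w\<close>, evaluated on coordinate vector fields
  (whose Lie brackets vanish).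
\<close>

definition curvature :: "'a::euclidean_space metric_tensor \<Rightarrow> 'a \<Rightarrow> 'a \<Rightarrow> 'a \<Rightarrow> 'a \<Rightarrow> 'a" where
  "curvature G p u v w =
     frechet_derivative (\<lambda>x. levi_civita G x v w) (at p) u
       - frechet_derivative (\<lambda>x. levi_civita G x u w) (at p) v
       + levi_civita G p u (levi_civita G p v w) - levi_civita G p v (levi_civita G p u w)"

definition const_sectional_curvature ::
  "'a::euclidean_space set \<Rightarrow> 'a metric_tensor \<Rightarrow> real \<Rightarrow> bool" where
  "const_sectional_curvature U G K \<longleftrightarrow> (\<forall>p\<in>U. \<forall>u v.
     G p (curvature G p u v v) u = K * (G p u u * G p v v - (G p u v)\<^sup>2))"

definition riem_complete :: "'a::euclidean_space set \<Rightarrow> 'a metric_tensor \<Rightarrow> bool" where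
  "riem_complete U G \<longleftrightarrow> (\<forall>X::nat \<Rightarrow> 'a. (\<forall>n. X n \<in> U) \<and>
     (\<forall>e>0. \<exists>N. \<forall>m\<ge>N. \<forall>n\<ge>N. riem_dist U G (X m) (X n) < e)
     \<longrightarrow> (\<exists>l\<in>U. (\<lambda>n. riem_dist U G (X n) l) \<longlonglongrightarrow> 0))"

text \<open>
  The model space is realised as the Poincare ball: the open unit ball with the metric of
  \<open>\<H>\<^sup>n\<close> scaled by \<open>1/\<kappa>\<close>. The lemma \<open>model_space_characterisation\<close> below confirms that this is a simply
  connected complete Riemannian manifold of constant sectional curvature \<open>-\<kappa>\<close>; such a
  manifold is unique up to isometry.
\<close>

definition model_carrier :: "'a::euclidean_space set" where
  "model_carrier = ball 0 1"

definition model_metric :: "real \<Rightarrow> 'a::euclidean_space metric_tensor" where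
  "model_metric \<kappa> p u v = 4 / (\<kappa> * (1 - (norm p)\<^sup>2)\<^sup>2) * (u \<bullet> v)"

subsection \<open>The Poincare ball is the model space\<close>

lemma levi_civita_eqI:
  assumes G: "bilinear (G p)" "\<And>u v. G p u v = G p v u" "\<And>u. u \<noteq> 0 \<Longrightarrow> G p u u > 0"
    and B: "is_levi_civita G p B"
  shows "levi_civita G p = B"
  unfolding levi_civita_def
proof (rule the_equality[where a = B])
  fix C assume C: "is_levi_civita G p C"
  have add: "G p (x + y) z = G p x z + G p y z" for x y z
    using G(1) by (simp add: bilinear_def linear_iff)
  have koszul: "2 * G p (A u v) w = frechet_derivative (\<lambda>x. G x v w) (at p) u
      + frechet_derivative (\<lambda>x. G x u w) (at p) v - frechet_derivative (\<lambda>x. G x u v) (at p) w"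
    if "is_levi_civita G p A" for A u v w
  proof -
    have s: "A x y = A y x" and c: "frechet_derivative (\<lambda>x. G x b c) (at p) a
         = G p (A a b) c + G p b (A a c)" for x y a b c
      using that unfolding is_levi_civita_def by blast+
    show ?thesis
      unfolding c using s[of v u] s[of w u] s[of w v]
        G(2)[of v "A u w"] G(2)[of u "A v w"] by simp
  qed
  show "C = B"
  proof (intro ext)
    fix u v
    have "G p (C u v) w = G p (B u v) w" for w
      using koszul[OF B, of u v w] koszul[OF C, of u v w] by simp
    then have "G p (C u v - B u v) (C u v - B u v) = 0"
      using add[of "C u v - B u v" "B u v" "C u v - B u v"] by simp
    then show "C u v = B u v"
      using G(3)[of "C u v - B u v"] by (metis eq_iff_diff_eq_0 less_irrefl)
  qed
qed (rule B)

definition poincare_christoffel :: "'a::euclidean_space \<Rightarrow> 'a \<Rightarrow> 'a \<Rightarrow> 'a" where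
  "poincare_christoffel p u v =
     (2 / (1 - p \<bullet> p)) *\<^sub>R ((p \<bullet> u) *\<^sub>R v + (p \<bullet> v) *\<^sub>R u - (u \<bullet> v) *\<^sub>R p)"

lemma ball_norm_pos: "p \<in> ball 0 1 \<Longrightarrow> 1 - p \<bullet> p > 0" for p :: "'a::euclidean_space"
  by (simp add: dot_square_norm power_less_one_iff)

lemma model_metric_alt: "model_metric \<kappa> p u v = 4 / \<kappa> * (inverse (1 - p \<bullet> p))\<^sup>2 * (u \<bullet> v)"
  by (simp add: model_metric_def dot_square_norm field_simps)

lemma bilinear_model_metric: "bilinear (model_metric \<kappa> p)"
  unfolding model_metric_alt bilinear_def
  by (auto intro!: linearI simp: inner_add_left inner_add_right distrib_left add_divide_distrib)

lemma model_metric_pos: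
  assumes "\<kappa> > 0" "p \<in> ball 0 1" "u \<noteq> 0"
  shows "model_metric \<kappa> p u u > 0"
  using assms ball_norm_pos[OF assms(2)] by (simp add: model_metric_alt)

lemma has_derivative_conformal_factor:
  fixes p :: "'a::euclidean_space"
  assumes "p \<in> ball 0 1"
  shows "((\<lambda>x. inverse (1 - x \<bullet> x)) has_derivative
    (\<lambda>u. 2 * (p \<bullet> u) * (inverse (1 - p \<bullet> p))\<^sup>2)) (at p)"
proof -
  have "1 - p \<bullet> p \<noteq> 0" using ball_norm_pos[OF assms] by simp
  then show ?thesis
    by (auto intro!: derivative_eq_intros simp: fun_eq_iff inner_commute power2_eq_square)
qed

lemma levi_civita_model_metric:
  assumes "\<kappa> > 0" "p \<in> ball 0 1"
  shows "levi_civita (model_metric \<kappa>) p = poincare_christoffel p"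
proof (rule levi_civita_eqI)
  note pos = ball_norm_pos[OF assms(2)]
  show "bilinear (model_metric \<kappa> p)" by (rule bilinear_model_metric)
  show "model_metric \<kappa> p u v = model_metric \<kappa> p v u" for u v
    by (simp add: model_metric_def inner_commute)
  show "model_metric \<kappa> p u u > 0" if "u \<noteq> 0" for u
    using model_metric_pos assms that by blast
  have der: "((\<lambda>x. model_metric \<kappa> x v w) has_derivative
      (\<lambda>u. 16 / \<kappa> * (p \<bullet> u) * (inverse (1 - p \<bullet> p)) ^ 3 * (v \<bullet> w))) (at p)" for v w
    unfolding model_metric_alt
    by (rule derivative_eq_intros has_derivative_conformal_factor[OF assms(2)] refl)+
       (simp add: fun_eq_iff power2_eq_square power3_eq_cube)
  show "is_levi_civita (model_metric \<kappa>) p (poincare_christoffel p)"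
    unfolding is_levi_civita_def
  proof (intro conjI allI)
    show "bilinear (poincare_christoffel p)"
      unfolding bilinear_def
      by (auto intro!: linearI simp: poincare_christoffel_def algebra_simps add_divide_distrib)
    show "poincare_christoffel p u v = poincare_christoffel p v u" for u v
      by (simp add: poincare_christoffel_def inner_commute algebra_simps)
    fix u v w
    have "frechet_derivative (\<lambda>x. model_metric \<kappa> x v w) (at p) u
        = 16 / \<kappa> * (p \<bullet> u) * (inverse (1 - p \<bullet> p)) ^ 3 * (v \<bullet> w)"
      using frechet_derivative_at[OF der] by metis
    also have "\<dots> = model_metric \<kappa> p (poincare_christoffel p u v) w
        + model_metric \<kappa> p v (poincare_christoffel p u w)"
    proof -
      define j where "j = inverse (1 - p \<bullet> p)"
      define k where "k = inverse \<kappa>"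
      show ?thesis
        unfolding model_metric_alt poincare_christoffel_def divide_inverse
          j_def[symmetric] k_def[symmetric]
          inner_add_right inner_diff_right inner_scaleR_right
          inner_add_left inner_diff_left inner_scaleR_left
          inner_commute[of v u] inner_commute[of v p] inner_commute[of u p] inner_commute[of w p]
          inner_commute[of w u] inner_commute[of w v]
        by (simp add: algebra_simps power2_eq_square power3_eq_cube)
    qed
    finally show "frechet_derivative (\<lambda>x. model_metric \<kappa> x v w) (at p) u
        = model_metric \<kappa> p (poincare_christoffel p u v) w
        + model_metric \<kappa> p v (poincare_christoffel p u w)" .
  qed
qed

lemma curvature_model_metric:
  fixes p :: "'a::euclidean_space"
  assumes "\<kappa> > 0" "p \<in> ball 0 1"
  shows "curvature (model_metric \<kappa>) p u v v
    = (4 * (inverse (1 - p \<bullet> p))\<^sup>2) *\<^sub>R ((u \<bullet> v) *\<^sub>R v - (v \<bullet> v) *\<^sub>R u)"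
proof -
  let ?i = "inverse (1 - p \<bullet> p)"
  have der: "((\<lambda>x. levi_civita (model_metric \<kappa>) x v w) has_derivative
      (\<lambda>u. (4 * (p \<bullet> u) * ?i\<^sup>2) *\<^sub>R ((p \<bullet> v) *\<^sub>R w + (p \<bullet> w) *\<^sub>R v - (v \<bullet> w) *\<^sub>R p)
         + (2 * ?i) *\<^sub>R ((u \<bullet> v) *\<^sub>R w + (u \<bullet> w) *\<^sub>R v - (v \<bullet> w) *\<^sub>R u))) (at p)"
    (is "(_ has_derivative ?D v w) _") for v w
  proof -
    have "((\<lambda>x. poincare_christoffel x v w) has_derivative ?D v w) (at p)"
      unfolding poincare_christoffel_def divide_inverse
      by (rule derivative_eq_intros has_derivative_conformal_factor[OF assms(2)] refl)+
         (simp add: fun_eq_iff algebra_simps power2_eq_square)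
    then show ?thesis
      by (rule has_derivative_transform_within_open[of _ _ p UNIV "ball 0 1"])
         (use assms in \<open>simp_all add: levi_civita_model_metric\<close>)
  qed
  have D: "frechet_derivative (\<lambda>x. levi_civita (model_metric \<kappa>) x v w) (at p) u = ?D v w u" for u v w
    by (simp only: frechet_derivative_at[OF der, symmetric])
  have "z \<bullet> curvature (model_metric \<kappa>) p u v v
      = z \<bullet> ((4 * ?i\<^sup>2) *\<^sub>R ((u \<bullet> v) *\<^sub>R v - (v \<bullet> v) *\<^sub>R u))" for z
  proof -
    define j q where "j = ?i" and "q = p \<bullet> p"
    have jq: "j * q = j - 1" using ball_norm_pos[OF assms(2)] by (simp add: j_def q_def field_simps)
    then have jq': "j * (q * x) = j * x - x" for x by (simp add: mult.assoc[symmetric] left_diff_distrib)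
    show ?thesis
      unfolding curvature_def D levi_civita_model_metric[OF assms] poincare_christoffel_def divide_inverse
        j_def[symmetric]
        inner_add_right inner_diff_right inner_scaleR_right inner_add_left inner_diff_left inner_scaleR_left
      unfolding q_def[symmetric] inner_commute[of v u] inner_commute[of u p] inner_commute[of v p]
      by (simp add: algebra_simps power2_eq_square jq jq')
  qed
  then show ?thesis using vector_eq_ldot by blast
qed

lemma Ck_on_cong:
  assumes "open U" "\<And>x. x \<in> U \<Longrightarrow> f x = g x" "Ck_on k U f"
  shows "Ck_on k U g"
  using assms(2,3)
proof (induction k arbitrary: f g)
  case 0
  then show ?case by (simp cong: continuous_on_cong_simp)
next
  case (Suc k)
  have der: "(g has_derivative frechet_derivative f (at x)) (at x)" if "x \<in> U" for x
    using has_derivative_transform_within_open[of f _ x UNIV U g] Suc.prems that assms(1)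
    by (metis Ck_on.simps(2) frechet_derivative_works)
  then have "frechet_derivative g (at x) = frechet_derivative f (at x)" if "x \<in> U" for x
    using that frechet_derivative_at by metis
  then have "Ck_on k U (\<lambda>x. frechet_derivative g (at x) v)" for v
    using Suc.IH[of "\<lambda>x. frechet_derivative f (at x) v" "\<lambda>x. frechet_derivative g (at x) v"] Suc.prems
    by auto
  then show ?case using der by (auto intro: differentiableI)
qed

lemma Ck_on_SucI:
  assumes "open U" "\<And>x. x \<in> U \<Longrightarrow> (f has_derivative f' x) (at x)" "\<And>v. Ck_on k U (\<lambda>x. f' x v)"
  shows "Ck_on (Suc k) U f"
proof -
  have "frechet_derivative f (at x) = f' x" if "x \<in> U" for x
    using frechet_derivative_at[OF assms(2)[OF that]] by simp
  then have "Ck_on k U (\<lambda>x. frechet_derivative f (at x) v)" for v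
    using Ck_on_cong[OF assms(1), of "\<lambda>x. f' x v"] assms(3) by auto
  then show ?thesis using assms(2) by (auto intro: differentiableI)
qed

lemma Ck_on_SucD: "Ck_on (Suc k) U f \<Longrightarrow> Ck_on k U f"
proof (induction k arbitrary: f)
  case 0
  then show ?case
    by (auto intro!: differentiable_imp_continuous_on differentiable_at_imp_differentiable_on)
next
  case (Suc k)
  then show ?case by (metis Ck_on.simps(2))
qed

lemma Ck_on_const: "open U \<Longrightarrow> Ck_on k U (\<lambda>x. c)"
proof (induction k arbitrary: c)
  case (Suc k)
  show ?case
    by (rule Ck_on_SucI[where f' = "\<lambda>x v. 0"]) (use Suc in auto)
qed simp

lemma Ck_on_inner: "open U \<Longrightarrow> Ck_on k U (\<lambda>x. x \<bullet> v)"
proof (cases k)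
  case (Suc m)
  assume "open U"
  then show ?thesis unfolding Suc
    by (intro Ck_on_SucI[where f' = "\<lambda>x u. u \<bullet> v"] Ck_on_const)
       (auto intro!: derivative_eq_intros)
qed (auto intro!: continuous_intros)

lemma Ck_on_add: "open U \<Longrightarrow> Ck_on k U f \<Longrightarrow> Ck_on k U g \<Longrightarrow> Ck_on k U (\<lambda>x. f x + g x)"
proof (induction k arbitrary: f g)
  case (Suc k)
  show ?case
    by (rule Ck_on_SucI[where f' = "\<lambda>x v. frechet_derivative f (at x) v + frechet_derivative g (at x) v"])
       (use Suc in \<open>auto intro!: has_derivative_add simp: frechet_derivative_works[symmetric]\<close>)
qed (auto intro!: continuous_intros)

lemma Ck_on_mult: "open U \<Longrightarrow> Ck_on k U f \<Longrightarrow> Ck_on k U g \<Longrightarrow> Ck_on k U (\<lambda>x. f x * g x)"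
proof (induction k arbitrary: f g)
  case (Suc k)
  have "Ck_on k U f" "Ck_on k U g" using Suc.prems Ck_on_SucD by blast+
  then show ?case
    by (intro Ck_on_SucI[where f' = "\<lambda>x v. f x * frechet_derivative g (at x) v + frechet_derivative f (at x) v * g x"] Ck_on_add)
       (use Suc in \<open>auto intro!: has_derivative_mult simp: frechet_derivative_works[symmetric]\<close>)
qed (auto intro!: continuous_intros)

lemma Ck_on_conformal_factor: "Ck_on k (ball 0 1) (\<lambda>x::'a::euclidean_space. inverse (1 - x \<bullet> x))"
proof (induction k)
  case 0
  have "1 - x \<bullet> x \<noteq> 0" if "x \<in> ball 0 1" for x :: 'a using ball_norm_pos[OF that] by simp
  then show ?case by (auto intro!: continuous_intros)
next
  case (Suc k)
  show ?case
    unfolding power2_eq_square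
    by (rule Ck_on_SucI[OF _ has_derivative_conformal_factor])
       (auto simp: power2_eq_square intro!: Ck_on_mult Ck_on_const Ck_on_inner Suc)
qed

lemma riemannian_model_metric:
  assumes "\<kappa> > 0"
  shows "riemannian_metric_on (model_carrier :: 'a::euclidean_space set) (model_metric \<kappa>)"
proof -
  have "Ck_on k (ball 0 1) (\<lambda>p::'a. model_metric \<kappa> p u v)" for k u v
    unfolding model_metric_alt power2_eq_square
    by (intro Ck_on_mult Ck_on_const Ck_on_conformal_factor) auto
  then show ?thesis
    unfolding riemannian_metric_on_def model_carrier_def smooth_on_def
    using bilinear_model_metric model_metric_pos[OF assms]
    by (auto simp: model_metric_def inner_commute)
qed

lemma const_curvature_model_metric:
  assumes "\<kappa> > 0"
  shows "const_sectional_curvature (model_carrier :: 'a::euclidean_space set) (model_metric \<kappa>) (- \<kappa>)"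
  unfolding const_sectional_curvature_def model_carrier_def
proof (intro ballI allI)
  fix p u v :: 'a assume p: "p \<in> ball 0 1"
  have \<kappa>: "\<kappa> * (inverse \<kappa> * y) = y" for y using assms by simp
  show "model_metric \<kappa> p (curvature (model_metric \<kappa>) p u v v) u
      = - \<kappa> * (model_metric \<kappa> p u u * model_metric \<kappa> p v v - (model_metric \<kappa> p u v)\<^sup>2)"
    unfolding curvature_model_metric[OF assms p] unfolding model_metric_alt
      inner_scaleR_left inner_diff_left inner_commute[of v u]
    by (simp add: divide_inverse algebra_simps power2_eq_square \<kappa>)
qed

lemma has_riem_length_lower_bound:
  fixes \<psi> :: "'a::euclidean_space \<Rightarrow> 'b::euclidean_space"
  assumes \<psi>: "\<And>x. x \<in> U \<Longrightarrow> (\<psi> has_derivative \<psi>' x) (at x)"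
    and bound: "\<And>x v. x \<in> U \<Longrightarrow> norm (\<psi>' x v) \<le> C * riem_norm G x v"
    and \<gamma>: "valid_path \<gamma>" "path_image \<gamma> \<subseteq> U" "has_riem_length G \<gamma> L"
  shows "norm (\<psi> (pathfinish \<gamma>) - \<psi> (pathstart \<gamma>)) \<le> C * L"
proof -
  obtain S where S: "finite S" "\<gamma> C1_differentiable_on {0..1} - S" "continuous_on {0..1} \<gamma>"
    using \<gamma>(1) unfolding valid_path_def piecewise_C1_differentiable_on_def by blast
  have U: "\<gamma> t \<in> U" if "t \<in> {0..1}" for t using \<gamma>(2) that by (auto simp: path_image_def)
  let ?f = "\<lambda>t. \<psi>' (\<gamma> t) (vector_derivative \<gamma> (at t))"
  have "continuous_on U \<psi>"
    by (meson \<psi> continuous_at_imp_continuous_on has_derivative_continuous)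
  then have cont: "continuous_on {0..1} (\<psi> \<circ> \<gamma>)"
    using S(3) U by (intro continuous_on_compose) (auto elim: continuous_on_subset)
  have "((\<psi> \<circ> \<gamma>) has_vector_derivative ?f t) (at t)" if "t \<in> {0<..<1} - S" for t
  proof -
    have "(\<gamma> has_vector_derivative vector_derivative \<gamma> (at t)) (at t)"
      using S(2) that by (auto simp: C1_differentiable_on_eq vector_derivative_works)
    then have "((\<psi> \<circ> \<gamma>) has_derivative (\<lambda>x. \<psi>' (\<gamma> t) (x *\<^sub>R vector_derivative \<gamma> (at t)))) (at t)"
      using diff_chain_at[of \<gamma> "\<lambda>x. x *\<^sub>R vector_derivative \<gamma> (at t)" t \<psi> "\<psi>' (\<gamma> t)"] \<psi>[OF U, of t] that
      unfolding has_vector_derivative_def by (auto simp: o_def)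
    moreover have "linear (\<psi>' (\<gamma> t))" using \<psi>[OF U, of t] that has_derivative_linear by auto
    ultimately show ?thesis unfolding has_vector_derivative_def by (simp add: linear_scale)
  qed
  then have int: "(?f has_integral (\<psi> \<circ> \<gamma>) 1 - (\<psi> \<circ> \<gamma>) 0) {0..1}"
    by (intro fundamental_theorem_of_calculus_interior_strong[OF S(1) _ _ cont]) auto
  have len: "((\<lambda>t. C * riem_norm G (\<gamma> t) (vector_derivative \<gamma> (at t))) has_integral C * L) {0..1}"
    using \<gamma>(3) unfolding has_riem_length_def by (rule has_integral_mult_right)
  have "norm (integral {0..1} ?f) \<le> integral {0..1} (\<lambda>t. C * riem_norm G (\<gamma> t) (vector_derivative \<gamma> (at t)))"
    using int len U bound by (intro integral_norm_bound_integral) (auto simp: has_integral_integrable)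
  then show ?thesis
    unfolding integral_unique[OF int] integral_unique[OF len]
    by (simp add: pathstart_def pathfinish_def)
qed

lemma riem_norm_model_metric:
  assumes "\<kappa> > 0" "p \<in> ball 0 1"
  shows "riem_norm (model_metric \<kappa>) p u = 2 / sqrt \<kappa> * inverse (1 - p \<bullet> p) * norm u"
proof -
  have "model_metric \<kappa> p u u = (2 / sqrt \<kappa> * inverse (1 - p \<bullet> p) * norm u)\<^sup>2"
    using assms(1) by (simp only: model_metric_alt power_mult_distrib power_divide dot_square_norm real_sqrt_pow2 less_imp_le) simp
  then show ?thesis
    using assms(1) ball_norm_pos[OF assms(2)] by (simp add: riem_norm_def real_sqrt_abs)
qed

lemma linepath_model_length:
  assumes "\<kappa> > 0" "x \<in> ball 0 1" "y \<in> ball 0 1"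
  obtains L where "has_riem_length (model_metric \<kappa>) (linepath x y) L"
    "\<And>r. 0 \<le> r \<Longrightarrow> r < 1 \<Longrightarrow> norm x \<le> r \<Longrightarrow> norm y \<le> r \<Longrightarrow> L \<le> 2 / sqrt \<kappa> * inverse (1 - r\<^sup>2) * norm (y - x)"
proof -
  let ?g = "\<lambda>t. 2 / sqrt \<kappa> * inverse (1 - linepath x y t \<bullet> linepath x y t) * norm (y - x)"
  have seg: "linepath x y t \<in> ball 0 1" if "t \<in> {0..1}" for t
    using linepath_in_path[OF that, of x y] closed_segment_subset[OF assms(2,3) convex_ball] by blast
  have nz: "1 - linepath x y t \<bullet> linepath x y t \<noteq> 0" if "t \<in> {0..1}" for t
    using ball_norm_pos[OF seg[OF that]] by simp
  have "continuous_on {0..1} ?g"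
    using nz assms(1) by (auto intro!: continuous_intros)
  then have intg: "?g integrable_on {0..1}" by (rule integrable_continuous_interval)
  have eq: "riem_norm (model_metric \<kappa>) (linepath x y t) (vector_derivative (linepath x y) (at t)) = ?g t"
    if "t \<in> {0..1}" for t
    unfolding riem_norm_model_metric[OF assms(1) seg[OF that]] vector_derivative_linepath_at ..
  have L: "has_riem_length (model_metric \<kappa>) (linepath x y) (integral {0..1} ?g)"
    unfolding has_riem_length_def
    by (intro has_integral_eq[OF eq[symmetric]] integrable_integral intg)
  show thesis
  proof (rule that[OF L])
    fix r :: real assume r: "0 \<le> r" "r < 1" "norm x \<le> r" "norm y \<le> r"
    have "?g t \<le> 2 / sqrt \<kappa> * inverse (1 - r\<^sup>2) * norm (y - x)" if "t \<in> {0..1}" for t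
    proof -
      have "linepath x y t \<in> cball 0 r"
        using linepath_in_path[OF that, of x y] closed_segment_subset[OF _ _ convex_cball, of x 0 r y] r
        by auto
      then have "linepath x y t \<bullet> linepath x y t \<le> r\<^sup>2"
        by (simp add: dot_square_norm power_mono)
      moreover have "r\<^sup>2 < 1" using r by (simp add: power_less_one_iff)
      ultimately have "inverse (1 - linepath x y t \<bullet> linepath x y t) \<le> inverse (1 - r\<^sup>2)"
        by (intro le_imp_inverse_le) auto
      then show ?thesis using assms(1) by (intro mult_right_mono mult_left_mono) simp_all
    qed
    then have "integral {0..1} ?g \<le> integral {0..1} (\<lambda>t::real. 2 / sqrt \<kappa> * inverse (1 - r\<^sup>2) * norm (y - x))"
      by (intro integral_le intg) auto
    also have "\<dots> = 2 / sqrt \<kappa> * inverse (1 - r\<^sup>2) * norm (y - x)"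
      by (simp only: integral_const_real) simp
    finally show "integral {0..1} ?g \<le> 2 / sqrt \<kappa> * inverse (1 - r\<^sup>2) * norm (y - x)" .
  qed
qed

lemma riem_dist_le:
  assumes "valid_path \<gamma>" "path_image \<gamma> \<subseteq> U" "has_riem_length G \<gamma> L"
    and "\<And>p u. p \<in> U \<Longrightarrow> G p u u \<ge> 0"
  shows "riem_dist U G (pathstart \<gamma>) (pathfinish \<gamma>) \<le> L"
  unfolding riem_dist_def
proof (rule cInf_lower)
  show "bdd_below {L. \<exists>\<gamma>'. valid_path \<gamma>' \<and> path_image \<gamma>' \<subseteq> U \<and>
     pathstart \<gamma>' = pathstart \<gamma> \<and> pathfinish \<gamma>' = pathfinish \<gamma> \<and> has_riem_length G \<gamma>' L}"
  proof (rule bdd_belowI[of _ 0], elim CollectE exE conjE)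
    fix L' \<gamma>' assume \<gamma>': "path_image \<gamma>' \<subseteq> U" "has_riem_length G \<gamma>' L'"
    have "riem_norm G (\<gamma>' t) (vector_derivative \<gamma>' (at t)) \<ge> 0" if "t \<in> {0..1}" for t
    proof -
      have "\<gamma>' t \<in> U" using \<gamma>'(1) that by (auto simp: path_image_def)
      then show ?thesis unfolding riem_norm_def using assms(4) by simp
    qed
    then show "0 \<le> L'" using \<gamma>'(2) has_integral_nonneg unfolding has_riem_length_def by blast
  qed
qed (use assms in blast)

lemma model_linepath_admissible:
  assumes "x \<in> ball 0 1" "y \<in> ball 0 1"
  shows "valid_path (linepath x y)" "path_image (linepath x y) \<subseteq> ball 0 (1::real)"
  using assms closed_segment_subset[OF assms convex_ball] by (auto simp: valid_path_linepath)

lemma model_dist_le: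
  assumes "\<kappa> > 0" "0 \<le> r" "r < 1" "norm x \<le> r" "norm y \<le> r"
  shows "riem_dist (ball 0 1) (model_metric \<kappa>) x y \<le> 2 / sqrt \<kappa> * inverse (1 - r\<^sup>2) * norm (y - x)"
proof -
  have xy: "x \<in> ball 0 1" "y \<in> ball 0 1" using assms by auto
  obtain L where L: "has_riem_length (model_metric \<kappa>) (linepath x y) L"
      "L \<le> 2 / sqrt \<kappa> * inverse (1 - r\<^sup>2) * norm (y - x)"
    by (rule linepath_model_length[OF assms(1) xy]) (use assms in blast)
  have "model_metric \<kappa> p u u \<ge> 0" for p u :: 'a using assms(1) by (simp add: model_metric_alt)
  then show ?thesis
    using riem_dist_le[OF model_linepath_admissible[OF xy] L(1)] L(2) by simp
qed

lemma model_dist_ge: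
  fixes \<psi> :: "'a::euclidean_space \<Rightarrow> 'b::euclidean_space"
  assumes "\<kappa> > 0" "C > 0" "x \<in> ball 0 1" "y \<in> ball 0 1"
    and \<psi>: "\<And>x. x \<in> ball 0 1 \<Longrightarrow> (\<psi> has_derivative \<psi>' x) (at x)"
    and bound: "\<And>x v. x \<in> ball 0 1 \<Longrightarrow> norm (\<psi>' x v) \<le> C * riem_norm (model_metric \<kappa>) x v"
  shows "norm (\<psi> y - \<psi> x) \<le> C * riem_dist (ball 0 1) (model_metric \<kappa>) x y"
proof -
  have "norm (\<psi> y - \<psi> x) / C \<le> riem_dist (ball 0 1) (model_metric \<kappa>) x y"
    unfolding riem_dist_def
  proof (rule cInf_greatest)
    obtain L where "has_riem_length (model_metric \<kappa>) (linepath x y) L"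
      by (rule linepath_model_length[OF assms(1,3,4)])
    then show "{L. \<exists>\<gamma>. valid_path \<gamma> \<and> path_image \<gamma> \<subseteq> ball 0 1 \<and>
        pathstart \<gamma> = x \<and> pathfinish \<gamma> = y \<and> has_riem_length (model_metric \<kappa>) \<gamma> L} \<noteq> {}"
      using model_linepath_admissible[OF assms(3,4)] pathstart_linepath pathfinish_linepath by blast
  next
    fix L assume "L \<in> {L. \<exists>\<gamma>. valid_path \<gamma> \<and> path_image \<gamma> \<subseteq> ball 0 1 \<and>
        pathstart \<gamma> = x \<and> pathfinish \<gamma> = y \<and> has_riem_length (model_metric \<kappa>) \<gamma> L}"
    then show "norm (\<psi> y - \<psi> x) / C \<le> L"
      using has_riem_length_lower_bound[of "ball 0 1" \<psi> \<psi>', OF \<psi> bound] assms(2)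
      by (auto simp: pos_divide_le_eq mult.commute[of _ C])
  qed
  then show ?thesis using assms(2) by (simp add: field_simps)
qed

lemma model_dist_ge_euclidean:
  assumes "\<kappa> > 0" "x \<in> ball 0 1" "y \<in> ball 0 1"
  shows "norm (y - x) \<le> sqrt \<kappa> / 2 * riem_dist (ball 0 1) (model_metric \<kappa>) x y"
proof (rule model_dist_ge[where \<psi> = "\<lambda>x. x" and \<psi>' = "\<lambda>x v. v"])
  fix x v :: 'a assume x: "x \<in> ball 0 1"
  have "1 \<le> inverse (1 - x \<bullet> x)"
    using ball_norm_pos[OF x] by (intro one_le_inverse) auto
  then have "norm v \<le> inverse (1 - x \<bullet> x) * norm v"
    using mult_right_mono[of 1 "inverse (1 - x \<bullet> x)" "norm v"] by simp
  then show "norm v \<le> sqrt \<kappa> / 2 * riem_norm (model_metric \<kappa>) x v"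
    using assms(1) unfolding riem_norm_model_metric[OF assms(1) x] by simp
qed (use assms in auto)

lemma model_dist_ge_log:
  assumes "\<kappa> > 0" "x \<in> ball 0 1" "y \<in> ball 0 1"
  shows "\<bar>ln (1 - y \<bullet> y) - ln (1 - x \<bullet> x)\<bar> \<le> sqrt \<kappa> * riem_dist (ball 0 1) (model_metric \<kappa>) x y"
proof -
  have "norm (ln (1 - y \<bullet> y) - ln (1 - x \<bullet> x)) \<le> sqrt \<kappa> * riem_dist (ball 0 1) (model_metric \<kappa>) x y"
  proof (rule model_dist_ge[where \<psi> = "\<lambda>x. ln (1 - x \<bullet> x)" and \<psi>' = "\<lambda>x v. - 2 * (x \<bullet> v) * inverse (1 - x \<bullet> x)"])
    fix x v :: 'a assume x: "x \<in> ball 0 1"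
    note pos = ball_norm_pos[OF x]
    show "((\<lambda>x. ln (1 - x \<bullet> x)) has_derivative (\<lambda>v. - 2 * (x \<bullet> v) * inverse (1 - x \<bullet> x))) (at x)"
      using pos by (auto intro!: derivative_eq_intros simp: fun_eq_iff inner_commute divide_inverse)
    have "\<bar>x \<bullet> v\<bar> \<le> norm x * norm v" by (rule Cauchy_Schwarz_ineq2)
    also have "\<dots> \<le> norm v" using x mult_right_mono[of "norm x" 1 "norm v"] by simp
    finally have "\<bar>x \<bullet> v\<bar> * inverse (1 - x \<bullet> x) \<le> norm v * inverse (1 - x \<bullet> x)"
      using pos by (intro mult_right_mono) auto
    then show "norm (- 2 * (x \<bullet> v) * inverse (1 - x \<bullet> x)) \<le> sqrt \<kappa> * riem_norm (model_metric \<kappa>) x v"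
      using assms(1) pos unfolding riem_norm_model_metric[OF assms(1) x]
      by (simp add: abs_mult)
  qed (use assms in auto)
  then show ?thesis by simp
qed

lemma complete_model_metric:
  assumes "\<kappa> > 0"
  shows "riem_complete (model_carrier :: 'a::euclidean_space set) (model_metric \<kappa>)"
  unfolding riem_complete_def model_carrier_def
proof (intro allI impI, elim conjE)
  let ?d = "riem_dist (ball 0 1) (model_metric \<kappa> :: 'a metric_tensor)"
  fix X :: "nat \<Rightarrow> 'a"
  assume X: "\<forall>n. X n \<in> ball 0 1"
    and cauchy: "\<forall>e>0. \<exists>N. \<forall>m\<ge>N. \<forall>n\<ge>N. ?d (X m) (X n) < e"
  have "Cauchy X"
  proof (rule metric_CauchyI)
    fix e :: real assume "e > 0"
    then have "2 * e / sqrt \<kappa> > 0" using assms by simp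
    then obtain N where N: "\<forall>m\<ge>N. \<forall>n\<ge>N. ?d (X m) (X n) < 2 * e / sqrt \<kappa>" using cauchy by blast
    have "dist (X m) (X n) < e" if "m \<ge> N" "n \<ge> N" for m n
    proof -
      have "norm (X n - X m) \<le> sqrt \<kappa> / 2 * ?d (X m) (X n)"
        using model_dist_ge_euclidean[OF assms] X by blast
      also have "\<dots> < sqrt \<kappa> / 2 * (2 * e / sqrt \<kappa>)"
        using N that assms by (intro mult_strict_left_mono) auto
      also have "\<dots> = e" using assms by simp
      finally show ?thesis by (simp add: dist_norm norm_minus_commute)
    qed
    then show "\<exists>M. \<forall>m\<ge>M. \<forall>n\<ge>M. dist (X m) (X n) < e" by blast
  qed
  then obtain l where l: "X \<longlonglongrightarrow> l" using Cauchy_convergent_iff convergent_def by blast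
  obtain N where N: "\<forall>m\<ge>N. \<forall>n\<ge>N. ?d (X m) (X n) < 1" using cauchy zero_less_one by blast
  define A where "A = ln (1 - X N \<bullet> X N) - sqrt \<kappa>"
  have low: "exp A \<le> 1 - X n \<bullet> X n" if "n \<ge> N" for n
  proof -
    have "\<bar>ln (1 - X n \<bullet> X n) - ln (1 - X N \<bullet> X N)\<bar> \<le> sqrt \<kappa> * ?d (X N) (X n)"
      using model_dist_ge_log[OF assms] X by blast
    also have "\<dots> \<le> sqrt \<kappa> * 1" using N that assms by (intro mult_left_mono) (auto intro: less_imp_le)
    finally have "A \<le> ln (1 - X n \<bullet> X n)" by (simp add: A_def)
    then show ?thesis using X ball_norm_pos[of "X n"] by (simp add: ln_ge_iff)
  qed
  define r where "r = sqrt (1 - exp A)"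
  have "exp A \<le> 1" using low[of N] inner_ge_zero[of "X N"] by linarith
  then have r: "0 \<le> r" "r < 1" "r\<^sup>2 = 1 - exp A" by (auto simp: r_def)
  have nX: "norm (X n) \<le> r" if "n \<ge> N" for n
    unfolding r_def norm_eq_sqrt_inner using low[OF that] by simp
  have nl: "norm l \<le> r"
    using nX by (intro LIMSEQ_le_const2[OF tendsto_norm[OF l]]) auto
  show "\<exists>l\<in>ball 0 1. (\<lambda>n. ?d (X n) l) \<longlonglongrightarrow> 0"
  proof (rule bexI[of _ l])
    show "l \<in> ball 0 1" using nl r by simp
    let ?b = "\<lambda>n. 2 / sqrt \<kappa> * inverse (1 - r\<^sup>2) * norm (l - X n)"
    have lim: "?b \<longlonglongrightarrow> 2 / sqrt \<kappa> * inverse (1 - r\<^sup>2) * norm (l - l)"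
      by (intro tendsto_intros l)
    have up: "?d (X n) l \<le> ?b n" if "n \<ge> N" for n
      using model_dist_le[OF assms r(1,2) nX[OF that] nl] .
    have lo: "0 \<le> ?d (X n) l" for n
    proof -
      have "0 \<le> sqrt \<kappa> / 2 * ?d (X n) l"
        using model_dist_ge_euclidean[OF assms, of "X n" l] X \<open>l \<in> ball 0 1\<close>
        by (meson norm_ge_zero order_trans)
      then show ?thesis using assms by (simp add: zero_le_mult_iff)
    qed
    show "(\<lambda>n. ?d (X n) l) \<longlonglongrightarrow> 0"
      by (rule tendsto_sandwich[of "\<lambda>_. 0" _ _ ?b])
         (use lim up lo in \<open>auto simp: eventually_sequentially\<close>)
  qed
qed

lemma model_space_characterisation:
  assumes "\<kappa> > 0"
  shows "riemannian_metric_on (model_carrier :: 'a::euclidean_space set) (model_metric \<kappa>)"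
    and "simply_connected (model_carrier :: 'a set)"
    and "riem_complete (model_carrier :: 'a set) (model_metric \<kappa>)"
    and "const_sectional_curvature (model_carrier :: 'a set) (model_metric \<kappa>) (- \<kappa>)"
  using riemannian_model_metric complete_model_metric const_curvature_model_metric assms
  by (auto simp: model_carrier_def convex_imp_simply_connected)

end

theory Submission
  imports Defs
begin

text \<open>
  Let \<open>r = sqrt \<kappa> * d(p, p\<^sub>0)\<close>. On the hyperboloid, \<open>c = cosh r\<close> is the Lorentz product with a
  fixed point, and restrictions of linear functions satisfy \<open>\<nabla>\<^sup>2 c = \<kappa> c G\<close> and
  \<open>\<bar>dc\<bar>\<^sup>2 = \<kappa> (c\<^sup>2 - 1)\<close> (\<open>has_derivative_cosh_dist_grad\<close>, \<open>norm_cosh_dist_grad\<close>); the lemma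
  \<open>riem_dist_model\<close> identifies \<open>arcosh c / sqrt \<kappa>\<close> with the Riemannian distance. Since
  \<open>\<kappa> f = (arcosh c)\<^sup>2\<close> and \<open>(arcosh c)\<^sup>2\<close> is the inverse of the entire function \<open>cosh (sqrt y)\<close>, the
  function \<open>f\<close> is smooth also at \<open>p\<^sub>0\<close>, and its covariant derivatives follow from the chain rule.

  At \<open>p \<noteq> p\<^sub>0\<close> put \<open>a = dg(u)\<close>, \<open>b = dg(w)\<close>, and let \<open>P\<close>, \<open>Q\<close>, \<open>X\<close> be the products of the parts of
  \<open>u\<close> and \<open>w\<close> orthogonal to the radial direction: \<open>P\<close> of \<open>u\<close> with itself, \<open>Q\<close> of \<open>w\<close> with itself, \<open>X\<close>
  of \<open>w\<close> with \<open>u\<close>. With \<open>k = r coth r\<close>, \<open>k'\<close> its derivative and \<open>m = (k - 1) coth r\<close>, the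
  differential equations of \<open>(arcosh c)\<^sup>2\<close> give (\<open>hessian_radial\<close>, \<open>nabla3_radial\<close>)
    \<open>\<nabla>\<^sup>2 f(u,u) = 2 a\<^sup>2 + 2 k P\<close> and \<open>\<nabla>\<^sup>3 f(w,u,u) = 2 sqrt \<kappa> (k' b P - 2 m a X)\<close>,
  so that all estimates are statements about the three functions \<open>k\<close>, \<open>k'\<close>, \<open>m\<close> of \<open>r\<close>.

  The bound (i) is the Cauchy-Schwarz inequality together with \<open>2 m\<^sup>2 + k'\<^sup>2 \<le> 2 k\<^sup>2\<close>
  (\<open>coeff_square_bound\<close>, \<open>third_order_bound\<close>), which after the substitution \<open>x = 2 r\<close> follows from
  \<open>3 sinh x \<le> x (cosh x + 2)\<close>; polarisation then gives self-concordance for three different vectors.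
  The bound (ii) is the inequality of arithmetic and geometric means (\<open>cubic_amgm\<close>) and
  \<open>\<bar>2 m - k'\<bar> \<le> 2 k\<close>. The bound (iii) needs \<open>m \<le> k\<close> and \<open>k' \<le> 2 \<zeta> k\<close>, where \<open>\<zeta>\<close> enters
  through \<open>k' / k = 2 (1 / (2 r) - 1 / sinh (2 r))\<close>. The constants in (i) and (ii) are optimal because
  \<open>m / k \<longrightarrow> 1\<close> and \<open>k' / k \<longrightarrow> 0\<close> as \<open>r \<longrightarrow> \<infinity>\<close>, and because in this limit there are vectors for
  which both bounds become equalities; they exist as soon as some direction is orthogonal to the
  radial one (\<open>adapted_vectors\<close>).
\<close>

section \<open>Hyperbolic function inequalities\<close>

lemma nonneg_by_derivative:
  fixes h h' :: "real \<Rightarrow> real"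
  assumes "\<And>x. 0 \<le> x \<Longrightarrow> (h has_real_derivative h' x) (at x)" "\<And>x. 0 \<le> x \<Longrightarrow> 0 \<le> h' x"
    and "0 \<le> h 0" "0 \<le> x"
  shows "0 \<le> h x"
proof -
  have "h 0 \<le> h x"
    by (rule DERIV_nonneg_imp_nondecreasing[OF assms(4)]) (use assms in blast)
  then show ?thesis using assms(3) by simp
qed

lemma sinh_le_mult_cosh:
  fixes x :: real
  assumes "0 \<le> x"
  shows "sinh x \<le> x * cosh x"
proof -
  have "0 \<le> x * cosh x - sinh x"
    by (rule nonneg_by_derivative[where h' = "\<lambda>x. x * sinh x"])
       (use assms in \<open>auto intro!: derivative_eq_intros\<close>)
  then show ?thesis by simp
qed

lemma le_sinh:
  fixes x :: real
  assumes "0 \<le> x"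
  shows "x \<le> sinh x"
proof -
  have "0 \<le> sinh x - x"
    by (rule nonneg_by_derivative[where h' = "\<lambda>x. cosh x - 1"])
       (use assms cosh_real_ge_1 in \<open>auto intro!: derivative_eq_intros\<close>)
  then show ?thesis by simp
qed

text \<open>
  With \<open>x = 2 * r\<close> this is the inequality behind the constant \<open>8 / \<kappa>\<close>. The second derivative of
  the difference of the two sides is \<open>x * cosh x - sinh x\<close>.
\<close>

lemma three_sinh_le:
  fixes x :: real
  assumes "0 \<le> x"
  shows "3 * sinh x \<le> x * (cosh x + 2)"
proof -
  have first: "0 \<le> 2 - 2 * cosh y + y * sinh y" if "0 \<le> y" for y :: real
    by (rule nonneg_by_derivative[where h' = "\<lambda>x. x * cosh x - sinh x"])
       (use that sinh_le_mult_cosh in \<open>auto intro!: derivative_eq_intros\<close>)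
  have "0 \<le> x * (cosh x + 2) - 3 * sinh x"
    by (rule nonneg_by_derivative[where x = x and h = "\<lambda>x. x * (cosh x + 2) - 3 * sinh x"
          and h' = "\<lambda>y. 2 - 2 * cosh y + y * sinh y"])
       (use assms first in \<open>auto intro!: derivative_eq_intros simp: algebra_simps\<close>)
  then show ?thesis by simp
qed

text \<open>
  For \<open>x > 0\<close> this is \<open>1 / x - 1 / sinh x \<le> 1 / 2\<close> with the denominators cleared, the reason
  for \<open>\<zeta> \<le> 1 / 2\<close>.
\<close>

lemma two_minus_mult_sinh_le:
  fixes x :: real
  assumes "0 \<le> x"
  shows "(2 - x) * sinh x \<le> 2 * x"
proof -
  have first: "0 \<le> 2 + sinh y - (2 - y) * cosh y" if "0 \<le> y" for y :: real
  proof (rule nonneg_by_derivative[where x = y and h = "\<lambda>y. 2 + sinh y - (2 - y) * cosh y"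
        and h' = "\<lambda>x. 2 * cosh x - 2 * sinh x + x * sinh x"])
    show "0 \<le> 2 * cosh x - 2 * sinh x + x * sinh x" if "0 \<le> x" for x :: real
      using sinh_less_cosh_real[of x] that by (simp add: less_imp_le)
  qed (use that in \<open>auto intro!: derivative_eq_intros simp: algebra_simps\<close>)
  have "0 \<le> 2 * x - (2 - x) * sinh x"
    by (rule nonneg_by_derivative[where x = x and h = "\<lambda>x. 2 * x - (2 - x) * sinh x"
          and h' = "\<lambda>y. 2 + sinh y - (2 - y) * cosh y"])
       (use assms first in \<open>auto intro!: derivative_eq_intros simp: algebra_simps\<close>)
  then show ?thesis by simp
qed

lemma inverse_sinh_gap_pos:
  fixes x :: real
  assumes "0 < x"
  shows "0 \<le> 1 / x - 1 / sinh x" "1 / x - 1 / sinh x \<le> 1 / 2"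
proof -
  have s: "0 < sinh x" using assms by simp
  show "0 \<le> 1 / x - 1 / sinh x"
    using le_sinh[of x] assms s by (simp add: frac_le)
  show "1 / x - 1 / sinh x \<le> 1 / 2"
    using two_minus_mult_sinh_le[of x] assms s by (simp add: field_simps)
qed

lemma inverse_sinh_gap:
  fixes x :: real
  shows "\<bar>1 / sinh x - 1 / x\<bar> \<le> 1 / 2"
proof (cases "x > 0")
  case True
  then show ?thesis using inverse_sinh_gap_pos[of x] by simp
next
  case False
  then consider "x = 0" | "- x > 0" by linarith
  then show ?thesis
  proof cases
    case 2
    then show ?thesis using inverse_sinh_gap_pos[of "- x"] by simp
  qed simp
qed

section \<open>The radial coefficients\<close>

text \<open>
  The eigenvalues of the Hessian of \<open>d\<^sup>2\<close> relative to the metric are \<open>2\<close> in the radial direction and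
  \<open>2 * rcoth r\<close> on its orthogonal complement.
\<close>

definition rcoth :: "real \<Rightarrow> real" where
  "rcoth r = r * cosh r / sinh r"

text \<open>
  The derivative of \<open>rcoth\<close>, simplified with \<open>cosh\<^sup>2 - sinh\<^sup>2 = 1\<close>.
\<close>

definition rcoth_deriv :: "real \<Rightarrow> real" where
  "rcoth_deriv r = (sinh r * cosh r - r) / (sinh r)\<^sup>2"

text \<open>
  This is \<open>(rcoth r - 1) * coth r\<close>: half the difference of the two eigenvalues of the Hessian of \<open>d\<^sup>2\<close>,
  times the rate \<open>coth r\<close> at which the radial direction turns when the point moves orthogonally to it.
\<close>

definition mixed_coeff :: "real \<Rightarrow> real" where
  "mixed_coeff r = (r * cosh r - sinh r) * cosh r / (sinh r)\<^sup>2"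

context
  fixes r :: real
  assumes r: "0 < r"
begin

lemma sinh_pos: "0 < sinh r" using r by simp

lemma rcoth_ge_1: "1 \<le> rcoth r"
  unfolding rcoth_def using sinh_le_mult_cosh[of r] sinh_pos r by (simp add: field_simps)

lemma mixed_coeff_eq: "mixed_coeff r = (cosh r / sinh r - 1 / r) * rcoth r"
proof -
  have "(r * c - s) * c / s\<^sup>2 = (c / s - 1 / r) * (r * c / s)" if "s > 0" for s c :: real
    using that r by (simp add: field_simps power2_eq_square)
  from this[OF sinh_pos] show ?thesis by (simp only: mixed_coeff_def rcoth_def)
qed

lemma mixed_coeff_nonneg: "0 \<le> mixed_coeff r"
  unfolding mixed_coeff_def using sinh_le_mult_cosh[of r] sinh_pos r by simp

text \<open>
  Together with \<open>mixed_coeff_le\<close> this says that \<open>mixed_coeff r / rcoth r\<close> tends to 1 from below; both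
  sharpness statements rest on it.
\<close>

lemma mixed_coeff_ge: "(1 - 1 / r) * rcoth r \<le> mixed_coeff r"
proof -
  have "1 \<le> cosh r / sinh r"
    using sinh_less_cosh_real[of r] sinh_pos by simp
  then show ?thesis
    unfolding mixed_coeff_eq using rcoth_ge_1 by (intro mult_right_mono) auto
qed

lemma mixed_coeff_le: "mixed_coeff r \<le> rcoth r"
proof -
  have "0 \<le> sinh r - r * (cosh r - sinh r)"
  proof (rule nonneg_by_derivative[where x = r and h = "\<lambda>r. sinh r - r * (cosh r - sinh r)"
        and h' = "\<lambda>r. sinh r + r * (cosh r - sinh r)"])
    show "0 \<le> sinh x + x * (cosh x - sinh x)" if "0 \<le> x" for x :: real
      using sinh_less_cosh_real[of x] that by (simp add: less_imp_le)
  qed (use r in \<open>auto intro!: derivative_eq_intros simp: algebra_simps\<close>)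
  then have "cosh r / sinh r - 1 / r \<le> 1"
    using sinh_pos r by (simp add: field_simps)
  then show ?thesis
    unfolding mixed_coeff_eq using rcoth_ge_1
      mult_right_mono[of "cosh r / sinh r - 1 / r" 1 "rcoth r"] by simp
qed

text \<open>
  Here the function \<open>1 / x - 1 / sinh x\<close> appears, at \<open>x = 2 * r\<close>; its supremum is the constant \<open>\<zeta>\<close>.
\<close>

lemma rcoth_deriv_eq: "rcoth_deriv r = 2 * (1 / (2 * r) - 1 / sinh (2 * r)) * rcoth r"
proof -
  have "(s * c - r) / s\<^sup>2 = 2 * (1 / (2 * r) - 1 / (2 * s * c)) * (r * c / s)"
    if "s > 0" "c > 0" for s c :: real
    using that r by (simp add: field_simps power2_eq_square)
  from this[OF sinh_pos cosh_real_pos[of r]] show ?thesis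
    by (simp only: rcoth_deriv_def rcoth_def sinh_double)
qed

lemma rcoth_deriv_nonneg: "0 \<le> rcoth_deriv r"
  unfolding rcoth_deriv_eq using inverse_sinh_gap_pos(1)[of "2 * r"] r rcoth_ge_1 by simp

lemma rcoth_deriv_le: "rcoth_deriv r \<le> rcoth r"
  unfolding rcoth_deriv_eq
  using inverse_sinh_gap_pos(2)[of "2 * r"] r rcoth_ge_1
    mult_right_mono[of "2 * (1 / (2 * r) - 1 / sinh (2 * r))" 1 "rcoth r"] by simp

lemma rcoth_deriv_le_div: "rcoth_deriv r \<le> 1 / r * rcoth r"
  unfolding rcoth_deriv_eq
  using r rcoth_ge_1 by (intro mult_right_mono) auto

lemma rcoth_deriv_le_gap:
  assumes "\<And>x::real. x \<noteq> 0 \<Longrightarrow> \<bar>1 / sinh x - 1 / x\<bar> \<le> z"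
  shows "rcoth_deriv r \<le> 2 * z * rcoth r"
proof -
  have "1 / (2 * r) - 1 / sinh (2 * r) \<le> z" using assms[of "2 * r"] r by linarith
  then show ?thesis unfolding rcoth_deriv_eq using rcoth_ge_1 by (intro mult_right_mono) auto
qed

text \<open>
  In terms of \<open>x = 2 * r\<close> and after multiplication by \<open>sinh r ^ 4\<close> the claim reads
  \<open>3 * (sinh x)\<^sup>2 \<le> x * (cosh x + 2) * (2 * sinh x - x)\<close>. By \<open>three_sinh_le\<close> the right-hand side is at
  least \<open>3 * sinh x * (2 * sinh x - x)\<close>, and \<open>x \<le> sinh x\<close>.
\<close>

lemma coeff_square_bound: "2 * (mixed_coeff r)\<^sup>2 + (rcoth_deriv r)\<^sup>2 \<le> 2 * (rcoth r)\<^sup>2"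
proof -
  define x s q where "x = 2 * r" and "s = sinh (2 * r)" and "q = cosh (2 * r)"
  have x: "0 < x" "x \<le> s" using r le_sinh[of "2 * r"] by (auto simp: x_def s_def)
  have "3 * s \<le> x * (q + 2)"
    using three_sinh_le[of "2 * r"] r by (simp add: x_def s_def q_def)
  then have "3 * s * (2 * s - x) \<le> x * (q + 2) * (2 * s - x)"
    using x by (intro mult_right_mono) auto
  moreover have "3 * s * s \<le> 3 * s * (2 * s - x)"
    using x by (intro mult_left_mono) auto
  ultimately have "3 * s * s \<le> x * (q + 2) * (2 * s - x)" by linarith
  then have *: "3 * s\<^sup>2 + x\<^sup>2 * (q + 2) \<le> 2 * x * s * (q + 2)"
    by (simp add: algebra_simps power2_eq_square)
  define S C where "S = sinh r" and "C = cosh r"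
  have S: "S > 0" using sinh_pos S_def by simp
  have C2: "C\<^sup>2 = S\<^sup>2 + 1" using cosh_square_eq[of r] by (simp add: S_def C_def)
  have sq: "s = 2 * S * C" "q = 2 * C\<^sup>2 - 1"
    unfolding s_def q_def S_def C_def sinh_double cosh_double_cosh by (rule refl)+
  have "3 * S\<^sup>2 * C\<^sup>2 + r\<^sup>2 * (2 * C\<^sup>2 + 1) \<le> 2 * r * S * C * (2 * C\<^sup>2 + 1)"
    using * unfolding sq x_def by (simp add: power_mult_distrib algebra_simps)
  then have **: "2 * ((r * C - S) * C)\<^sup>2 + (S * C - r)\<^sup>2 \<le> 2 * (r * C * S)\<^sup>2"
  proof -
    have "2 * (r * C * S)\<^sup>2 - 2 * ((r * C - S) * C)\<^sup>2 - (S * C - r)\<^sup>2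
      = 2 * r * S * C * (2 * C\<^sup>2 + 1) - 3 * S\<^sup>2 * C\<^sup>2 - r\<^sup>2 - 2 * r\<^sup>2 * C\<^sup>2 * (C\<^sup>2 - S\<^sup>2)"
      by (simp add: algebra_simps power2_eq_square)
    also have "C\<^sup>2 - S\<^sup>2 = 1" using C2 by simp
    finally show ?thesis
      using \<open>3 * S\<^sup>2 * C\<^sup>2 + r\<^sup>2 * (2 * C\<^sup>2 + 1) \<le> 2 * r * S * C * (2 * C\<^sup>2 + 1)\<close>
      by (simp add: algebra_simps)
  qed
  have "2 * (mixed_coeff r)\<^sup>2 + (rcoth_deriv r)\<^sup>2
      = (2 * ((r * C - S) * C)\<^sup>2 + (S * C - r)\<^sup>2) / (S\<^sup>2)\<^sup>2"
    by (simp add: mixed_coeff_def rcoth_deriv_def S_def C_def power_divide add_divide_distrib)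
  also have "\<dots> \<le> 2 * (r * C * S)\<^sup>2 / (S\<^sup>2)\<^sup>2"
    using ** by (intro divide_right_mono) auto
  also have "\<dots> = 2 * (rcoth r)\<^sup>2"
    using S by (simp add: rcoth_def S_def C_def power_divide power_mult_distrib power2_eq_square)
  finally show ?thesis .
qed

end

section \<open>Pointwise estimates for the third derivative\<close>

text \<open>
  The Cauchy-Schwarz inequality separates \<open>(b, Q)\<close> from \<open>(a, P)\<close> and leaves
  \<open>k'\<^sup>2 * P\<^sup>2 + 4 * m\<^sup>2 * a\<^sup>2 * P / k \<le> (a\<^sup>2 + k * P)\<^sup>2\<close>, a condition on a binary quadratic form in
  \<open>(a\<^sup>2, P)\<close>. With \<open>R = (k\<^sup>2 - k'\<^sup>2) / k\<close> the hypothesis on \<open>m\<close> bounds the mixed coefficient by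
  \<open>2 * R\<close>, and \<open>R \<le> k\<close> makes the form dominate \<open>(a\<^sup>2 - R * P)\<^sup>2\<close>.
\<close>

lemma third_order_bound:
  fixes k k' m a b P Q X :: real
  assumes k: "k > 0" and k': "k'\<^sup>2 \<le> k\<^sup>2" and m: "2 * m\<^sup>2 + k'\<^sup>2 \<le> 2 * k\<^sup>2"
    and PQ: "0 \<le> P" "0 \<le> Q" and X: "X\<^sup>2 \<le> P * Q"
  shows "\<bar>k' * b * P - 2 * m * a * X\<bar> \<le> sqrt (b\<^sup>2 + k * Q) * (a\<^sup>2 + k * P)"
proof -
  define R where "R = (k\<^sup>2 - k'\<^sup>2) / k"
  have R: "R \<le> k" "0 \<le> R" "k * R = k\<^sup>2 - k'\<^sup>2"
    using k k' by (auto simp: R_def field_simps power2_eq_square)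
  have "4 * m\<^sup>2 \<le> 2 * k * (R + k)" using m R(3) by (simp add: algebra_simps power2_eq_square)
  then have "4 * m\<^sup>2 * (a\<^sup>2 * P) \<le> 2 * k * (R + k) * (a\<^sup>2 * P)"
    using PQ by (intro mult_right_mono) auto
  also have "\<dots> = k * (2 * R * a\<^sup>2 * P + 2 * k * a\<^sup>2 * P)" by (simp add: algebra_simps)
  also have "\<dots> \<le> k * (a ^ 4 + k * R * P\<^sup>2 + 2 * k * a\<^sup>2 * P)"
  proof -
    have "0 \<le> (a\<^sup>2 - R * P)\<^sup>2" by simp
    then have "2 * R * a\<^sup>2 * P \<le> a ^ 4 + R * R * P\<^sup>2"
      by (simp add: power2_diff power_mult_distrib power2_eq_square power4_eq_xxxx algebra_simps)
    also have "R * R * P\<^sup>2 \<le> k * R * P\<^sup>2" using R by (intro mult_right_mono) auto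
    finally show ?thesis using k by (intro mult_left_mono) auto
  qed
  also have "\<dots> = k * ((a\<^sup>2 + k * P)\<^sup>2 - k'\<^sup>2 * P\<^sup>2)"
  proof -
    have "(a\<^sup>2 + k * P)\<^sup>2 - k'\<^sup>2 * P\<^sup>2 = a ^ 4 + (k\<^sup>2 - k'\<^sup>2) * P\<^sup>2 + 2 * k * a\<^sup>2 * P"
      by (simp add: power2_sum algebra_simps power2_eq_square power4_eq_xxxx)
    then show ?thesis by (simp add: R(3))
  qed
  finally have quad: "4 * m\<^sup>2 * a\<^sup>2 * P / k \<le> (a\<^sup>2 + k * P)\<^sup>2 - k'\<^sup>2 * P\<^sup>2"
    using k by (simp add: field_simps)
  (* Cauchy-Schwarz for (b, sqrt (k Q)) and (k' P, 2 m a sqrt (P / k)); the missing square is that of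
     k' X sqrt (k P) + 2 m a b sqrt (P / k), where X^2 <= P Q allows X in place of sqrt (P Q) *)
  have "(k' * b * P - 2 * m * a * X)\<^sup>2 \<le> (b\<^sup>2 + k * Q) * (k'\<^sup>2 * P\<^sup>2 + 4 * m\<^sup>2 * a\<^sup>2 * P / k)"
  proof -
    have 1: "0 \<le> (k' * P)\<^sup>2 * (k * Q) + b\<^sup>2 * (4 * m\<^sup>2 * a\<^sup>2 * P / k) + 2 * (k' * b * P) * (2 * m * a * X)"
    proof (cases "P = 0")
      case True
      then show ?thesis using X by simp
    next
      case False
      then have P: "P > 0" using PQ by simp
      have "0 \<le> (k' * X * sqrt (k * P) + b * (2 * m * a * sqrt (P / k)))\<^sup>2" by simp
      also have "\<dots> = k'\<^sup>2 * X\<^sup>2 * (k * P) + b\<^sup>2 * (4 * m\<^sup>2 * a\<^sup>2 * (P / k))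
          + 2 * (k' * X * b * (2 * m * a)) * (sqrt (k * P) * sqrt (P / k))"
        using k P by (simp add: power2_sum power_mult_distrib real_sqrt_pow2 algebra_simps)
      also have "sqrt (k * P) * sqrt (P / k) = P"
        using k P by (simp add: real_sqrt_mult[symmetric] power2_eq_square[symmetric])
      also have "k'\<^sup>2 * X\<^sup>2 * (k * P) \<le> k'\<^sup>2 * (P * Q) * (k * P)"
        using X k P by (intro mult_right_mono mult_left_mono) auto
      finally show ?thesis by (simp add: algebra_simps power2_eq_square)
    qed
    have 2: "4 * m\<^sup>2 * a\<^sup>2 * X\<^sup>2 \<le> 4 * m\<^sup>2 * a\<^sup>2 * (P * Q)"
      using X by (intro mult_left_mono) auto
    have "(b\<^sup>2 + k * Q) * (k'\<^sup>2 * P\<^sup>2 + 4 * m\<^sup>2 * a\<^sup>2 * P / k) - (k' * b * P - 2 * m * a * X)\<^sup>2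
       = ((k' * P)\<^sup>2 * (k * Q) + b\<^sup>2 * (4 * m\<^sup>2 * a\<^sup>2 * P / k) + 2 * (k' * b * P) * (2 * m * a * X))
         + (4 * m\<^sup>2 * a\<^sup>2 * (P * Q) - 4 * m\<^sup>2 * a\<^sup>2 * X\<^sup>2)"
      using k by (simp add: power2_diff power_mult_distrib algebra_simps add_divide_distrib)
    then show ?thesis using 1 2 by linarith
  qed
  also have "\<dots> \<le> (b\<^sup>2 + k * Q) * (a\<^sup>2 + k * P)\<^sup>2"
    using quad k PQ by (intro mult_left_mono) auto
  finally have "\<bar>k' * b * P - 2 * m * a * X\<bar> \<le> sqrt ((b\<^sup>2 + k * Q) * (a\<^sup>2 + k * P)\<^sup>2)"
    by (intro real_le_rsqrt) simp
  also have "\<dots> = sqrt (b\<^sup>2 + k * Q) * (a\<^sup>2 + k * P)"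
    using k PQ by (simp add: real_sqrt_mult)
  finally show ?thesis .
qed

text \<open>
  The arithmetic-geometric mean inequality for \<open>a\<^sup>2\<close>, \<open>P / 2\<close>, \<open>P / 2\<close>; equality holds for
  \<open>P = 2 * a\<^sup>2\<close>, which is the choice that shows the optimality of \<open>27 / (2 * \<kappa>)\<close>.
\<close>

lemma cubic_amgm:
  fixes a P :: real
  assumes "0 \<le> P"
  shows "27 * (a\<^sup>2 * P\<^sup>2) \<le> 4 * (a\<^sup>2 + P) ^ 3"
proof -
  have "4 * (a\<^sup>2 + P) ^ 3 - 27 * (a\<^sup>2 * P\<^sup>2) = (P - 2 * a\<^sup>2)\<^sup>2 * (4 * P + a\<^sup>2)"
    by (simp add: power2_eq_square power3_eq_cube algebra_simps)
  also have "\<dots> \<ge> 0" using assms by simp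
  finally show ?thesis by simp
qed

section \<open>The squared inverse hyperbolic cosine\<close>

text \<open>
  The function \<open>cosh (sqrt y)\<close> is given by the power series \<open>\<Sum> y ^ n / fact (2 * n)\<close> and is therefore
  entire in \<open>y\<close>. Its inverse is \<open>(arcosh c)\<^sup>2\<close>, which is thus smooth up to \<open>c = 1\<close>, although
  \<open>arcosh\<close> is not. Iterating \<open>diffs\<close> yields the coefficients of the derivative of order \<open>j\<close>.
\<close>

definition cosh_sqrt_coeff :: "nat \<Rightarrow> nat \<Rightarrow> real" where
  "cosh_sqrt_coeff j = (diffs ^^ j) (\<lambda>n. 1 / fact (2 * n))"

definition cosh_sqrt_deriv :: "nat \<Rightarrow> real \<Rightarrow> real" where
  "cosh_sqrt_deriv j y = (\<Sum>n. cosh_sqrt_coeff j n * y ^ n)"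

lemma summable_cosh_sqrt: "summable (\<lambda>n. cosh_sqrt_coeff j n * y ^ n)"
proof (induction j arbitrary: y)
  case 0
  show ?case
  proof (rule summable_comparison_test'[OF summable_exp[of "\<bar>y\<bar>"]])
    fix n :: nat
    have "fact n \<le> (fact (2 * n) :: real)" by (intro fact_mono) simp
    then have "1 / fact (2 * n) \<le> (inverse (fact n) :: real)"
      by (simp add: inverse_eq_divide frac_le)
    then show "norm (cosh_sqrt_coeff 0 n * y ^ n) \<le> inverse (fact n) * \<bar>y\<bar> ^ n"
      using mult_right_mono[of "1 / fact (2 * n)" "inverse (fact n)" "\<bar>y\<bar> ^ n"]
      by (simp add: cosh_sqrt_coeff_def abs_mult power_abs)
  qed
next
  case (Suc j)
  then show ?case using termdiff_converges_all[of "cosh_sqrt_coeff j"] by (simp add: cosh_sqrt_coeff_def)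
qed

lemma has_derivative_cosh_sqrt_deriv [derivative_intros]:
  "(cosh_sqrt_deriv j has_real_derivative cosh_sqrt_deriv (Suc j) y) (at y)"
  using termdiffs_strong_converges_everywhere[OF summable_cosh_sqrt, of j y]
  unfolding cosh_sqrt_deriv_def by (simp add: cosh_sqrt_coeff_def)

lemma cosh_sqrt_coeff_pos: "0 < cosh_sqrt_coeff j n"
proof (induction j arbitrary: n)
  case (Suc j)
  then show ?case by (simp add: cosh_sqrt_coeff_def diffs_def)
qed (simp add: cosh_sqrt_coeff_def)

lemma cosh_sqrt_deriv_pos:
  assumes "0 \<le> y"
  shows "0 < cosh_sqrt_deriv j y"
  unfolding cosh_sqrt_deriv_def
  by (rule suminf_pos2[OF summable_cosh_sqrt, of _ _ 0])
     (use assms cosh_sqrt_coeff_pos in \<open>simp_all add: less_imp_le\<close>)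

text \<open>
  With \<open>E y = cosh (sqrt y)\<close>, the last two identities are \<open>4 * y * E'' + 2 * E' = E\<close> and its derivative
  at \<open>y = r\<^sup>2\<close>. All of them come from differentiating \<open>E (r\<^sup>2) = cosh r\<close> with respect to \<open>r\<close>.
\<close>

lemma cosh_sqrt_deriv_square:
  "cosh_sqrt_deriv 0 (r\<^sup>2) = cosh r"
  "2 * r * cosh_sqrt_deriv 1 (r\<^sup>2) = sinh r"
  "4 * r\<^sup>2 * cosh_sqrt_deriv 2 (r\<^sup>2) + 2 * cosh_sqrt_deriv 1 (r\<^sup>2) = cosh r"
  "r \<noteq> 0 \<Longrightarrow> 4 * r\<^sup>2 * cosh_sqrt_deriv 3 (r\<^sup>2) + 6 * cosh_sqrt_deriv 2 (r\<^sup>2) = cosh_sqrt_deriv 1 (r\<^sup>2)"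
proof -
  let ?E = cosh_sqrt_deriv
  have der: "((\<lambda>r. ?E j (r\<^sup>2)) has_real_derivative 2 * x * ?E (Suc j) (x\<^sup>2)) (at x)" for x j
    by (rule DERIV_cong[OF DERIV_chain2[OF has_derivative_cosh_sqrt_deriv]])
       (auto intro!: derivative_eq_intros)
  have 0: "?E 0 (x\<^sup>2) = cosh x" for x
  proof -
    have "(\<lambda>n. if even (2 * n) then x ^ (2 * n) /\<^sub>R fact (2 * n) else 0) sums cosh x"
      by (subst sums_mono_reindex[of "\<lambda>n. 2 * n"])
         (use cosh_converges[of x] in \<open>auto simp: strict_mono_def\<close>)
    then show ?thesis
      by (simp add: cosh_sqrt_deriv_def cosh_sqrt_coeff_def sums_iff power_mult divide_inverse)
  qed
  have 1: "2 * x * ?E 1 (x\<^sup>2) = sinh x" for x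
  proof (rule DERIV_unique)
    show "(cosh has_real_derivative 2 * x * ?E 1 (x\<^sup>2)) (at x)"
      using der[of 0 x] by (simp add: 0)
  qed (auto intro!: derivative_eq_intros)
  have 2: "4 * x\<^sup>2 * ?E 2 (x\<^sup>2) + 2 * ?E 1 (x\<^sup>2) = cosh x" for x
  proof (rule DERIV_unique)
    have "((\<lambda>x. 2 * x * ?E 1 (x\<^sup>2)) has_real_derivative 4 * x\<^sup>2 * ?E 2 (x\<^sup>2) + 2 * ?E 1 (x\<^sup>2)) (at x)"
      by (rule derivative_eq_intros der refl)+ (simp add: power2_eq_square numeral_2_eq_2)
    then show "(sinh has_real_derivative 4 * x\<^sup>2 * ?E 2 (x\<^sup>2) + 2 * ?E 1 (x\<^sup>2)) (at x)"
      by (simp only: 1)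
  qed (auto intro!: derivative_eq_intros)
  have 3: "8 * x * ?E 2 (x\<^sup>2) + 8 * x\<^sup>2 * x * ?E 3 (x\<^sup>2) + 4 * x * ?E 2 (x\<^sup>2) = sinh x" for x
  proof (rule DERIV_unique)
    have "((\<lambda>x. 4 * x\<^sup>2 * ?E 2 (x\<^sup>2) + 2 * ?E 1 (x\<^sup>2)) has_real_derivative
        8 * x * ?E 2 (x\<^sup>2) + 8 * x\<^sup>2 * x * ?E 3 (x\<^sup>2) + 4 * x * ?E 2 (x\<^sup>2)) (at x)"
      by (rule derivative_eq_intros der refl)+
         (simp add: power2_eq_square numeral_2_eq_2 numeral_3_eq_3)
    then show "(cosh has_real_derivative
        8 * x * ?E 2 (x\<^sup>2) + 8 * x\<^sup>2 * x * ?E 3 (x\<^sup>2) + 4 * x * ?E 2 (x\<^sup>2)) (at x)"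
      by (simp only: 2)
  qed (auto intro!: derivative_eq_intros)
  show "?E 0 (r\<^sup>2) = cosh r" "2 * r * ?E 1 (r\<^sup>2) = sinh r"
    "4 * r\<^sup>2 * ?E 2 (r\<^sup>2) + 2 * ?E 1 (r\<^sup>2) = cosh r"
    using 0 1 2 by auto
  show "4 * r\<^sup>2 * ?E 3 (r\<^sup>2) + 6 * ?E 2 (r\<^sup>2) = ?E 1 (r\<^sup>2)" if "r \<noteq> 0"
  proof -
    have "2 * r * (4 * r\<^sup>2 * ?E 3 (r\<^sup>2) + 6 * ?E 2 (r\<^sup>2)) = 2 * r * ?E 1 (r\<^sup>2)"
      using 3[of r] 1[of r] by (simp add: algebra_simps)
    then show ?thesis using that by simp
  qed
qed

definition arcosh_sq :: "real \<Rightarrow> real" where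
  "arcosh_sq c = (arcosh c)\<^sup>2"

text \<open>
  The first three derivatives of \<open>arcosh_sq\<close> on \<open>{1..}\<close>, obtained from the rule for inverse functions.
  Unlike closed formulas such as \<open>2 * r / sinh r\<close> at \<open>c = cosh r\<close>, they make sense at \<open>c = 1\<close>.
\<close>

definition arcosh_sq' :: "real \<Rightarrow> real" where
  "arcosh_sq' c = inverse (cosh_sqrt_deriv 1 (arcosh_sq c))"

definition arcosh_sq'' :: "real \<Rightarrow> real" where
  "arcosh_sq'' c = - cosh_sqrt_deriv 2 (arcosh_sq c) * arcosh_sq' c ^ 3"

definition arcosh_sq''' :: "real \<Rightarrow> real" where
  "arcosh_sq''' c = (3 * (cosh_sqrt_deriv 2 (arcosh_sq c))\<^sup>2 * arcosh_sq' c
     - cosh_sqrt_deriv 3 (arcosh_sq c)) * arcosh_sq' c ^ 4"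

lemma cosh_sqrt_arcosh_sq: "1 \<le> c \<Longrightarrow> cosh_sqrt_deriv 0 (arcosh_sq c) = c"
  by (simp add: arcosh_sq_def cosh_sqrt_deriv_square)

lemma arcosh_sq'_pos: "0 < arcosh_sq' c"
  unfolding arcosh_sq'_def arcosh_sq_def using cosh_sqrt_deriv_pos by simp

text \<open>
  The difference quotients of \<open>arcosh_sq\<close> are the reciprocals of those of its inverse. At \<open>c = 1\<close> only
  the derivative within \<open>{1..}\<close> is available, and this is all that composition with \<open>cosh_dist\<close> requires.
\<close>

lemma has_derivative_arcosh_sq:
  assumes "1 \<le> c"
  shows "(arcosh_sq has_real_derivative arcosh_sq' c) (at c within {1..})"
proof -
  let ?E = "cosh_sqrt_deriv 0"
  have quot: "((\<lambda>u. (?E u - ?E (arcosh_sq c)) / (u - arcosh_sq c)) \<longlongrightarrow>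
      cosh_sqrt_deriv 1 (arcosh_sq c)) (at (arcosh_sq c))"
    using has_derivative_cosh_sqrt_deriv[of 0 "arcosh_sq c"] by (simp add: has_field_derivative_iff)
  have ev: "\<forall>\<^sub>F y in at c within {1..}. 1 \<le> y \<and> y \<noteq> c"
    by (simp add: eventually_at_filter)
  have "continuous_on {1..} arcosh_sq"
    unfolding arcosh_sq_def by (intro continuous_intros) auto
  then have "(arcosh_sq \<longlongrightarrow> arcosh_sq c) (at c within {1..})"
    using assms by (simp add: continuous_on_def)
  moreover have "\<forall>\<^sub>F y in at c within {1..}. arcosh_sq y \<noteq> arcosh_sq c"
    using ev by eventually_elim (use assms cosh_sqrt_arcosh_sq in metis)
  ultimately have "filterlim arcosh_sq (at (arcosh_sq c)) (at c within {1..})"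
    by (simp add: filterlim_at)
  from filterlim_compose[OF quot this]
  have "((\<lambda>y. inverse ((?E (arcosh_sq y) - ?E (arcosh_sq c)) / (arcosh_sq y - arcosh_sq c))) \<longlongrightarrow>
      arcosh_sq' c) (at c within {1..})"
    unfolding arcosh_sq'_def using cosh_sqrt_deriv_pos[of "arcosh_sq c" 1]
    by (intro tendsto_inverse) (auto simp: arcosh_sq_def)
  moreover have "\<forall>\<^sub>F y in at c within {1..}.
      inverse ((?E (arcosh_sq y) - ?E (arcosh_sq c)) / (arcosh_sq y - arcosh_sq c))
      = (arcosh_sq y - arcosh_sq c) / (y - c)"
    using ev by eventually_elim (use assms in \<open>simp add: cosh_sqrt_arcosh_sq\<close>)
  ultimately show ?thesis
    unfolding has_field_derivative_iff using tendsto_cong by fast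
qed

lemma has_derivative_cosh_sqrt_arcosh_sq:
  assumes "1 \<le> c"
  shows "((\<lambda>c. cosh_sqrt_deriv j (arcosh_sq c)) has_real_derivative
    cosh_sqrt_deriv (Suc j) (arcosh_sq c) * arcosh_sq' c) (at c within {1..})"
  using DERIV_chain2[OF has_derivative_cosh_sqrt_deriv has_derivative_arcosh_sq[OF assms]] by simp

lemma has_derivative_arcosh_sq':
  assumes "1 \<le> c"
  shows "(arcosh_sq' has_real_derivative arcosh_sq'' c) (at c within {1..})"
proof -
  have "cosh_sqrt_deriv 1 (arcosh_sq c) \<noteq> 0"
    using arcosh_sq'_pos[of c] unfolding arcosh_sq'_def by auto
  from DERIV_inverse'[OF has_derivative_cosh_sqrt_arcosh_sq[OF assms] this]
  have "((\<lambda>c. inverse (cosh_sqrt_deriv 1 (arcosh_sq c))) has_real_derivative arcosh_sq'' c) (at c within {1..})"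
    by (simp add: arcosh_sq''_def arcosh_sq'_def numeral_2_eq_2 power3_eq_cube algebra_simps)
  then show ?thesis by (simp add: arcosh_sq'_def[abs_def])
qed

lemma has_derivative_arcosh_sq'':
  assumes "1 \<le> c"
  shows "(arcosh_sq'' has_real_derivative arcosh_sq''' c) (at c within {1..})"
proof -
  have "((\<lambda>c. - cosh_sqrt_deriv 2 (arcosh_sq c) * arcosh_sq' c ^ 3) has_real_derivative arcosh_sq''' c)
      (at c within {1..})"
    by (rule derivative_eq_intros has_derivative_cosh_sqrt_arcosh_sq[OF assms]
          has_derivative_arcosh_sq'[OF assms] refl)+
       (simp add: arcosh_sq'''_def arcosh_sq''_def algebra_simps power2_eq_square power3_eq_cube
          power4_eq_xxxx numeral_2_eq_2 numeral_3_eq_3)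
  then show ?thesis by (simp add: arcosh_sq''_def[abs_def])
qed

lemma arcosh_sq'_cosh:
  assumes "0 < r"
  shows "arcosh_sq' (cosh r) = 2 * r / sinh r"
proof -
  have "2 * r * cosh_sqrt_deriv 1 (r\<^sup>2) = sinh r" by (rule cosh_sqrt_deriv_square)
  then have "cosh_sqrt_deriv 1 (r\<^sup>2) = sinh r / (2 * r)" using assms by (simp add: field_simps)
  then show ?thesis
    using assms by (simp add: arcosh_sq'_def arcosh_sq_def arcosh_cosh_real)
qed

text \<open>
  The differential equations of \<open>cosh (sqrt y)\<close>, rewritten for the inverse function. They express the
  purely radial components of the second and third covariant derivatives of the squared distance
  through the first derivative.
\<close>

lemma arcosh_sq_ode:
  assumes "0 < r"
  shows "(sinh r)\<^sup>2 * arcosh_sq'' (cosh r) + cosh r * arcosh_sq' (cosh r) = 2"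
    and "(sinh r)\<^sup>2 * arcosh_sq''' (cosh r) + 3 * cosh r * arcosh_sq'' (cosh r)
      + arcosh_sq' (cosh r) = 0"
proof -
  define y where "y = r\<^sup>2"
  define E1 E2 E3 where "E1 = cosh_sqrt_deriv 1 y" and "E2 = cosh_sqrt_deriv 2 y"
    and "E3 = cosh_sqrt_deriv 3 y"
  have E1: "E1 > 0" unfolding E1_def y_def by (rule cosh_sqrt_deriv_pos) simp
  have F: "arcosh_sq (cosh r) = y" using assms by (simp add: arcosh_sq_def arcosh_cosh_real y_def)
  have s: "(sinh r)\<^sup>2 = 4 * y * E1\<^sup>2"
    unfolding cosh_sqrt_deriv_square(2)[of r, symmetric] E1_def y_def by (simp add: power2_eq_square)
  have c: "cosh r = 4 * y * E2 + 2 * E1"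
    unfolding cosh_sqrt_deriv_square(3)[of r, symmetric] E1_def E2_def y_def ..
  have y3: "4 * y * E3 = E1 - 6 * E2"
    using cosh_sqrt_deriv_square(4)[of r] assms by (simp add: E1_def E2_def E3_def y_def)
  show "(sinh r)\<^sup>2 * arcosh_sq'' (cosh r) + cosh r * arcosh_sq' (cosh r) = 2"
    unfolding arcosh_sq''_def arcosh_sq'_def F s E1_def[symmetric] E2_def[symmetric]
    unfolding c using E1 by (simp add: field_simps power2_eq_square power3_eq_cube)
  have "(4 * y * E1\<^sup>2) * ((3 * E2\<^sup>2 * inverse E1 - E3) * inverse E1 ^ 4)
      + 3 * (4 * y * E2 + 2 * E1) * (- E2 * inverse E1 ^ 3) + inverse E1
    = (E1 - 6 * E2 - 4 * y * E3) / E1\<^sup>2"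
    using E1 by (simp add: field_simps power2_eq_square power3_eq_cube power4_eq_xxxx)
  then show "(sinh r)\<^sup>2 * arcosh_sq''' (cosh r) + 3 * cosh r * arcosh_sq'' (cosh r)
      + arcosh_sq' (cosh r) = 0"
    unfolding arcosh_sq'''_def arcosh_sq''_def arcosh_sq'_def F s E1_def[symmetric] E2_def[symmetric]
      E3_def[symmetric]
    unfolding c by (simp add: y3)
qed

section \<open>The hyperboloid and the distance from a point\<close>

text \<open>
  The metric of the model space is \<open>4 / \<kappa> * (conformal_factor p)\<^sup>2\<close> times the Euclidean one.
\<close>

definition conformal_factor :: "'a::euclidean_space \<Rightarrow> real" where
  "conformal_factor p = inverse (1 - p \<bullet> p)"

text \<open>
  The point \<open>(T, S)\<close> of the hyperboloid \<open>T\<^sup>2 - S \<bullet> S = 1\<close> that corresponds to \<open>p\<close> under the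
  stereographic projection \<open>(T, S) \<mapsto> S / (1 + T)\<close>.
\<close>

definition hyp_time :: "'a::euclidean_space \<Rightarrow> real" where
  "hyp_time p = 2 * conformal_factor p - 1"

definition hyp_space :: "'a::euclidean_space \<Rightarrow> 'a" where
  "hyp_space p = (2 * conformal_factor p) *\<^sub>R p"

text \<open>
  The Lorentz product of two points of the hyperboloid. By \<open>riem_dist_model\<close> below it is the
  hyperbolic cosine of \<open>sqrt \<kappa>\<close> times their distance.
\<close>

definition cosh_dist :: "'a::euclidean_space \<Rightarrow> 'a \<Rightarrow> real" where
  "cosh_dist q p = hyp_time q * hyp_time p - hyp_space q \<bullet> hyp_space p"

text \<open>
  The gradient with respect to the Euclidean inner product of the chart.
\<close>

definition cosh_dist_grad :: "'a::euclidean_space \<Rightarrow> 'a \<Rightarrow> 'a" where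
  "cosh_dist_grad q p = (4 * (conformal_factor p)\<^sup>2 * (hyp_time q - hyp_space q \<bullet> p)) *\<^sub>R p
     - (2 * conformal_factor p) *\<^sub>R hyp_space q"

lemma conformal_factor_pos: "p \<in> ball 0 1 \<Longrightarrow> 0 < conformal_factor p"
  using ball_norm_pos[of p] by (simp add: conformal_factor_def)

lemma conformal_factor_mult_norm: "p \<in> ball 0 1 \<Longrightarrow> conformal_factor p * (p \<bullet> p) = conformal_factor p - 1"
  using ball_norm_pos[of p] by (simp add: conformal_factor_def field_simps)

lemma hyperboloid:
  assumes "p \<in> ball 0 1"
  shows "(hyp_time p)\<^sup>2 - hyp_space p \<bullet> hyp_space p = 1"
proof -
  have "(hyp_time p)\<^sup>2 - hyp_space p \<bullet> hyp_space p
      = (2 * conformal_factor p - 1)\<^sup>2 - 4 * conformal_factor p * (conformal_factor p * (p \<bullet> p))"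
    by (simp add: hyp_time_def hyp_space_def)
  then show ?thesis unfolding conformal_factor_mult_norm[OF assms] by (simp add: power2_eq_square algebra_simps)
qed

lemma cosh_dist_alt:
  "cosh_dist q p = 2 * conformal_factor p * (hyp_time q - hyp_space q \<bullet> p) - hyp_time q"
  by (simp add: cosh_dist_def hyp_time_def[of p] hyp_space_def[of p] algebra_simps)

lemma cosh_dist_eq:
  assumes "q \<in> ball 0 1" "p \<in> ball 0 1"
  shows "cosh_dist q p = 1 + 2 * conformal_factor q * conformal_factor p * (norm (p - q))\<^sup>2"
proof -
  have "2 * conformal_factor q * conformal_factor p * (norm (p - q))\<^sup>2 = 2 * conformal_factor q * (conformal_factor p * (p \<bullet> p))
      + 2 * conformal_factor p * (conformal_factor q * (q \<bullet> q)) - 4 * conformal_factor q * conformal_factor p * (q \<bullet> p)"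
    by (simp add: power2_norm_eq_inner inner_diff_left inner_diff_right inner_commute[of p q] algebra_simps)
  also have "\<dots> = cosh_dist q p - 1"
    unfolding conformal_factor_mult_norm[OF assms(1)] conformal_factor_mult_norm[OF assms(2)]
    by (simp add: cosh_dist_def hyp_time_def hyp_space_def algebra_simps)
  finally show ?thesis by simp
qed

lemma cosh_dist_ge_1: "q \<in> ball 0 1 \<Longrightarrow> p \<in> ball 0 1 \<Longrightarrow> 1 \<le> cosh_dist q p"
  using conformal_factor_pos[of p] conformal_factor_pos[of q] by (simp add: cosh_dist_eq)

lemma cosh_dist_eq_1_iff: "q \<in> ball 0 1 \<Longrightarrow> p \<in> ball 0 1 \<Longrightarrow> cosh_dist q p = 1 \<longleftrightarrow> p = q"
  using conformal_factor_pos[of p] conformal_factor_pos[of q] by (simp add: cosh_dist_eq)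

lemma has_derivative_conformal:
  "p \<in> ball 0 1 \<Longrightarrow> (conformal_factor has_derivative (\<lambda>u. 2 * (p \<bullet> u) * (conformal_factor p)\<^sup>2)) (at p)"
  using has_derivative_conformal_factor[of p] unfolding conformal_factor_def[abs_def] .

lemma has_derivative_cosh_dist:
  assumes "p \<in> ball 0 1"
  shows "(cosh_dist q has_derivative (\<lambda>v. cosh_dist_grad q p \<bullet> v)) (at p)"
proof -
  have "((\<lambda>p. 2 * conformal_factor p * (hyp_time q - hyp_space q \<bullet> p) - hyp_time q) has_derivative
      (\<lambda>v. cosh_dist_grad q p \<bullet> v)) (at p)"
    by (rule derivative_eq_intros has_derivative_conformal[OF assms] refl)+
       (simp add: fun_eq_iff cosh_dist_grad_def inner_diff_left algebra_simps)
  then show ?thesis by (simp add: cosh_dist_alt[abs_def])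
qed

lemma model_metric_conf: "model_metric \<kappa> p u v = 4 / \<kappa> * (conformal_factor p)\<^sup>2 * (u \<bullet> v)"
  by (simp add: model_metric_alt conformal_factor_def)

lemma poincare_christoffel_conf:
  "poincare_christoffel p u v = (2 * conformal_factor p) *\<^sub>R ((p \<bullet> u) *\<^sub>R v + (p \<bullet> v) *\<^sub>R u - (u \<bullet> v) *\<^sub>R p)"
  by (simp add: poincare_christoffel_def conformal_factor_def divide_inverse)

text \<open>
  The Levi-Civita connection is compatible with the metric.
\<close>

lemma has_derivative_model_metric:
  assumes "p \<in> ball 0 1"
  shows "((\<lambda>x. model_metric \<kappa> x v w) has_derivative
    (\<lambda>u. model_metric \<kappa> p (poincare_christoffel p u v) w
       + model_metric \<kappa> p v (poincare_christoffel p u w))) (at p)"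
proof -
  have der: "((\<lambda>x. model_metric \<kappa> x v w) has_derivative
      (\<lambda>u. 16 / \<kappa> * (p \<bullet> u) * (conformal_factor p) ^ 3 * (v \<bullet> w))) (at p)"
    unfolding model_metric_conf
    by (rule derivative_eq_intros has_derivative_conformal[OF assms] refl)+
       (simp add: fun_eq_iff power2_eq_square power3_eq_cube)
  have "16 / \<kappa> * (p \<bullet> u) * (conformal_factor p) ^ 3 * (v \<bullet> w)
      = model_metric \<kappa> p (poincare_christoffel p u v) w
       + model_metric \<kappa> p v (poincare_christoffel p u w)" for u
    unfolding model_metric_conf poincare_christoffel_conf divide_inverse
      inner_add_right inner_diff_right inner_scaleR_right
      inner_add_left inner_diff_left inner_scaleR_left
      inner_commute[of w p] inner_commute[of v p] inner_commute[of v u] inner_commute[of w u]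
    by (simp add: inner_commute algebra_simps power2_eq_square power3_eq_cube)
  then show ?thesis using der by simp
qed

text \<open>
  In invariant terms the Hessian of \<open>c = cosh_dist q\<close> is \<open>\<kappa> * c\<close> times the metric: after the
  subtraction of the Christoffel term only the first summand of the derivative remains.
\<close>

lemma has_derivative_cosh_dist_grad:
  assumes \<kappa>: "\<kappa> > 0" and p: "p \<in> ball 0 1"
  shows "((\<lambda>x. cosh_dist_grad q x \<bullet> v) has_derivative
    (\<lambda>u. \<kappa> * cosh_dist q p * model_metric \<kappa> p u v
       + cosh_dist_grad q p \<bullet> poincare_christoffel p u v)) (at p)"
proof -
  define j t where "j = conformal_factor p" and "t = hyp_time q - hyp_space q \<bullet> p"
  have "((\<lambda>x. 4 * (conformal_factor x)\<^sup>2 * (hyp_time q - hyp_space q \<bullet> x) * (x \<bullet> v)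
        - 2 * conformal_factor x * (hyp_space q \<bullet> v)) has_derivative
      (\<lambda>u. 4 * j\<^sup>2 * t * (u \<bullet> v) + 16 * j ^ 3 * t * (p \<bullet> u) * (p \<bullet> v)
        - 4 * j\<^sup>2 * (p \<bullet> v) * (hyp_space q \<bullet> u) - 4 * j\<^sup>2 * (p \<bullet> u) * (hyp_space q \<bullet> v))) (at p)"
    by (rule derivative_eq_intros has_derivative_conformal[OF p] refl)+
       (simp add: fun_eq_iff j_def t_def power2_eq_square power3_eq_cube algebra_simps)
  then have der: "((\<lambda>x. cosh_dist_grad q x \<bullet> v) has_derivative
      (\<lambda>u. 4 * j\<^sup>2 * t * (u \<bullet> v) + 16 * j ^ 3 * t * (p \<bullet> u) * (p \<bullet> v)
        - 4 * j\<^sup>2 * (p \<bullet> v) * (hyp_space q \<bullet> u) - 4 * j\<^sup>2 * (p \<bullet> u) * (hyp_space q \<bullet> v))) (at p)"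
    by (simp add: cosh_dist_grad_def inner_diff_left)
  have "4 * j\<^sup>2 * t * (u \<bullet> v) + 16 * j ^ 3 * t * (p \<bullet> u) * (p \<bullet> v)
        - 4 * j\<^sup>2 * (p \<bullet> v) * (hyp_space q \<bullet> u) - 4 * j\<^sup>2 * (p \<bullet> u) * (hyp_space q \<bullet> v)
      = \<kappa> * cosh_dist q p * model_metric \<kappa> p u v
       + cosh_dist_grad q p \<bullet> poincare_christoffel p u v" for u
  proof -
    have k: "\<kappa> * cosh_dist q p * model_metric \<kappa> p u v = 4 * j\<^sup>2 * (2 * j * t - hyp_time q) * (u \<bullet> v)"
      using \<kappa> by (simp add: model_metric_conf cosh_dist_alt j_def t_def)
    have "cosh_dist_grad q p \<bullet> poincare_christoffel p u v
      = 4 * j\<^sup>2 * t * (4 * j * (p \<bullet> u) * (p \<bullet> v) - 2 * (u \<bullet> v) * (j * (p \<bullet> p)))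
        - 4 * j\<^sup>2 * ((p \<bullet> u) * (hyp_space q \<bullet> v) + (p \<bullet> v) * (hyp_space q \<bullet> u)
          - (u \<bullet> v) * (hyp_space q \<bullet> p))"
      unfolding cosh_dist_grad_def poincare_christoffel_conf j_def[symmetric] t_def[symmetric]
        inner_add_right inner_diff_right inner_scaleR_right
        inner_add_left inner_diff_left inner_scaleR_left
      by (simp add: power2_eq_square algebra_simps)
    also have "j * (p \<bullet> p) = j - 1" unfolding j_def by (rule conformal_factor_mult_norm[OF p])
    finally show ?thesis unfolding k
      by (simp add: t_def power2_eq_square power3_eq_cube algebra_simps)
  qed
  then show ?thesis using der by simp
qed

text \<open>
  In invariant terms \<open>\<bar>dc\<bar>\<^sup>2 = \<kappa> * (c\<^sup>2 - 1)\<close>; the conformal factor comes from the use of the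
  Euclidean norm.
\<close>

lemma norm_cosh_dist_grad:
  assumes "q \<in> ball 0 1" "p \<in> ball 0 1"
  shows "cosh_dist_grad q p \<bullet> cosh_dist_grad q p = 4 * (conformal_factor p)\<^sup>2 * ((cosh_dist q p)\<^sup>2 - 1)"
proof -
  define j T b where "j = conformal_factor p" and "T = hyp_time q" and "b = hyp_space q \<bullet> p"
  have j: "j * (p \<bullet> p) = j - 1" unfolding j_def by (rule conformal_factor_mult_norm[OF assms(2)])
  have S: "hyp_space q \<bullet> hyp_space q = T\<^sup>2 - 1" using hyperboloid[OF assms(1)] by (simp add: T_def)
  have "cosh_dist_grad q p \<bullet> cosh_dist_grad q p
     = 16 * j ^ 3 * (T - b)\<^sup>2 * (j * (p \<bullet> p)) - 16 * j ^ 3 * (T - b) * b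
       + 4 * j\<^sup>2 * (hyp_space q \<bullet> hyp_space q)"
    unfolding cosh_dist_grad_def j_def[symmetric] T_def[symmetric] b_def[symmetric]
      inner_diff_right inner_scaleR_right inner_diff_left inner_scaleR_left
      inner_commute[of p "hyp_space q"]
    by (simp add: b_def[symmetric] power2_eq_square power3_eq_cube algebra_simps)
  also have "\<dots> = 4 * j\<^sup>2 * ((2 * j * (T - b) - T)\<^sup>2 - 1)"
    unfolding j S by (simp add: power2_eq_square power3_eq_cube algebra_simps)
  finally show ?thesis by (simp add: cosh_dist_alt j_def T_def b_def)
qed

section \<open>Covariant derivatives of the squared distance\<close>

text \<open>
  One-sided derivatives of \<open>\<phi>\<close> suffice because \<open>cosh_dist q\<close> takes its values in \<open>{1..}\<close>, with
  the value 1 attained at \<open>q\<close>.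
\<close>

lemma has_derivative_compose_cosh_dist:
  assumes "q \<in> ball 0 1" "p \<in> ball 0 1"
    and "(\<phi> has_real_derivative d) (at (cosh_dist q p) within {1..})"
  shows "((\<lambda>x. \<phi> (cosh_dist q x)) has_derivative (\<lambda>v. d * (cosh_dist_grad q p \<bullet> v))) (at p)"
proof -
  have "(\<phi> has_derivative (*) d) (at (cosh_dist q p) within cosh_dist q ` ball 0 1)"
    using assms(3) cosh_dist_ge_1[OF assms(1)] unfolding has_field_derivative_def
    by (elim has_derivative_subset) auto
  from has_derivative_in_compose[OF has_derivative_at_withinI[OF has_derivative_cosh_dist[OF assms(2)]] this]
  show ?thesis using assms(2) by (simp add: at_within_open[of p "ball 0 1"])
qed

lemma frechet_derivative_eqI:
  assumes "(g has_derivative g') (at p)" "p \<in> U" "open U" "\<And>x. x \<in> U \<Longrightarrow> f x = g x"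
  shows "frechet_derivative f (at p) = g'"
  using has_derivative_transform_within_open[OF assms(1,3,2)] assms(4) frechet_derivative_at by metis

context
  fixes \<kappa> :: real and q :: "'a::euclidean_space" and f :: "'a \<Rightarrow> real"
  assumes \<kappa>: "\<kappa> > 0" and q: "q \<in> ball 0 1"
    and f: "\<forall>x\<in>ball 0 1. f x = arcosh_sq (cosh_dist q x) / \<kappa>"
begin

lemma has_derivative_sq_dist:
  assumes p: "p \<in> ball 0 1"
  shows "(f has_derivative (\<lambda>v. arcosh_sq' (cosh_dist q p) / \<kappa> * (cosh_dist_grad q p \<bullet> v))) (at p)"
proof -
  have "((\<lambda>x. arcosh_sq (cosh_dist q x) / \<kappa>) has_derivative
      (\<lambda>v. arcosh_sq' (cosh_dist q p) / \<kappa> * (cosh_dist_grad q p \<bullet> v))) (at p)"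
    using has_derivative_mult_right[OF has_derivative_compose_cosh_dist[OF q p
        has_derivative_arcosh_sq[OF cosh_dist_ge_1[OF q p]]], of "1 / \<kappa>"] by simp
  then show ?thesis
    by (rule has_derivative_transform_within_open[of _ _ p UNIV "ball 0 1"]) (use p f in auto)
qed

lemma diff_form_sq_dist:
  "p \<in> ball 0 1 \<Longrightarrow> diff_form f p v = arcosh_sq' (cosh_dist q p) / \<kappa> * (cosh_dist_grad q p \<bullet> v)"
  unfolding diff_form_def by (simp only: frechet_derivative_at[OF has_derivative_sq_dist, symmetric])

lemma has_derivative_diff_form_sq_dist:
  assumes p: "p \<in> ball 0 1"
  shows "((\<lambda>x. diff_form f x v) has_derivative
    (\<lambda>u. (arcosh_sq'' (cosh_dist q p) / \<kappa> * (cosh_dist_grad q p \<bullet> u)) * (cosh_dist_grad q p \<bullet> v)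
      + arcosh_sq' (cosh_dist q p) / \<kappa> * (\<kappa> * cosh_dist q p * model_metric \<kappa> p u v
         + cosh_dist_grad q p \<bullet> poincare_christoffel p u v))) (at p)"
proof -
  define i where "i = inverse \<kappa>"
  have "((\<lambda>x. arcosh_sq' (cosh_dist q x) / \<kappa> * (cosh_dist_grad q x \<bullet> v)) has_derivative
    (\<lambda>u. (arcosh_sq'' (cosh_dist q p) / \<kappa> * (cosh_dist_grad q p \<bullet> u)) * (cosh_dist_grad q p \<bullet> v)
      + arcosh_sq' (cosh_dist q p) / \<kappa> * (\<kappa> * cosh_dist q p * model_metric \<kappa> p u v
         + cosh_dist_grad q p \<bullet> poincare_christoffel p u v))) (at p)"
    unfolding divide_inverse i_def[symmetric]
    by (rule derivative_eq_intros refl has_derivative_cosh_dist_grad[OF \<kappa> p]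
         has_derivative_compose_cosh_dist[OF q p has_derivative_arcosh_sq'[OF cosh_dist_ge_1[OF q p]]])+
       (simp add: fun_eq_iff algebra_simps)
  then show ?thesis
    by (rule has_derivative_transform_within_open[of _ _ p UNIV "ball 0 1"])
       (use p in \<open>auto simp: diff_form_sq_dist\<close>)
qed

lemma hessian_sq_dist:
  assumes p: "p \<in> ball 0 1"
  shows "hessian (model_metric \<kappa>) f p u v
    = arcosh_sq'' (cosh_dist q p) / \<kappa> * (cosh_dist_grad q p \<bullet> u) * (cosh_dist_grad q p \<bullet> v)
      + arcosh_sq' (cosh_dist q p) * cosh_dist q p * model_metric \<kappa> p u v"
  unfolding hessian_def cov_deriv_form_def levi_civita_model_metric[OF \<kappa> p]
    frechet_derivative_at[OF has_derivative_diff_form_sq_dist[OF p], symmetric]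
    diff_form_sq_dist[OF p]
  using \<kappa> by (simp add: algebra_simps)

text \<open>
  The product rule for \<open>hessian_sq_dist\<close>. Since the metric is parallel and the Hessian of \<open>cosh_dist\<close> is
  a multiple of it, every term with a Christoffel symbol cancels.
\<close>

lemma nabla3_sq_dist:
  fixes w u v :: 'a
  assumes p: "p \<in> ball 0 1"
  defines "N \<equiv> \<lambda>v. cosh_dist_grad q p \<bullet> v" and "c \<equiv> cosh_dist q p" and "G \<equiv> model_metric \<kappa> p"
  shows "nabla3 (model_metric \<kappa>) f p w u v
    = arcosh_sq''' c / \<kappa> * N w * N u * N v
      + arcosh_sq'' c * c * (G w u * N v + G w v * N u)
      + (arcosh_sq'' c * c + arcosh_sq' c) * N w * G u v"
proof -
  let ?\<Gamma> = "poincare_christoffel p"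
  define i where "i = inverse \<kappa>"
  have c1: "1 \<le> cosh_dist q p" by (rule cosh_dist_ge_1[OF q p])
  have "((\<lambda>x. arcosh_sq'' (cosh_dist q x) / \<kappa> * (cosh_dist_grad q x \<bullet> u) * (cosh_dist_grad q x \<bullet> v)
      + arcosh_sq' (cosh_dist q x) * cosh_dist q x * model_metric \<kappa> x u v) has_derivative
    (\<lambda>w. arcosh_sq''' c / \<kappa> * N w * N u * N v
      + arcosh_sq'' c / \<kappa> * ((\<kappa> * c * G w u + N (?\<Gamma> w u)) * N v + N u * (\<kappa> * c * G w v + N (?\<Gamma> w v)))
      + (arcosh_sq'' c * c + arcosh_sq' c) * N w * G u v
      + arcosh_sq' c * c * (G (?\<Gamma> w u) v + G u (?\<Gamma> w v)))) (at p)"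
    unfolding N_def c_def G_def divide_inverse i_def[symmetric]
    by (rule derivative_eq_intros refl has_derivative_cosh_dist_grad[OF \<kappa> p]
         has_derivative_cosh_dist[OF p] has_derivative_model_metric[OF p]
         has_derivative_compose_cosh_dist[OF q p has_derivative_arcosh_sq'[OF c1]]
         has_derivative_compose_cosh_dist[OF q p has_derivative_arcosh_sq''[OF c1]])+
       (simp add: fun_eq_iff algebra_simps)
  from frechet_derivative_eqI[OF this p open_ball]
  have D: "frechet_derivative (\<lambda>x. hessian (model_metric \<kappa>) f x u v) (at p) w
      = arcosh_sq''' c / \<kappa> * N w * N u * N v
      + arcosh_sq'' c / \<kappa> * ((\<kappa> * c * G w u + N (?\<Gamma> w u)) * N v + N u * (\<kappa> * c * G w v + N (?\<Gamma> w v)))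
      + (arcosh_sq'' c * c + arcosh_sq' c) * N w * G u v
      + arcosh_sq' c * c * (G (?\<Gamma> w u) v + G u (?\<Gamma> w v))"
    by (simp only: hessian_sq_dist)
  show ?thesis
    unfolding nabla3_def cov_deriv_tensor_def levi_civita_model_metric[OF \<kappa> p] D hessian_sq_dist[OF p]
    unfolding N_def c_def G_def
    using \<kappa> by (simp add: algebra_simps add_divide_distrib)
qed

end

lemma Ck_on_cosh_dist: "Ck_on k (ball 0 1) (cosh_dist q)"
proof -
  have "Ck_on k (ball 0 1) (\<lambda>p. (2 * hyp_time q) * conformal_factor p + (- 2) * conformal_factor p * (p \<bullet> hyp_space q) + (- hyp_time q))"
    unfolding conformal_factor_def
    by (intro Ck_on_add Ck_on_mult Ck_on_const Ck_on_inner Ck_on_conformal_factor) auto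
  then show ?thesis
    by (rule Ck_on_cong[rotated 2]) (auto simp: cosh_dist_alt algebra_simps inner_commute)
qed

lemma Ck_on_cosh_dist_grad: "Ck_on k (ball 0 1) (\<lambda>x. cosh_dist_grad q x \<bullet> v)"
proof -
  have "Ck_on (Suc k) (ball 0 1) (cosh_dist q)" by (rule Ck_on_cosh_dist)
  then have "Ck_on k (ball 0 1) (\<lambda>x. frechet_derivative (cosh_dist q) (at x) v)" by simp
  then show ?thesis
    by (rule Ck_on_cong[rotated 2])
       (simp_all add: frechet_derivative_at[OF has_derivative_cosh_dist, symmetric])
qed

text \<open>
  The two families are treated together: the directional derivatives of their members are products of
  members of both families and components of the gradient of \<open>cosh_dist\<close>.
\<close>

lemma Ck_on_compose_cosh_dist:
  assumes q: "q \<in> ball 0 1"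
  shows "Ck_on k (ball 0 1) (\<lambda>x. cosh_sqrt_deriv j (arcosh_sq (cosh_dist q x)))"
    and "Ck_on k (ball 0 1) (\<lambda>x. arcosh_sq' (cosh_dist q x))"
proof (induction k arbitrary: j)
  case 0
  have c: "continuous_on (ball 0 1) (\<lambda>x. \<phi> (cosh_dist q x))"
    if "\<And>c. 1 \<le> c \<Longrightarrow> (\<phi> has_real_derivative \<phi>' c) (at c within {1..})" for \<phi> \<phi>'
    using has_derivative_compose_cosh_dist[OF q _ that[OF cosh_dist_ge_1[OF q]]]
    by (intro continuous_at_imp_continuous_on) (blast intro: has_derivative_continuous)
  {
    case 1
    show ?case using c[OF has_derivative_cosh_sqrt_arcosh_sq] by simp
  next
    case 2
    show ?case using c[OF has_derivative_arcosh_sq'] by simp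
  }
next
  case (Suc k)
  {
    case 1
    show ?case
      by (rule Ck_on_SucI[OF open_ball has_derivative_compose_cosh_dist[OF q _
            has_derivative_cosh_sqrt_arcosh_sq[OF cosh_dist_ge_1[OF q]]]])
         (auto intro!: Ck_on_mult Suc Ck_on_cosh_dist_grad)
  next
    case 2
    have "Ck_on k (ball 0 1) (\<lambda>x. - 1 * cosh_sqrt_deriv 2 (arcosh_sq (cosh_dist q x))
        * (arcosh_sq' (cosh_dist q x) * (arcosh_sq' (cosh_dist q x) * arcosh_sq' (cosh_dist q x)))
        * (cosh_dist_grad q x \<bullet> v))" for v
      by (intro Ck_on_mult Ck_on_const Suc Ck_on_cosh_dist_grad) auto
    then have "Ck_on k (ball 0 1) (\<lambda>x. arcosh_sq'' (cosh_dist q x) * (cosh_dist_grad q x \<bullet> v))" for v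
      by (simp add: arcosh_sq''_def power3_eq_cube mult.assoc)
    then show ?case
      using Ck_on_SucI[OF open_ball has_derivative_compose_cosh_dist[OF q _
            has_derivative_arcosh_sq'[OF cosh_dist_ge_1[OF q]]]] by blast
  }
qed

lemma smooth_on_sq_dist:
  assumes q: "q \<in> ball 0 1" and f: "\<forall>x\<in>ball 0 1. f x = arcosh_sq (cosh_dist q x) / \<kappa>"
  shows "smooth_on (ball 0 1) f"
  unfolding smooth_on_def
proof
  fix k
  have "Ck_on (Suc k) (ball 0 1) (\<lambda>x. arcosh_sq (cosh_dist q x))"
    by (rule Ck_on_SucI[OF open_ball has_derivative_compose_cosh_dist[OF q _
            has_derivative_arcosh_sq[OF cosh_dist_ge_1[OF q]]]])
       (auto intro!: Ck_on_mult Ck_on_compose_cosh_dist[OF q] Ck_on_cosh_dist_grad)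
  then have "Ck_on k (ball 0 1) (\<lambda>x. (1 / \<kappa>) * arcosh_sq (cosh_dist q x))"
    using Ck_on_mult[OF open_ball Ck_on_const[OF open_ball] Ck_on_SucD] by blast
  then show "Ck_on k (ball 0 1) f"
    by (rule Ck_on_cong[rotated 2]) (auto simp: f)
qed

section \<open>The distance formula\<close>

lemma norm_grad_eq:
  assumes "q \<in> ball 0 1" "p \<in> ball 0 1"
  shows "norm (cosh_dist_grad q p) = 2 * conformal_factor p * sinh (arcosh (cosh_dist q p))"
proof -
  have "norm (cosh_dist_grad q p) = sqrt (4 * (conformal_factor p)\<^sup>2 * ((cosh_dist q p)\<^sup>2 - 1))"
    by (simp add: norm_eq_sqrt_inner norm_cosh_dist_grad[OF assms])
  also have "\<dots> = 2 * conformal_factor p * sqrt ((cosh_dist q p)\<^sup>2 - 1)"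
    using conformal_factor_pos[OF assms(2)] by (simp add: real_sqrt_mult)
  finally show ?thesis using cosh_dist_ge_1[OF assms] by (simp add: sinh_arcosh_real)
qed

lemma riem_norm_conf:
  assumes "\<kappa> > 0" "p \<in> ball 0 1"
  shows "riem_norm (model_metric \<kappa>) p u = 2 / sqrt \<kappa> * conformal_factor p * norm u"
  using riem_norm_model_metric[OF assms] by (simp add: conformal_factor_def)

text \<open>
  The natural comparison function \<open>r = arcosh (cosh_dist q x)\<close> is not differentiable at \<open>q\<close>. Its
  regularisation \<open>sqrt (r\<^sup>2 + e\<^sup>2)\<close> is smooth, is at least \<open>r\<close>, has the value \<open>e\<close> at \<open>q\<close>, and its
  Riemannian gradient has norm at most \<open>sqrt \<kappa>\<close>.
\<close>

lemma dist_lower_bound: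
  assumes \<kappa>: "\<kappa> > 0" and p: "p \<in> ball 0 1" and q: "q \<in> ball 0 1"
  shows "arcosh (cosh_dist q p) \<le> sqrt \<kappa> * riem_dist (ball 0 1) (model_metric \<kappa>) p q"
proof (rule field_le_epsilon)
  fix e :: real assume e: "e > 0"
  let ?r = "\<lambda>x. arcosh (cosh_dist q x)"
  let ?h = "\<lambda>x. sqrt (arcosh_sq (cosh_dist q x) + e\<^sup>2)"
  let ?h' = "\<lambda>x v. arcosh_sq' (cosh_dist q x) / (2 * ?h x) * (cosh_dist_grad q x \<bullet> v)"
  have "norm (?h q - ?h p) \<le> sqrt \<kappa> * riem_dist (ball 0 1) (model_metric \<kappa>) p q"
  proof (rule model_dist_ge[OF \<kappa> _ p q, where \<psi> = ?h and \<psi>' = ?h'])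
    show "sqrt \<kappa> > 0" using \<kappa> by simp
    fix x :: 'a assume x: "x \<in> ball 0 1"
    have pos: "arcosh_sq (cosh_dist q x) + e\<^sup>2 > 0"
      using e by (simp add: arcosh_sq_def add_nonneg_pos)
    have "((\<lambda>x. arcosh_sq (cosh_dist q x) + e\<^sup>2) has_derivative
        (\<lambda>v. arcosh_sq' (cosh_dist q x) * (cosh_dist_grad q x \<bullet> v) + 0)) (at x)"
      by (intro has_derivative_add has_derivative_const has_derivative_compose_cosh_dist[OF q x]
          has_derivative_arcosh_sq cosh_dist_ge_1[OF q x])
    from DERIV_compose_FDERIV[where f = sqrt and g = "\<lambda>x. arcosh_sq (cosh_dist q x) + e\<^sup>2",
        OF DERIV_real_sqrt[OF pos] this]
    have "(?h has_derivative (\<lambda>v. (arcosh_sq' (cosh_dist q x) * (cosh_dist_grad q x \<bullet> v) + 0)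
        * (inverse (?h x) / 2))) (at x)" .
    then show "(?h has_derivative ?h' x) (at x)"
      by (rule has_derivative_eq_rhs) (simp add: fun_eq_iff divide_simps)
    fix v
    have r0: "0 \<le> ?r x" using cosh_dist_ge_1[OF q x] by simp
    have "?r x \<le> ?h x" unfolding arcosh_sq_def by (rule real_le_rsqrt) simp
    moreover have h0: "?h x > 0" using pos by simp
    moreover have "arcosh_sq' (cosh_dist q x) * sinh (?r x) \<le> 2 * ?r x"
    proof (cases "?r x = 0")
      case False
      then have "0 < ?r x" using r0 by simp
      from arcosh_sq'_cosh[OF this] show ?thesis
        using cosh_dist_ge_1[OF q x] \<open>0 < ?r x\<close> by simp
    qed simp
    ultimately have le1: "arcosh_sq' (cosh_dist q x) / (2 * ?h x) * sinh (?r x) \<le> 1"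
      by (simp add: divide_le_eq)
    have "norm (?h' x v) = arcosh_sq' (cosh_dist q x) / (2 * ?h x) * \<bar>cosh_dist_grad q x \<bullet> v\<bar>"
      using h0 arcosh_sq'_pos[of "cosh_dist q x"] by (simp add: abs_mult)
    also have "\<dots> \<le> arcosh_sq' (cosh_dist q x) / (2 * ?h x) * (2 * conformal_factor x * sinh (?r x) * norm v)"
      using h0 arcosh_sq'_pos[of "cosh_dist q x"] Cauchy_Schwarz_ineq2[of "cosh_dist_grad q x" v]
      unfolding norm_grad_eq[OF q x] by (intro mult_left_mono) auto
    also have "\<dots> = (arcosh_sq' (cosh_dist q x) / (2 * ?h x) * sinh (?r x)) * (2 * conformal_factor x * norm v)"
      by simp
    also have "\<dots> \<le> 1 * (2 * conformal_factor x * norm v)"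
      using le1 conformal_factor_pos[OF x] by (intro mult_right_mono) auto
    also have "\<dots> = sqrt \<kappa> * riem_norm (model_metric \<kappa>) x v"
      using \<kappa> by (simp add: riem_norm_conf[OF \<kappa> x])
    finally show "norm (?h' x v) \<le> sqrt \<kappa> * riem_norm (model_metric \<kappa>) x v" .
  qed
  moreover have "?h q = e"
    using e cosh_dist_eq_1_iff[OF q q] by (simp add: arcosh_sq_def)
  moreover have "?r p \<le> ?h p" unfolding arcosh_sq_def by (rule real_le_rsqrt) simp
  ultimately show "?r p \<le> sqrt \<kappa> * riem_dist (ball 0 1) (model_metric \<kappa>) p q + e" by simp
qed

lemma hyp_time_ge_1:
  assumes "p \<in> ball 0 1"
  shows "1 \<le> hyp_time p"
proof -
  have "1 \<le> conformal_factor p" unfolding conformal_factor_def using ball_norm_pos[OF assms] by (intro one_le_inverse) auto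
  then show ?thesis by (simp add: hyp_time_def)
qed

lemma hyperboloid_projection:
  assumes "p \<in> ball 0 1"
  shows "(1 / (1 + hyp_time p)) *\<^sub>R hyp_space p = p"
  using conformal_factor_pos[OF assms] by (simp add: hyp_time_def hyp_space_def)

text \<open>
  The Lorentz product on the plane spanned by two points of the hyperboloid. The geodesic between the
  points lies in this plane.
\<close>

lemma hyperboloid_combination:
  assumes "p \<in> ball 0 1" "q \<in> ball 0 1"
  shows "(a * hyp_time p + b * hyp_time q) * (c * hyp_time p + d * hyp_time q)
     - (a *\<^sub>R hyp_space p + b *\<^sub>R hyp_space q) \<bullet> (c *\<^sub>R hyp_space p + d *\<^sub>R hyp_space q)
     = a * c + b * d + (a * d + b * c) * cosh_dist q p"
proof -
  have "(a * hyp_time p + b * hyp_time q) * (c * hyp_time p + d * hyp_time q)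
     - (a *\<^sub>R hyp_space p + b *\<^sub>R hyp_space q) \<bullet> (c *\<^sub>R hyp_space p + d *\<^sub>R hyp_space q)
     = a * c * ((hyp_time p)\<^sup>2 - hyp_space p \<bullet> hyp_space p)
     + b * d * ((hyp_time q)\<^sup>2 - hyp_space q \<bullet> hyp_space q)
     + (a * d + b * c) * cosh_dist q p"
    by (simp add: cosh_dist_def inner_add_left inner_add_right inner_commute[of "hyp_space p" "hyp_space q"]
        power2_eq_square algebra_simps)
  then show ?thesis unfolding hyperboloid[OF assms(1)] hyperboloid[OF assms(2)] by simp
qed

text \<open>
  The stereographic projection is, up to the factor \<open>1 / sqrt \<kappa>\<close>, an isometry from the hyperboloid to
  the ball. Here \<open>(T, S)\<close> is a point, \<open>(T', S')\<close> a tangent vector of length \<open>r\<close>, and \<open>x'\<close>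
  its image under the differential of the projection.
\<close>

lemma projected_curve:
  fixes S S' :: "'a::euclidean_space"
  assumes "T > 0" "T\<^sup>2 - S \<bullet> S = 1" "T * T' - S \<bullet> S' = 0" "T'\<^sup>2 - S' \<bullet> S' = - r\<^sup>2" "r \<ge> 0"
    and "\<kappa> > 0"
  defines "x \<equiv> (1 / (1 + T)) *\<^sub>R S" and "x' \<equiv> (1 / (1 + T)) *\<^sub>R S' - (T' / (1 + T)\<^sup>2) *\<^sub>R S"
  shows "x \<in> ball 0 1" and "riem_norm (model_metric \<kappa>) x x' = r / sqrt \<kappa>"
proof -
  have T: "1 + T > 0" using assms(1) by simp
  have SS: "S \<bullet> S = T\<^sup>2 - 1" "S \<bullet> S' = T * T'" "S' \<bullet> S' = T'\<^sup>2 + r\<^sup>2" using assms by auto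
  define i where "i = 1 / (1 + T)"
  have i: "i * T = 1 - i" using T by (simp add: i_def field_simps)
  have "x \<bullet> x = (i * T)\<^sup>2 - i\<^sup>2"
    unfolding x_def i_def[symmetric] by (simp add: SS(1) power2_eq_square algebra_simps)
  then have xx: "1 - x \<bullet> x = 2 / (1 + T)"
    unfolding i by (simp add: i_def[symmetric] power2_eq_square algebra_simps) (simp add: i_def)
  then have "x \<bullet> x < 1" using T by (smt (verit) divide_pos_pos)
  then show x: "x \<in> ball 0 1" by (simp add: norm_eq_sqrt_inner)
  have x'_eq: "x' = i *\<^sub>R S' - (i\<^sup>2 * T') *\<^sub>R S"
    by (simp add: x'_def i_def power_divide)
  have "x' \<bullet> x' = i\<^sup>2 * (S' \<bullet> S') - 2 * i ^ 3 * T' * (S \<bullet> S') + i ^ 4 * T'\<^sup>2 * (S \<bullet> S)"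
    unfolding x'_eq by (simp add: inner_diff_left inner_diff_right inner_commute[of S' S]
        power2_eq_square power3_eq_cube power4_eq_xxxx algebra_simps)
  also have "\<dots> = i\<^sup>2 * (T'\<^sup>2 + r\<^sup>2) - 2 * i\<^sup>2 * T'\<^sup>2 * (i * T) + i\<^sup>2 * T'\<^sup>2 * ((i * T)\<^sup>2 - i\<^sup>2)"
    unfolding SS by (simp add: power2_eq_square power3_eq_cube power4_eq_xxxx algebra_simps)
  also have "\<dots> = (r / (1 + T))\<^sup>2"
    unfolding i divide_inverse[of r] inverse_eq_divide i_def[symmetric]
    by (simp add: power2_eq_square algebra_simps)
  finally have "norm x' = r / (1 + T)"
    using T assms(5) by (simp add: norm_eq_sqrt_inner)
  moreover have "conformal_factor x = (1 + T) / 2" unfolding conformal_factor_def xx by simp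
  ultimately have "riem_norm (model_metric \<kappa>) x x' = 2 / sqrt \<kappa> * ((1 + T) / 2) * (r / (1 + T))"
    by (simp only: riem_norm_conf[OF assms(6) x])
  moreover have "2 / s * (y / 2) * (r / y) = r / s" if "y > 0" for y s :: real using that by simp
  ultimately show "riem_norm (model_metric \<kappa>) x x' = r / sqrt \<kappa>" using T by metis
qed

text \<open>
  The geodesic of the hyperboloid from \<open>p\<close> to \<open>q\<close> has the coefficients
  \<open>sinh ((1 - t) * r) / sinh r\<close> and \<open>sinh (t * r) / sinh r\<close> and constant speed \<open>r\<close>; its projection to
  the ball is a path of length \<open>r / sqrt \<kappa>\<close>.
\<close>

lemma dist_upper_bound:
  assumes \<kappa>: "\<kappa> > 0" and p: "p \<in> ball 0 1" and q: "q \<in> ball 0 1" and pq: "p \<noteq> q"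
  shows "riem_dist (ball 0 1) (model_metric \<kappa>) p q \<le> arcosh (cosh_dist q p) / sqrt \<kappa>"
proof -
  define r where "r = arcosh (cosh_dist q p)"
  have c1: "1 \<le> cosh_dist q p" "cosh_dist q p \<noteq> 1"
    using cosh_dist_ge_1[OF q p] cosh_dist_eq_1_iff[OF q p] pq by auto
  then have r: "r > 0" and cr: "cosh_dist q p = cosh r" by (simp_all add: r_def)
  have s: "sinh r > 0" using r by simp
  define a b a' b' where "a = (\<lambda>t. sinh ((1 - t) * r) / sinh r)" and "b = (\<lambda>t. sinh (t * r) / sinh r)"
    and "a' = (\<lambda>t. - r * cosh ((1 - t) * r) / sinh r)" and "b' = (\<lambda>t. r * cosh (t * r) / sinh r)"
  define T where "T = (\<lambda>t. a t * hyp_time p + b t * hyp_time q)"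
  define T' where "T' = (\<lambda>t. a' t * hyp_time p + b' t * hyp_time q)"
  define S where "S = (\<lambda>t. a t *\<^sub>R hyp_space p + b t *\<^sub>R hyp_space q)"
  define S' where "S' = (\<lambda>t. a' t *\<^sub>R hyp_space p + b' t *\<^sub>R hyp_space q)"
  define \<gamma> where "\<gamma> = (\<lambda>t. (1 / (1 + T t)) *\<^sub>R S t)"
  define \<gamma>' where "\<gamma>' = (\<lambda>t. (1 / (1 + T t)) *\<^sub>R S' t - (T' t / (1 + T t)\<^sup>2) *\<^sub>R S t)"
  have T_pos: "T t > 0" if "t \<in> {0..1}" for t
  proof -
    have "0 \<le> a t" "0 \<le> b t"
      using that r s by (auto simp: a_def b_def)
    moreover have "a t > 0 \<or> b t > 0"
    proof (cases "t = 1")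
      case False
      then have "0 < (1 - t) * r" using that r by simp
      then show ?thesis using s by (simp add: a_def del: mult_pos_pos)
    qed (use s in \<open>simp add: b_def\<close>)
    moreover have "hyp_time p > 0" "hyp_time q > 0" using hyp_time_ge_1 p q by force+
    ultimately show ?thesis unfolding T_def by (auto intro: add_pos_nonneg add_nonneg_pos)
  qed
  have hyp: "(T t)\<^sup>2 - S t \<bullet> S t = 1" "T t * T' t - S t \<bullet> S' t = 0" "(T' t)\<^sup>2 - S' t \<bullet> S' t = - r\<^sup>2" for t
  proof -
    define x y where "x = (1 - t) * r" and "y = t * r"
    have xy: "x + y = r" by (simp add: x_def y_def algebra_simps)
    have "cosh_dist q p = cosh x * cosh y + sinh x * sinh y"
      using cosh_add[of x y] by (simp add: cr xy)
    moreover have "sinh r = sinh x * cosh y + cosh x * sinh y"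
      using sinh_add[of x y] by (simp add: xy)
    moreover have "(cosh x)\<^sup>2 = (sinh x)\<^sup>2 + 1" "(cosh y)\<^sup>2 = (sinh y)\<^sup>2 + 1"
      by (simp_all add: cosh_square_eq)
    ultimately have id: "(sinh x)\<^sup>2 + (sinh y)\<^sup>2 + 2 * sinh x * sinh y * cosh_dist q p = (sinh r)\<^sup>2"
      "sinh x * - cosh x + sinh y * cosh y + (sinh x * cosh y - cosh x * sinh y) * cosh_dist q p = 0"
      "(cosh x)\<^sup>2 + (cosh y)\<^sup>2 - 2 * cosh x * cosh y * cosh_dist q p = - (sinh r)\<^sup>2"
      by algebra+
    have ab: "a t = sinh x / sinh r" "b t = sinh y / sinh r" "a' t = - r * cosh x / sinh r"
      "b' t = r * cosh y / sinh r"
      by (simp_all add: a_def b_def a'_def b'_def x_def y_def)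
    have "(T t)\<^sup>2 - S t \<bullet> S t = a t * a t + b t * b t + (a t * b t + b t * a t) * cosh_dist q p"
      unfolding T_def S_def power2_eq_square by (rule hyperboloid_combination[OF p q])
    also have "\<dots> = ((sinh x)\<^sup>2 + (sinh y)\<^sup>2 + 2 * sinh x * sinh y * cosh_dist q p) / (sinh r)\<^sup>2"
      by (simp add: ab power2_eq_square add_divide_distrib)
    finally show "(T t)\<^sup>2 - S t \<bullet> S t = 1" using id(1) s by simp
    have "T t * T' t - S t \<bullet> S' t = a t * a' t + b t * b' t + (a t * b' t + b t * a' t) * cosh_dist q p"
      unfolding T_def S_def T'_def S'_def by (rule hyperboloid_combination[OF p q])
    also have "\<dots> = r * (sinh x * - cosh x + sinh y * cosh y
        + (sinh x * cosh y - cosh x * sinh y) * cosh_dist q p) / (sinh r)\<^sup>2"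
      using s by (simp add: ab field_simps power2_eq_square)
    finally show "T t * T' t - S t \<bullet> S' t = 0" using id(2) by simp
    have "(T' t)\<^sup>2 - S' t \<bullet> S' t = a' t * a' t + b' t * b' t + (a' t * b' t + b' t * a' t) * cosh_dist q p"
      unfolding T'_def S'_def power2_eq_square by (rule hyperboloid_combination[OF p q])
    also have "\<dots> = r\<^sup>2 * ((cosh x)\<^sup>2 + (cosh y)\<^sup>2 - 2 * cosh x * cosh y * cosh_dist q p) / (sinh r)\<^sup>2"
      using s by (simp add: ab field_simps power2_eq_square)
    finally show "(T' t)\<^sup>2 - S' t \<bullet> S' t = - r\<^sup>2" using id(3) s by simp
  qed
  have curve: "\<gamma> t \<in> ball 0 1" "riem_norm (model_metric \<kappa>) (\<gamma> t) (\<gamma>' t) = r / sqrt \<kappa>"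
    if "t \<in> {0..1}" for t
    unfolding \<gamma>_def \<gamma>'_def using projected_curve[OF T_pos[OF that] hyp less_imp_le[OF r] \<kappa>] by auto
  have dab: "(a has_real_derivative a' t) (at t)" "(b has_real_derivative b' t) (at t)" for t
    unfolding a_def b_def a'_def b'_def using s by (auto intro!: derivative_eq_intros)
  have dT: "(T has_real_derivative T' t) (at t)" for t
    unfolding T_def T'_def by (auto intro!: derivative_eq_intros dab)
  have dS: "(S has_vector_derivative S' t) (at t)" for t
    unfolding S_def S'_def
    by (auto intro!: derivative_eq_intros dab)
  have d\<gamma>: "(\<gamma> has_vector_derivative \<gamma>' t) (at t)" if "t \<in> {0..1}" for t
  proof -
    have nz: "1 + T t \<noteq> 0" using T_pos[OF that] by simp
    have "((\<lambda>t. 1 / (1 + T t)) has_real_derivative - (T' t / (1 + T t)\<^sup>2)) (at t)"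
      using nz by (auto intro!: derivative_eq_intros dT simp: power2_eq_square)
    from has_vector_derivative_scaleR[OF this dS]
    show ?thesis unfolding \<gamma>_def \<gamma>'_def by simp
  qed
  have "continuous_on {0..1} T" "continuous_on {0..1} T'" "continuous_on {0..1} S" "continuous_on {0..1} S'"
    unfolding T_def T'_def S_def S'_def a_def b_def a'_def b'_def using s
    by (auto intro!: continuous_intros)
  then have "continuous_on {0..1} \<gamma>'"
    unfolding \<gamma>'_def using T_pos by (fastforce intro!: continuous_intros)
  then have "\<gamma> C1_differentiable_on {0..1}"
    using d\<gamma> unfolding C1_differentiable_on_def by blast
  then have valid: "valid_path \<gamma>"
    unfolding valid_path_def by (rule C1_differentiable_imp_piecewise)
  have img: "path_image \<gamma> \<subseteq> ball 0 1" using curve(1) by (auto simp: path_image_def)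
  have "((\<lambda>t. r / sqrt \<kappa>) has_integral r / sqrt \<kappa>) {0..1::real}"
    using has_integral_const_real[of "r / sqrt \<kappa>" 0 1] by simp
  then have len: "has_riem_length (model_metric \<kappa>) \<gamma> (r / sqrt \<kappa>)"
    unfolding has_riem_length_def
    by (rule has_integral_eq[rotated]) (simp add: vector_derivative_at[OF d\<gamma>] curve(2))
  have "\<gamma> 0 = p" "\<gamma> 1 = q"
    using s hyperboloid_projection[OF p] hyperboloid_projection[OF q]
    by (simp_all add: \<gamma>_def T_def S_def a_def b_def)
  moreover have "model_metric \<kappa> x u u \<ge> 0" for x u :: 'a using \<kappa> by (simp add: model_metric_alt)
  ultimately show ?thesis
    using riem_dist_le[OF valid img len] by (simp add: r_def pathstart_def pathfinish_def)
qed

lemma riem_dist_model: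
  assumes \<kappa>: "\<kappa> > 0" and p: "p \<in> ball 0 1" and q: "q \<in> ball 0 1"
  shows "riem_dist (ball 0 1) (model_metric \<kappa>) p q = arcosh (cosh_dist q p) / sqrt \<kappa>"
proof (rule antisym)
  show "arcosh (cosh_dist q p) / sqrt \<kappa> \<le> riem_dist (ball 0 1) (model_metric \<kappa>) p q"
    using dist_lower_bound[OF assms] \<kappa> by (simp add: divide_le_eq mult.commute)
  show "riem_dist (ball 0 1) (model_metric \<kappa>) p q \<le> arcosh (cosh_dist q p) / sqrt \<kappa>"
  proof (cases "p = q")
    case True
    have "riem_dist (ball 0 1) (model_metric \<kappa>) p q \<le> 0"
      using model_dist_le[of \<kappa> "norm p" p p] \<kappa> p True by simp
    then show ?thesis using True cosh_dist_eq_1_iff[OF q p] by simp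
  qed (rule dist_upper_bound[OF assms])
qed

section \<open>Convexity along geodesics\<close>

text \<open>
  At the ends of the interval only one-sided derivatives are assumed. The slopes of two adjacent chords
  are compared through the mean value theorem, which involves derivatives at interior points only.
\<close>

lemma convex_on_unit_interval:
  fixes h h' h'' :: "real \<Rightarrow> real"
  assumes h: "\<And>t. t \<in> {0..1} \<Longrightarrow> (h has_real_derivative h' t) (at t within {0..1})"
    and h': "\<And>t. t \<in> {0..1} \<Longrightarrow> (h' has_real_derivative h'' t) (at t within {0..1})"
    and pos: "\<And>t. t \<in> {0..1} \<Longrightarrow> 0 \<le> h'' t"
  shows "convex_on {0..1} h"
proof (rule convex_on_linorderI)
  have inner: "(h has_real_derivative h' t) (at t)" "(h' has_real_derivative h'' t) (at t)"
    if "0 < t" "t < 1" for t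
    using h[of t] h'[of t] that by (simp_all add: at_within_Icc_at)
  fix s x y :: real
  assume s: "0 < s" "s < 1" and xy: "x \<in> {0..1}" "y \<in> {0..1}" "x < y"
  define z where "z = (1 - s) * x + s * y"
  have zx: "z - x = s * (y - x)" "y - z = (1 - s) * (y - x)" by (simp_all add: z_def algebra_simps)
  have "0 < s * (y - x)" "0 < (1 - s) * (y - x)" using s xy by simp_all
  then have z: "x < z" "z < y" unfolding zx[symmetric] by simp_all
  have cont: "continuous_on {0..1} h"
    using h DERIV_continuous_on by blast
  have mvt: "\<exists>w>u. w < v \<and> h v - h u = (v - u) * h' w" if "0 \<le> u" "u < v" "v \<le> 1" for u v
  proof -
    have "continuous_on {u..v} h" using cont that by (elim continuous_on_subset) auto
    moreover have "(h has_derivative (*) (h' w)) (at w)" if "u < w" "w < v" for w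
      using inner(1)[of w] that \<open>0 \<le> u\<close> \<open>v \<le> 1\<close> by (simp add: has_field_derivative_def)
    ultimately show ?thesis
      using mvt[of u v h "\<lambda>w. (*) (h' w)"] \<open>u < v\<close> by (metis mult.commute)
  qed
  obtain u where u: "x < u" "u < z" "h z - h x = (z - x) * h' u" using mvt[of x z] z xy by auto
  obtain v where v: "z < v" "v < y" "h y - h z = (y - z) * h' v" using mvt[of z y] z xy by auto
  have "h' u \<le> h' v"
  proof (rule DERIV_nonneg_imp_nondecreasing[of u v h'])
    show "u \<le> v" using u v by simp
    fix w assume "u \<le> w" "w \<le> v"
    then have "0 < w" "w < 1" using u v xy by simp_all
    then show "\<exists>d. (h' has_real_derivative d) (at w) \<and> 0 \<le> d" using inner(2)[of w] pos[of w] by auto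
  qed
  then have "(1 - s) * s * (y - x) * h' u \<le> (1 - s) * s * (y - x) * h' v"
    using s xy by (intro mult_left_mono) auto
  then have "(1 - s) * (h z - h x) \<le> s * (h y - h z)"
    unfolding u(3) v(3) zx by (simp add: mult_ac)
  then have "h z \<le> (1 - s) * h x + s * h y" by (simp add: algebra_simps)
  then show "h ((1 - s) *\<^sub>R x + s *\<^sub>R y) \<le> (1 - s) * h x + s * h y" by (simp add: z_def)
qed simp

text \<open>
  Both arguments of \<open>\<omega>\<close> vary with \<open>s\<close>. Expansion of the second one in the basis reduces the claim
  to products of real functions; that \<open>D\<close> is linear in its first argument follows from the uniqueness
  of derivatives.
\<close>

lemma has_derivative_form_along_curve:
  fixes \<omega> :: "'a::euclidean_space \<Rightarrow> 'a \<Rightarrow> real" and \<gamma> \<gamma>' :: "real \<Rightarrow> 'a"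
  assumes U: "open U" "\<And>s. s \<in> I \<Longrightarrow> \<gamma> s \<in> U" "t \<in> I"
    and lin: "\<And>x. x \<in> U \<Longrightarrow> linear (\<omega> x)"
    and D: "\<And>v. ((\<lambda>x. \<omega> x v) has_derivative D v) (at (\<gamma> t))"
    and \<gamma>: "(\<gamma> has_vector_derivative \<gamma>' t) (at t within I)"
    and \<gamma>': "(\<gamma>' has_vector_derivative a) (at t within I)"
  shows "((\<lambda>s. \<omega> (\<gamma> s) (\<gamma>' s)) has_real_derivative D (\<gamma>' t) (\<gamma>' t) + \<omega> (\<gamma> t) a) (at t within I)"
proof -
  have expand: "\<omega> x v = (\<Sum>b\<in>Basis. (v \<bullet> b) * \<omega> x b)" if "x \<in> U" for x v
  proof -
    have "\<omega> x v = \<omega> x (\<Sum>b\<in>Basis. (v \<bullet> b) *\<^sub>R b)" by (simp add: euclidean_representation)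
    also have "\<dots> = (\<Sum>b\<in>Basis. \<omega> x ((v \<bullet> b) *\<^sub>R b))"
      by (rule linear_sum[OF lin[OF that]])
    also have "\<dots> = (\<Sum>b\<in>Basis. (v \<bullet> b) * \<omega> x b)"
      using linear_scale[OF lin[OF that]] by simp
    finally show ?thesis .
  qed
  have t: "\<gamma> t \<in> U" using U by blast
  have Dexpand: "D v u = (\<Sum>b\<in>Basis. (v \<bullet> b) * D b u)" for u v
  proof -
    have "((\<lambda>x. \<Sum>b\<in>Basis. (v \<bullet> b) * \<omega> x b) has_derivative (\<lambda>u. \<Sum>b\<in>Basis. (v \<bullet> b) * D b u)) (at (\<gamma> t))"
      by (intro has_derivative_sum has_derivative_mult_right D)
    then have "((\<lambda>x. \<omega> x v) has_derivative (\<lambda>u. \<Sum>b\<in>Basis. (v \<bullet> b) * D b u)) (at (\<gamma> t))"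
      by (rule has_derivative_transform_within_open[OF _ U(1) t]) (simp add: expand[symmetric])
    from has_derivative_unique[OF D this] show ?thesis by metis
  qed
  have comp: "((\<lambda>s. \<omega> (\<gamma> s) b) has_real_derivative D b (\<gamma>' t)) (at t within I)" for b
  proof -
    have "((\<lambda>s. \<omega> (\<gamma> s) b) has_derivative (\<lambda>h. D b (h *\<^sub>R \<gamma>' t))) (at t within I)"
      using has_derivative_in_compose[OF \<gamma>[unfolded has_vector_derivative_def]
          has_derivative_at_withinI[OF D]] .
    moreover have "D b (h *\<^sub>R \<gamma>' t) = D b (\<gamma>' t) * h" for h
      using linear_scale[OF has_derivative_linear[OF D]] by simp
    ultimately show ?thesis by (simp add: has_field_derivative_def)
  qed
  have coord: "((\<lambda>s. \<gamma>' s \<bullet> b) has_real_derivative a \<bullet> b) (at t within I)" for b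
    using bounded_linear.has_vector_derivative[OF bounded_linear_inner_left \<gamma>', of b]
    by (simp add: has_real_derivative_iff_has_vector_derivative)
  have "((\<lambda>s. \<Sum>b\<in>Basis. (\<gamma>' s \<bullet> b) * \<omega> (\<gamma> s) b) has_real_derivative
      (\<Sum>b\<in>Basis. (a \<bullet> b) * \<omega> (\<gamma> t) b + D b (\<gamma>' t) * (\<gamma>' t \<bullet> b))) (at t within I)"
    by (intro DERIV_sum DERIV_mult coord comp)
  also have "(\<Sum>b\<in>Basis. (a \<bullet> b) * \<omega> (\<gamma> t) b + D b (\<gamma>' t) * (\<gamma>' t \<bullet> b))
      = D (\<gamma>' t) (\<gamma>' t) + \<omega> (\<gamma> t) a"
    unfolding expand[OF t, of a] Dexpand[of "\<gamma>' t" "\<gamma>' t"]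
    by (simp add: sum.distrib mult.commute)
  finally have "((\<lambda>s. \<Sum>b\<in>Basis. (\<gamma>' s \<bullet> b) * \<omega> (\<gamma> s) b) has_derivative
      (*) (D (\<gamma>' t) (\<gamma>' t) + \<omega> (\<gamma> t) a)) (at t within I)"
    by (simp add: has_field_derivative_def)
  then have "((\<lambda>s. \<omega> (\<gamma> s) (\<gamma>' s)) has_derivative
      (*) (D (\<gamma>' t) (\<gamma>' t) + \<omega> (\<gamma> t) a)) (at t within I)"
    by (rule has_derivative_transform[OF U(3), rotated]) (simp add: expand[OF U(2)])
  then show ?thesis by (simp add: has_field_derivative_def)
qed

text \<open>
  The second derivative of \<open>f\<close> along a geodesic is the Hessian at its velocity: the geodesic equation
  contributes exactly the Christoffel term.
\<close>

lemma geodesically_convex_onI: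
  fixes f :: "'a::euclidean_space \<Rightarrow> real"
  assumes "open U"
    and f: "\<And>x. x \<in> U \<Longrightarrow> f differentiable (at x)"
    and df: "\<And>x v. x \<in> U \<Longrightarrow> (\<lambda>x. diff_form f x v) differentiable (at x)"
    and hess: "\<And>x u. x \<in> U \<Longrightarrow> 0 \<le> hessian G f x u u"
  shows "geodesically_convex_on U G f"
  unfolding geodesically_convex_on_def geodesic_in_def
proof (intro allI impI, elim exE)
  fix \<gamma> \<gamma>' :: "real \<Rightarrow> 'a"
  assume geo: "\<forall>t\<in>{0..1}. \<gamma> t \<in> U \<and> (\<gamma> has_vector_derivative \<gamma>' t) (at t within {0..1}) \<and>
     (\<gamma>' has_vector_derivative - levi_civita G (\<gamma> t) (\<gamma>' t) (\<gamma>' t)) (at t within {0..1})"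
  have der: "(f has_derivative diff_form f x) (at x)" if "x \<in> U" for x
    using f[OF that] unfolding diff_form_def by (simp add: frechet_derivative_works)
  show "convex_on {0..1} (\<lambda>t. f (\<gamma> t))"
  proof (rule convex_on_unit_interval)
    fix t :: real assume t: "t \<in> {0..1}"
    then have U: "\<gamma> t \<in> U" and g: "(\<gamma> has_vector_derivative \<gamma>' t) (at t within {0..1})"
      "(\<gamma>' has_vector_derivative - levi_civita G (\<gamma> t) (\<gamma>' t) (\<gamma>' t)) (at t within {0..1})"
      using geo by auto
    note lin = has_derivative_linear[OF der]
    have "((\<lambda>t. f (\<gamma> t)) has_derivative (\<lambda>h. diff_form f (\<gamma> t) (h *\<^sub>R \<gamma>' t))) (at t within {0..1})"
      using has_derivative_in_compose[OF g(1)[unfolded has_vector_derivative_def]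
          has_derivative_at_withinI[OF der[OF U]]] .
    then show "((\<lambda>t. f (\<gamma> t)) has_real_derivative diff_form f (\<gamma> t) (\<gamma>' t)) (at t within {0..1})"
      unfolding has_field_derivative_def
      by (rule has_derivative_eq_rhs) (simp add: fun_eq_iff linear_scale[OF lin[OF U]])
    have "((\<lambda>s. diff_form f (\<gamma> s) (\<gamma>' s)) has_real_derivative
        frechet_derivative (\<lambda>x. diff_form f x (\<gamma>' t)) (at (\<gamma> t)) (\<gamma>' t)
        + diff_form f (\<gamma> t) (- levi_civita G (\<gamma> t) (\<gamma>' t) (\<gamma>' t))) (at t within {0..1})"
      by (rule has_derivative_form_along_curve[where U = U
            and D = "\<lambda>v. frechet_derivative (\<lambda>x. diff_form f x v) (at (\<gamma> t))"])
         (use assms(1) geo t lin g df U in \<open>auto simp: frechet_derivative_works\<close>)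
    then show "((\<lambda>s. diff_form f (\<gamma> s) (\<gamma>' s)) has_real_derivative hessian G f (\<gamma> t) (\<gamma>' t) (\<gamma>' t))
        (at t within {0..1})"
      using linear_neg[OF lin[OF U]] by (simp add: hessian_def cov_deriv_form_def)
    show "0 \<le> hessian G f (\<gamma> t) (\<gamma>' t) (\<gamma>' t)" by (rule hess[OF U])
  qed
qed

section \<open>Splitting along the radial direction\<close>

text \<open>
  The differential of the distance from \<open>q\<close> at a point \<open>p \<noteq> q\<close>, see \<open>has_derivative_distance\<close>.
\<close>

definition radial :: "real \<Rightarrow> 'a::euclidean_space \<Rightarrow> 'a \<Rightarrow> 'a \<Rightarrow> real" where
  "radial \<kappa> q p v = (cosh_dist_grad q p \<bullet> v) / (sqrt \<kappa> * sinh (arcosh (cosh_dist q p)))"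

text \<open>
  The metric restricted to the parts orthogonal to the radial direction.
\<close>

definition transversal :: "real \<Rightarrow> 'a::euclidean_space \<Rightarrow> 'a \<Rightarrow> 'a \<Rightarrow> 'a \<Rightarrow> real" where
  "transversal \<kappa> q p u v = model_metric \<kappa> p u v - radial \<kappa> q p u * radial \<kappa> q p v"

text \<open>
  The Lorentz product is affine in \<open>p\<close> up to the factor \<open>2 * conformal_factor p\<close>, and
  \<open>hyp_time q - hyp_space q \<bullet> p \<ge> hyp_time q - norm (hyp_space q) > 0\<close>. So it is enough that the
  conformal factor, here \<open>K\<close>, is large.
\<close>

lemma exists_far_point:
  fixes q :: "'a::euclidean_space"
  assumes q: "q \<in> ball 0 1" and R: "0 < R"
  obtains p where "p \<in> ball 0 1" "p \<noteq> q" "R < arcosh (cosh_dist q p)"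
proof -
  define T where "T = hyp_time q"
  define d where "d = T - norm (hyp_space q)"
  have T: "1 \<le> T" using hyp_time_ge_1[OF q] by (simp add: T_def)
  have "(norm (hyp_space q))\<^sup>2 < T\<^sup>2"
    using hyperboloid[OF q] by (simp add: T_def power2_norm_eq_inner)
  then have d: "d > 0" using T by (simp add: d_def power_less_imp_less_base)
  define K where "K = max 1 ((cosh R + T + 1) / (2 * d))"
  have K: "1 \<le> K" "cosh R + T + 1 \<le> 2 * K * d"
  proof -
    have "(cosh R + T + 1) / (2 * d) \<le> K" by (simp add: K_def)
    then show "cosh R + T + 1 \<le> 2 * K * d" using d by (simp add: pos_divide_le_eq mult_ac)
  qed (simp add: K_def)
  obtain b :: 'a where b: "b \<in> Basis" using nonempty_Basis by blast
  define p where "p = sqrt (1 - 1 / K) *\<^sub>R b"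
  have "p \<bullet> p = 1 - 1 / K" using K(1) b by (simp add: p_def)
  then have p: "p \<in> ball 0 1" and conformal_factor: "conformal_factor p = K"
    using K(1) by (simp_all add: norm_eq_sqrt_inner conformal_factor_def)
  have "hyp_space q \<bullet> p \<le> norm (hyp_space q) * norm p" by (rule norm_cauchy_schwarz)
  also have "\<dots> \<le> norm (hyp_space q) * 1" using p by (intro mult_left_mono) auto
  finally have "2 * K * d \<le> 2 * K * (T - hyp_space q \<bullet> p)"
    using K(1) by (intro mult_left_mono) (auto simp: d_def)
  then have c: "cosh R < cosh_dist q p"
    using K(2) by (simp add: cosh_dist_alt conformal_factor T_def)
  have "arcosh (cosh R) < arcosh (cosh_dist q p)"
    using c cosh_real_ge_1[of R] by (intro arcosh_real_strict_mono) auto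
  then have far: "R < arcosh (cosh_dist q p)" using R by (simp add: arcosh_cosh_real)
  moreover have "p \<noteq> q" using far R cosh_dist_eq_1_iff[OF q p] by auto
  ultimately show thesis using that p by blast
qed

context
  fixes \<kappa> :: real and q p :: "'a::euclidean_space" and f :: "'a \<Rightarrow> real"
  assumes \<kappa>: "\<kappa> > 0" and q: "q \<in> ball 0 1" and p: "p \<in> ball 0 1" and pq: "p \<noteq> q"
begin

private abbreviation (input) "r \<equiv> arcosh (cosh_dist q p)"

lemma far_from_center: "0 < r" "cosh r = cosh_dist q p" "0 < sinh r"
proof -
  have c: "1 \<le> cosh_dist q p" "cosh_dist q p \<noteq> 1"
    using cosh_dist_ge_1[OF q p] cosh_dist_eq_1_iff[OF q p] pq by auto
  show r: "0 < r" using c by simp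
  show "cosh r = cosh_dist q p" using c by simp
  show "0 < sinh r" using r by simp
qed

lemma grad_radial: "cosh_dist_grad q p \<bullet> v = sqrt \<kappa> * sinh r * radial \<kappa> q p v"
  using far_from_center(3) \<kappa> by (simp add: radial_def)

lemma radial_unit:
  obtains e where "norm e = 1" "\<And>v. radial \<kappa> q p v = 2 * conformal_factor p / sqrt \<kappa> * (e \<bullet> v)"
proof
  let ?N = "cosh_dist_grad q p"
  have N: "norm ?N = 2 * conformal_factor p * sinh r" by (rule norm_grad_eq[OF q p])
  then have pos: "norm ?N > 0" using conformal_factor_pos[OF p] far_from_center(3) by simp
  then show "norm ((1 / norm ?N) *\<^sub>R ?N) = 1" by simp
  show "radial \<kappa> q p v = 2 * conformal_factor p / sqrt \<kappa> * (((1 / norm ?N) *\<^sub>R ?N) \<bullet> v)" for v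
    using far_from_center(3) conformal_factor_pos[OF p] \<kappa> unfolding N by (simp add: radial_def)
qed

text \<open>
  In terms of the Euclidean unit vector \<open>e\<close> in the radial direction, \<open>transversal\<close> is a positive
  multiple of the Euclidean product of the projections to the complement of \<open>e\<close>; hence it is positive
  semidefinite.
\<close>

lemma transversal_eq:
  obtains e where "norm e = 1" "\<And>v. radial \<kappa> q p v = 2 * conformal_factor p / sqrt \<kappa> * (e \<bullet> v)"
    "\<And>u v. transversal \<kappa> q p u v = (2 * conformal_factor p / sqrt \<kappa>)\<^sup>2 * ((u - (e \<bullet> u) *\<^sub>R e) \<bullet> (v - (e \<bullet> v) *\<^sub>R e))"
proof (rule radial_unit)
  fix e assume e: "norm e = 1" "\<And>v. radial \<kappa> q p v = 2 * conformal_factor p / sqrt \<kappa> * (e \<bullet> v)"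
  have ee: "e \<bullet> e = 1" using e(1) by (simp add: norm_eq_sqrt_inner)
  have "transversal \<kappa> q p u v = (2 * conformal_factor p / sqrt \<kappa>)\<^sup>2 * (u \<bullet> v - (e \<bullet> u) * (e \<bullet> v))" for u v
    using \<kappa> by (simp add: transversal_def e(2) model_metric_conf power_divide power_mult_distrib
        right_diff_distrib power2_eq_square)
  moreover have "(u - (e \<bullet> u) *\<^sub>R e) \<bullet> (v - (e \<bullet> v) *\<^sub>R e) = u \<bullet> v - (e \<bullet> u) * (e \<bullet> v)" for u v
    by (simp add: inner_diff_left inner_diff_right ee inner_commute[of u e])
  ultimately show thesis using that e by simp
qed

lemma transversal_nonneg: "0 \<le> transversal \<kappa> q p u u"
  by (rule transversal_eq) simp

lemma transversal_Cauchy_Schwarz: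
  "(transversal \<kappa> q p u v)\<^sup>2 \<le> transversal \<kappa> q p u u * transversal \<kappa> q p v v"
proof (rule transversal_eq)
  fix e assume "\<And>u v. transversal \<kappa> q p u v
    = (2 * conformal_factor p / sqrt \<kappa>)\<^sup>2 * ((u - (e \<bullet> u) *\<^sub>R e) \<bullet> (v - (e \<bullet> v) *\<^sub>R e))"
  moreover have "(l * (x \<bullet> y))\<^sup>2 \<le> (l * (x \<bullet> x)) * (l * (y \<bullet> y))" for l :: real and x y :: 'a
  proof -
    have "l\<^sup>2 * (x \<bullet> y)\<^sup>2 \<le> l\<^sup>2 * ((x \<bullet> x) * (y \<bullet> y))"
      by (intro mult_left_mono Cauchy_Schwarz_ineq) simp
    then show ?thesis by (simp add: power_mult_distrib power2_eq_square mult_ac)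
  qed
  ultimately show ?thesis by simp
qed

lemma radial_le_riem_norm: "\<bar>radial \<kappa> q p v\<bar> \<le> riem_norm (model_metric \<kappa>) p v"
  using transversal_nonneg[of v] unfolding riem_norm_def transversal_def
  by (intro real_le_rsqrt) (simp add: power2_eq_square)

text \<open>
  The vectors that show optimality: \<open>w\<close> is a unit vector orthogonal to the radial direction, and \<open>u\<close>
  lies in the plane of \<open>w\<close> and the radial direction.
\<close>

lemma adapted_vectors:
  assumes "DIM('a) \<ge> 2"
  obtains u w where "radial \<kappa> q p u = \<alpha>" "transversal \<kappa> q p u u = \<beta>\<^sup>2"
    "radial \<kappa> q p w = 0" "transversal \<kappa> q p w w = 1" "transversal \<kappa> q p w u = \<beta>"
proof (rule transversal_eq)
  fix e assume e: "norm e = 1" "\<And>v. radial \<kappa> q p v = 2 * conformal_factor p / sqrt \<kappa> * (e \<bullet> v)"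
    "\<And>u v. transversal \<kappa> q p u v = (2 * conformal_factor p / sqrt \<kappa>)\<^sup>2 * ((u - (e \<bullet> u) *\<^sub>R e) \<bullet> (v - (e \<bullet> v) *\<^sub>R e))"
  obtain y where y: "y \<noteq> 0" "orthogonal e y" using orthogonal_to_vector_exists[OF assms] by blast
  define t where "t = (1 / norm y) *\<^sub>R y"
  have t: "t \<bullet> t = 1" "e \<bullet> t = 0"
    using y by (simp_all add: t_def orthogonal_def dot_square_norm power2_eq_square)
  have ee: "e \<bullet> e = 1" using e(1) by (simp add: norm_eq_sqrt_inner)
  define l where "l = 2 * conformal_factor p / sqrt \<kappa>"
  have l: "l > 0" using conformal_factor_pos[OF p] \<kappa> by (simp add: l_def)
  show thesis
    by (rule that[of "(\<alpha> / l) *\<^sub>R e + (\<beta> / l) *\<^sub>R t" "(1 / l) *\<^sub>R t"])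
       (use l in \<open>simp_all add: e(2,3) l_def[symmetric] inner_add_left inner_add_right inner_diff_left
          inner_diff_right t ee inner_commute[of t e] power2_eq_square\<close>)
qed

context
  assumes f: "\<forall>x\<in>ball 0 1. f x = arcosh_sq (cosh_dist q x) / \<kappa>"
begin

lemma hessian_radial:
  "hessian (model_metric \<kappa>) f p u u
    = 2 * (radial \<kappa> q p u)\<^sup>2 + 2 * rcoth r * transversal \<kappa> q p u u"
proof -
  define a c s F1 F2 where "a = radial \<kappa> q p u" and "c = cosh_dist q p" and "s = sinh r"
    and "F1 = arcosh_sq' c" and "F2 = arcosh_sq'' c"
  have ode: "s\<^sup>2 * F2 + c * F1 = 2"
    using arcosh_sq_ode(1)[OF far_from_center(1)] far_from_center(2)
    by (simp add: c_def s_def F1_def F2_def)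
  have k: "c * F1 = 2 * rcoth r"
    using arcosh_sq'_cosh[OF far_from_center(1)] far_from_center(2)
    by (simp add: c_def F1_def rcoth_def)
  have "hessian (model_metric \<kappa>) f p u u = F2 / \<kappa> * (sqrt \<kappa> * s * a) * (sqrt \<kappa> * s * a)
      + F1 * c * (transversal \<kappa> q p u u + a\<^sup>2)"
    unfolding hessian_sq_dist[OF \<kappa> q f p] grad_radial
    by (simp add: a_def c_def s_def F1_def F2_def transversal_def power2_eq_square)
  also have "F2 / \<kappa> * (sqrt \<kappa> * s * a) * (sqrt \<kappa> * s * a) = s\<^sup>2 * F2 * a\<^sup>2"
  proof -
    have "F2 / \<kappa> * (sqrt \<kappa> * s * a) * (sqrt \<kappa> * s * a) = F2 / \<kappa> * (sqrt \<kappa> * sqrt \<kappa>) * (s\<^sup>2 * a\<^sup>2)"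
      by (simp add: power2_eq_square)
    then show ?thesis using \<kappa> by simp
  qed
  also have "s\<^sup>2 * F2 = 2 - c * F1" using ode by simp
  finally have "hessian (model_metric \<kappa>) f p u u
      = (2 - 2 * rcoth r) * a\<^sup>2 + 2 * rcoth r * (transversal \<kappa> q p u u + a\<^sup>2)"
    by (simp only: k mult.commute[of F1 c])
  then show ?thesis by (simp add: a_def algebra_simps)
qed

text \<open>
  The purely radial term is zero by the third-order equation of \<open>arcosh_sq_ode\<close>, in accordance with
  \<open>d\<^sup>2\<close> being quadratic along radial geodesics.
\<close>

lemma nabla3_radial:
  "nabla3 (model_metric \<kappa>) f p w u u
    = 2 * sqrt \<kappa> * (rcoth_deriv r * radial \<kappa> q p w * transversal \<kappa> q p u u
        - 2 * mixed_coeff r * radial \<kappa> q p u * transversal \<kappa> q p w u)"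
proof -
  define a b c s F1 F2 F3 where "a = radial \<kappa> q p u" and "b = radial \<kappa> q p w" and "c = cosh_dist q p"
    and "s = sinh r" and "F1 = arcosh_sq' c" and "F2 = arcosh_sq'' c" and "F3 = arcosh_sq''' c"
  define P X where "P = transversal \<kappa> q p u u" and "X = transversal \<kappa> q p w u"
  have s: "s > 0" using far_from_center(3) by (simp add: s_def)
  have cr: "cosh r = c" using far_from_center(2) by (simp add: c_def)
  have ode: "s\<^sup>2 * F2 + c * F1 = 2" "s\<^sup>2 * F3 + 3 * c * F2 + F1 = 0"
    using arcosh_sq_ode[OF far_from_center(1)] far_from_center(2)
    by (simp_all add: c_def s_def F1_def F2_def F3_def)
  have F1: "F1 = 2 * r / s"
    using arcosh_sq'_cosh[OF far_from_center(1)] far_from_center(2) by (simp add: c_def s_def F1_def)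
  have c2: "c\<^sup>2 = s\<^sup>2 + 1" using cosh_square_eq[of r] by (simp add: cr s_def)
  have F2: "F2 = 2 * (s - r * c) / s ^ 3"
  proof -
    have "s\<^sup>2 * F2 = 2 - c * F1" using ode(1) by simp
    then show ?thesis using s by (simp add: F1 field_simps power2_eq_square power3_eq_cube)
  qed
  have m: "s * (c * F2) = - 2 * mixed_coeff r"
    using s by (simp add: F2 mixed_coeff_def s_def[symmetric] cr field_simps power2_eq_square power3_eq_cube)
  have k': "s * (c * F2 + F1) = 2 * rcoth_deriv r"
  proof -
    have "s * (c * F2 + F1) = 2 * (c * s - r * c\<^sup>2 + r * s\<^sup>2) / s\<^sup>2"
      using s by (simp add: F1 F2 field_simps power2_eq_square power3_eq_cube)
    also have "c * s - r * c\<^sup>2 + r * s\<^sup>2 = s * c - r" unfolding c2 by (simp add: algebra_simps)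
    finally show ?thesis by (simp add: rcoth_deriv_def s_def cr)
  qed
  have G: "model_metric \<kappa> p u u = P + a\<^sup>2" "model_metric \<kappa> p w u = X + a * b"
    by (simp_all add: P_def X_def a_def b_def transversal_def power2_eq_square)
  have "nabla3 (model_metric \<kappa>) f p w u u
    = F3 / \<kappa> * (sqrt \<kappa> * s * b) * (sqrt \<kappa> * s * a) * (sqrt \<kappa> * s * a)
      + F2 * c * ((X + a * b) * (sqrt \<kappa> * s * a) + (X + a * b) * (sqrt \<kappa> * s * a))
      + (F2 * c + F1) * (sqrt \<kappa> * s * b) * (P + a\<^sup>2)"
    unfolding nabla3_sq_dist[OF \<kappa> q f p] grad_radial G
    by (simp add: a_def b_def c_def s_def F1_def F2_def F3_def)
  also have "F3 / \<kappa> * (sqrt \<kappa> * s * b) * (sqrt \<kappa> * s * a) * (sqrt \<kappa> * s * a)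
      = sqrt \<kappa> * s * (s\<^sup>2 * F3) * b * a\<^sup>2"
  proof -
    have "F3 / \<kappa> * (sqrt \<kappa> * s * b) * (sqrt \<kappa> * s * a) * (sqrt \<kappa> * s * a)
        = F3 / \<kappa> * (sqrt \<kappa> * sqrt \<kappa>) * sqrt \<kappa> * (s * s\<^sup>2 * b * a\<^sup>2)"
      by (simp add: power2_eq_square)
    then show ?thesis using \<kappa> by simp
  qed
  also have "s\<^sup>2 * F3 = - 3 * c * F2 - F1" using ode(2) by simp
  also have "sqrt \<kappa> * s * (- 3 * c * F2 - F1) * b * a\<^sup>2
      + F2 * c * ((X + a * b) * (sqrt \<kappa> * s * a) + (X + a * b) * (sqrt \<kappa> * s * a))
      + (F2 * c + F1) * (sqrt \<kappa> * s * b) * (P + a\<^sup>2)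
    = sqrt \<kappa> * ((s * (c * F2 + F1)) * b * P + 2 * (s * (c * F2)) * a * X)"
    by (simp add: algebra_simps power2_eq_square)
  finally show ?thesis unfolding m k' by (simp add: P_def X_def a_def b_def algebra_simps)
qed

end

lemma has_derivative_distance:
  fixes g :: "'a \<Rightarrow> real"
  assumes g: "\<forall>x\<in>ball 0 1. g x = arcosh (cosh_dist q x) / sqrt \<kappa>"
  shows "(g has_derivative radial \<kappa> q p) (at p)"
proof -
  have c: "1 < cosh_dist q p"
    using cosh_dist_ge_1[OF q p] cosh_dist_eq_1_iff[OF q p] pq by force
  have "((\<lambda>x. 1 / sqrt \<kappa> * arcosh (cosh_dist q x)) has_derivative
      (\<lambda>v. 1 / sqrt \<kappa> * ((cosh_dist_grad q p \<bullet> v) * (1 / sqrt ((cosh_dist q p)\<^sup>2 - 1))))) (at p)"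
    using arcosh_real_has_field_derivative[OF c]
    by (intro has_derivative_mult_right DERIV_compose_FDERIV has_derivative_cosh_dist[OF p]) simp
  also have "(\<lambda>v. 1 / sqrt \<kappa> * ((cosh_dist_grad q p \<bullet> v) * (1 / sqrt ((cosh_dist q p)\<^sup>2 - 1))))
      = radial \<kappa> q p"
    using c by (simp add: fun_eq_iff radial_def sinh_arcosh_real)
  finally show ?thesis
    by (rule has_derivative_transform_within_open[of _ _ p UNIV "ball 0 1"]) (use p g in auto)
qed

end

section \<open>Polarisation of quadratic bounds\<close>

lemma quadratic_nonneg_discriminant:
  fixes A B D :: real
  assumes "\<And>t. 0 \<le> A * t\<^sup>2 + 2 * B * t + D" "0 \<le> A"
  shows "B\<^sup>2 \<le> A * D"
proof (cases "A = 0")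
  case True
  have "B = 0"
  proof (rule ccontr)
    assume "B \<noteq> 0"
    then show False using assms(1)[of "- (D + 1) / (2 * B)"] True by simp
  qed
  then show ?thesis using True by simp
next
  case False
  then have "A > 0" using assms(2) by simp
  have "0 \<le> A * (A * (- B / A)\<^sup>2 + 2 * B * (- B / A) + D)"
    using assms by (intro mult_nonneg_nonneg)
  also have "\<dots> = A * D - B\<^sup>2" using \<open>A > 0\<close> by (simp add: field_simps power2_eq_square)
  finally show ?thesis by simp
qed

text \<open>
  Comparison of \<open>B\<close> and \<open>C * H\<close> at \<open>t *\<^sub>R u + v\<close> and \<open>- t *\<^sub>R u + v\<close> eliminates the off-diagonal term of
  \<open>H\<close>, and the discriminant of the resulting quadratic polynomial in \<open>t\<close> is nonpositive. This passes
  from the estimate for \<open>(w, u, u)\<close> to self-concordance with three independent vectors.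
\<close>

lemma polarisation_bound:
  fixes B H :: "'a::real_vector \<Rightarrow> 'a \<Rightarrow> real"
  assumes quadB: "\<And>t u v. B (t *\<^sub>R u + v) (t *\<^sub>R u + v) = t\<^sup>2 * B u u + 2 * t * B u v + B v v"
    and quadH: "\<And>t u v. H (t *\<^sub>R u + v) (t *\<^sub>R u + v) = t\<^sup>2 * H u u + 2 * t * H u v + H v v"
    and pos: "\<And>u. 0 \<le> H u u" and C: "0 \<le> C" and bound: "\<And>u. \<bar>B u u\<bar> \<le> C * H u u"
  shows "\<bar>B u v\<bar> \<le> C * sqrt (H u u) * sqrt (H v v)"
proof -
  have quad: "0 \<le> (C * H u u) * t\<^sup>2 + 2 * B u v * t + C * H v v" for t
  proof -
    have "\<bar>t\<^sup>2 * B u u + 2 * t * B u v + B v v\<bar> \<le> C * (t\<^sup>2 * H u u + 2 * t * H u v + H v v)"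
      using bound[of "t *\<^sub>R u + v"] unfolding quadB quadH .
    moreover have "\<bar>t\<^sup>2 * B u u - 2 * t * B u v + B v v\<bar> \<le> C * (t\<^sup>2 * H u u - 2 * t * H u v + H v v)"
      using bound[of "(- t) *\<^sub>R u + v"] unfolding quadB quadH by simp
    ultimately have "- (C * (t\<^sup>2 * H u u + 2 * t * H u v + H v v) + C * (t\<^sup>2 * H u u - 2 * t * H u v + H v v))
        \<le> 4 * (t * B u v)"
      by linarith
    then show ?thesis by (simp add: algebra_simps)
  qed
  have "(B u v)\<^sup>2 \<le> (C * H u u) * (C * H v v)"
    using quad C pos by (intro quadratic_nonneg_discriminant) auto
  also have "\<dots> = (C * sqrt (H u u) * sqrt (H v v))\<^sup>2"
    using pos by (simp add: power_mult_distrib) (simp add: power2_eq_square)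
  finally show ?thesis using C pos by (simp add: abs_le_square_iff[symmetric] abs_mult)
qed


section \<open>The estimates\<close>

lemma powr_three_halves:
  fixes x :: real
  assumes "0 \<le> x"
  shows "x powr (3 / 2) = x * sqrt x"
proof (cases "x = 0")
  case False
  then have "x powr (1 + 1 / 2) = x * sqrt x"
    using assms unfolding powr_add by (simp add: powr_half_sqrt)
  then show ?thesis by simp
qed simp

context
  fixes \<kappa> :: real and q :: "'a::euclidean_space" and f :: "'a \<Rightarrow> real"
  assumes \<kappa>: "\<kappa> > 0" and q: "q \<in> ball 0 1"
    and f: "\<forall>x\<in>ball 0 1. f x = arcosh_sq (cosh_dist q x) / \<kappa>"
begin

private abbreviation (input) "G \<equiv> model_metric \<kappa> :: 'a metric_tensor"
private abbreviation (input) "rad p \<equiv> arcosh (cosh_dist q p)"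

lemma nabla3_at_center: "nabla3 G f q w u v = 0"
proof -
  have "cosh_dist_grad q q = 0"
    using norm_grad_eq[OF q q] cosh_dist_eq_1_iff[OF q q] by simp
  then show ?thesis unfolding nabla3_sq_dist[OF \<kappa> q f q] by simp
qed

text \<open>
  At the centre itself the gradient vanishes and the Hessian is a positive multiple of the metric.
\<close>

lemma hessian_nonneg:
  assumes p: "p \<in> ball 0 1"
  shows "0 \<le> hessian G f p u u"
proof (cases "p = q")
  case True
  have "cosh_dist_grad q q = 0" "cosh_dist q q = 1"
    using norm_grad_eq[OF q q] cosh_dist_eq_1_iff[OF q q] by simp_all
  then have "hessian G f q u u = arcosh_sq' 1 * G q u u"
    unfolding hessian_sq_dist[OF \<kappa> q f q] by simp
  then show ?thesis using True arcosh_sq'_pos[of 1] \<kappa> by (simp add: model_metric_conf)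
next
  case False
  have "1 \<le> rcoth (rad p)" by (rule rcoth_ge_1[OF far_from_center(1)[OF \<kappa> q p False]])
  then show ?thesis
    using transversal_nonneg[OF \<kappa> q p False, of u] hessian_radial[OF \<kappa> q p False f, of u] by simp
qed

lemma mixed_bound:
  assumes p: "p \<in> ball 0 1"
  shows "\<bar>nabla3 G f p w u u\<bar> \<le> sqrt (\<kappa> / 2) * sqrt (hessian G f p w w) * hessian G f p u u"
proof (cases "p = q")
  case True
  then show ?thesis using nabla3_at_center hessian_nonneg[OF p] \<kappa> by simp
next
  case False
  note r = far_from_center(1)[OF \<kappa> q p False]
  define k a b P Q where "k = rcoth (rad p)" and "a = radial \<kappa> q p u" and "b = radial \<kappa> q p w"
    and "P = transversal \<kappa> q p u u" and "Q = transversal \<kappa> q p w w"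
  define L where "L = rcoth_deriv (rad p) * b * P - 2 * mixed_coeff (rad p) * a * transversal \<kappa> q p w u"
  have L: "\<bar>L\<bar> \<le> sqrt (b\<^sup>2 + k * Q) * (a\<^sup>2 + k * P)"
    unfolding L_def
  proof (rule third_order_bound)
    show "0 < k" using rcoth_ge_1[OF r] by (simp add: k_def)
    show "(rcoth_deriv (rad p))\<^sup>2 \<le> k\<^sup>2"
      unfolding k_def using rcoth_deriv_le[OF r] rcoth_deriv_nonneg[OF r] by (rule power_mono)
    show "2 * (mixed_coeff (rad p))\<^sup>2 + (rcoth_deriv (rad p))\<^sup>2 \<le> 2 * k\<^sup>2"
      unfolding k_def by (rule coeff_square_bound[OF r])
    show "0 \<le> P" "0 \<le> Q" unfolding P_def Q_def by (rule transversal_nonneg[OF \<kappa> q p False])+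
    show "(transversal \<kappa> q p w u)\<^sup>2 \<le> P * Q"
      using transversal_Cauchy_Schwarz[OF \<kappa> q p False, of w u] by (simp add: P_def Q_def mult.commute)
  qed
  have N: "nabla3 G f p w u u = 2 * sqrt \<kappa> * L"
    unfolding L_def a_def b_def P_def by (rule nabla3_radial[OF \<kappa> q p False f])
  have H: "hessian G f p u u = 2 * (a\<^sup>2 + k * P)" "hessian G f p w w = 2 * (b\<^sup>2 + k * Q)"
    using hessian_radial[OF \<kappa> q p False f] by (simp_all add: a_def b_def k_def P_def Q_def)
  have "\<bar>nabla3 G f p w u u\<bar> = 2 * sqrt \<kappa> * \<bar>L\<bar>" unfolding N using \<kappa> by (simp add: abs_mult)
  also have "\<dots> \<le> 2 * sqrt \<kappa> * (sqrt (b\<^sup>2 + k * Q) * (a\<^sup>2 + k * P))"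
    using L \<kappa> by (intro mult_left_mono) auto
  also have "sqrt \<kappa> = sqrt (\<kappa> / 2) * sqrt 2" by (simp add: real_sqrt_mult[symmetric])
  also have "2 * (sqrt (\<kappa> / 2) * sqrt 2) * (sqrt (b\<^sup>2 + k * Q) * (a\<^sup>2 + k * P))
      = sqrt (\<kappa> / 2) * (sqrt 2 * sqrt (b\<^sup>2 + k * Q)) * (2 * (a\<^sup>2 + k * P))"
    by simp
  finally show ?thesis unfolding H real_sqrt_mult[of 2] .
qed

text \<open>
  For \<open>w = u\<close> the third derivative is \<open>2 * sqrt \<kappa> * a * P * d\<close> with \<open>\<bar>d\<bar> \<le> 2 * rcoth r\<close>, and
  \<open>cubic_amgm\<close> applies to \<open>a\<close> and \<open>rcoth r * P\<close>.
\<close>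

lemma cubic_bound:
  assumes p: "p \<in> ball 0 1"
  shows "\<bar>nabla3 G f p u u u\<bar> \<le> sqrt (8 * \<kappa> / 27) * hessian G f p u u powr (3 / 2)"
proof (cases "p = q")
  case True
  then show ?thesis using nabla3_at_center \<kappa> by simp
next
  case False
  note r = far_from_center(1)[OF \<kappa> q p False]
  define k a P where "k = rcoth (rad p)" and "a = radial \<kappa> q p u" and "P = transversal \<kappa> q p u u"
  define d where "d = rcoth_deriv (rad p) - 2 * mixed_coeff (rad p)"
  define y where "y = hessian G f p u u"
  have P: "0 \<le> P" unfolding P_def by (rule transversal_nonneg[OF \<kappa> q p False])
  have k: "1 \<le> k" unfolding k_def by (rule rcoth_ge_1[OF r])
  have d: "\<bar>d\<bar> \<le> 2 * k"
    using rcoth_deriv_le[OF r] rcoth_deriv_nonneg[OF r] mixed_coeff_le[OF r] mixed_coeff_nonneg[OF r] k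
    by (simp add: d_def k_def)
  have y: "y = 2 * (a\<^sup>2 + k * P)"
    using hessian_radial[OF \<kappa> q p False f, of u] by (simp add: y_def a_def k_def P_def)
  have y0: "0 \<le> y" unfolding y_def by (rule hessian_nonneg[OF p])
  have N: "nabla3 G f p u u u = 2 * sqrt \<kappa> * (a * P * d)"
    using nabla3_radial[OF \<kappa> q p False f, of u u] by (simp add: d_def a_def P_def algebra_simps)
  have "(nabla3 G f p u u u)\<^sup>2 = 4 * \<kappa> * a\<^sup>2 * P\<^sup>2 * d\<^sup>2"
    unfolding N using \<kappa> by (simp add: power_mult_distrib)
  also have "\<dots> \<le> 4 * \<kappa> * a\<^sup>2 * P\<^sup>2 * (2 * k)\<^sup>2"
    using power_mono[OF d abs_ge_zero, of 2] \<kappa> by (intro mult_left_mono) simp_all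
  also have "\<dots> = 16 * \<kappa> / 27 * (27 * (a\<^sup>2 * (k * P)\<^sup>2))" by (simp add: power_mult_distrib)
  also have "\<dots> \<le> 16 * \<kappa> / 27 * (4 * (a\<^sup>2 + k * P) ^ 3)"
    using cubic_amgm[of "k * P" a] k P \<kappa> by (intro mult_left_mono) auto
  also have "\<dots> = 8 * \<kappa> / 27 * y ^ 3" unfolding y power_mult_distrib by simp
  also have "\<dots> = (sqrt (8 * \<kappa> / 27) * (y * sqrt y))\<^sup>2"
    using \<kappa> y0 unfolding power_mult_distrib by (simp add: power2_eq_square[of y] power3_eq_cube)
  finally have "\<bar>nabla3 G f p u u u\<bar> \<le> \<bar>sqrt (8 * \<kappa> / 27) * (y * sqrt y)\<bar>"
    by (simp only: abs_le_square_iff)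
  then show ?thesis using \<kappa> y0 by (simp add: powr_three_halves y_def[symmetric] abs_mult)
qed

lemma smooth_and_convex: "smooth_on (ball 0 1) f" "geodesically_convex_on (ball 0 1) G f"
proof -
  show "smooth_on (ball 0 1) f" by (rule smooth_on_sq_dist[OF q f])
  show "geodesically_convex_on (ball 0 1) G f"
    using has_derivative_sq_dist[OF \<kappa> q f] has_derivative_diff_form_sq_dist[OF \<kappa> q f] hessian_nonneg
    by (intro geodesically_convex_onI open_ball) (auto intro: differentiableI)
qed

lemma self_concordant_sq_dist: "self_concordant (ball 0 1) G (8 / \<kappa>) f"
  unfolding self_concordant_def
proof (intro conjI ballI allI)
  show "8 / \<kappa> > 0" using \<kappa> by simp
  show "smooth_on (ball 0 1) f" "geodesically_convex_on (ball 0 1) G f" by (rule smooth_and_convex)+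
  fix p u v w :: 'a assume p: "p \<in> ball 0 1"
  let ?C = "sqrt (\<kappa> / 2) * sqrt (hessian G f p u u)"
  have "\<bar>nabla3 G f p u v w\<bar> \<le> ?C * sqrt (hessian G f p v v) * sqrt (hessian G f p w w)"
  proof (rule polarisation_bound[where B = "nabla3 G f p u" and H = "hessian G f p"])
    fix t :: real and x y :: 'a
    show "nabla3 G f p u (t *\<^sub>R x + y) (t *\<^sub>R x + y)
        = t\<^sup>2 * nabla3 G f p u x x + 2 * t * nabla3 G f p u x y + nabla3 G f p u y y"
      unfolding nabla3_sq_dist[OF \<kappa> q f p] unfolding model_metric_conf
      by (simp add: inner_add_left inner_add_right inner_commute[of y x] algebra_simps power2_eq_square
          add_divide_distrib)
    show "hessian G f p (t *\<^sub>R x + y) (t *\<^sub>R x + y)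
        = t\<^sup>2 * hessian G f p x x + 2 * t * hessian G f p x y + hessian G f p y y"
      unfolding hessian_sq_dist[OF \<kappa> q f p] unfolding model_metric_conf
      by (simp add: inner_add_left inner_add_right inner_commute[of y x] algebra_simps power2_eq_square
          add_divide_distrib)
    show "0 \<le> hessian G f p x x" by (rule hessian_nonneg[OF p])
    show "0 \<le> ?C" using \<kappa> hessian_nonneg[OF p] by simp
    show "\<bar>nabla3 G f p u x x\<bar> \<le> ?C * hessian G f p x x" by (rule mixed_bound[OF p])
  qed
  moreover have "2 / sqrt (8 / \<kappa>) = sqrt (\<kappa> / 2)"
  proof -
    have "2 / sqrt (8 / \<kappa>) = sqrt (4 / (8 / \<kappa>))" unfolding real_sqrt_divide[of 4] by simp
    then show ?thesis by simp
  qed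
  ultimately show "\<bar>nabla3 G f p u v w\<bar> \<le> 2 / sqrt (8 / \<kappa>) * sqrt (hessian G f p u u)
      * sqrt (hessian G f p v v) * sqrt (hessian G f p w w)" by simp
qed

lemma self_concordant_along_geodesics_sq_dist:
  "self_concordant_along_geodesics (ball 0 1) G (27 / (2 * \<kappa>)) f"
proof -
  have "2 / sqrt (27 / (2 * \<kappa>)) = sqrt (4 / (27 / (2 * \<kappa>)))" unfolding real_sqrt_divide[of 4] by simp
  also have "4 / (27 / (2 * \<kappa>)) = 8 * \<kappa> / 27" by simp
  finally show ?thesis
    unfolding self_concordant_along_geodesics_def using smooth_and_convex cubic_bound \<kappa> by simp
qed

text \<open>
  For \<open>w\<close> orthogonal to the radial direction and \<open>u\<close> with \<open>a\<^sup>2 = k * P\<close>, the equality case of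
  \<open>third_order_bound\<close> for \<open>m = k\<close> and \<open>k' = 0\<close>, self-concordance becomes \<open>m \<le> \<theta> * k\<close>, where
  \<open>\<theta> < 1\<close> if \<open>\<alpha> > 8 / \<kappa>\<close>. This fails for large \<open>r\<close>.
\<close>

lemma self_concordant_sharp:
  assumes dim: "DIM('a) \<ge> 2" and sc: "self_concordant (ball 0 1) G \<alpha> f"
  shows "\<alpha> \<le> 8 / \<kappa>"
proof (rule ccontr)
  assume "\<not> \<alpha> \<le> 8 / \<kappa>"
  then have \<alpha>: "8 < \<alpha> * \<kappa>" using \<kappa> by (simp add: field_simps)
  define \<theta> where "\<theta> = sqrt (8 / (\<alpha> * \<kappa>))"
  have \<theta>: "\<theta> < 1" using \<alpha> by (simp add: \<theta>_def)
  then obtain p where p: "p \<in> ball 0 1" "p \<noteq> q" "1 / (1 - \<theta>) < rad p"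
    using exists_far_point[OF q, of "1 / (1 - \<theta>)"] by auto
  note r = far_from_center(1)[OF \<kappa> q p(1,2)]
  define k m where "k = rcoth (rad p)" and "m = mixed_coeff (rad p)"
  have k: "k > 0" and m: "m \<ge> 0" using rcoth_ge_1[OF r] mixed_coeff_nonneg[OF r] by (simp_all add: k_def m_def)
  obtain u w where uw: "radial \<kappa> q p u = sqrt k" "transversal \<kappa> q p u u = 1\<^sup>2"
    "radial \<kappa> q p w = 0" "transversal \<kappa> q p w w = 1" "transversal \<kappa> q p w u = 1"
    by (rule adapted_vectors[OF \<kappa> q p(1,2) dim])
  have H: "hessian G f p u u = 4 * k" "hessian G f p w w = 2 * k"
    using hessian_radial[OF \<kappa> q p(1,2) f] k by (simp_all add: uw k_def[symmetric])
  have "nabla3 G f p w u u = 2 * sqrt \<kappa> * (- 2 * m * sqrt k)"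
    using nabla3_radial[OF \<kappa> q p(1,2) f, of w u] by (simp add: uw m_def)
  then have "4 * sqrt \<kappa> * m * sqrt k = \<bar>nabla3 G f p w u u\<bar>" using \<kappa> k m by (simp add: abs_mult)
  also have "\<dots> \<le> 2 / sqrt \<alpha> * sqrt (2 * k) * sqrt (4 * k) * sqrt (4 * k)"
    using sc p(1) unfolding self_concordant_def H[symmetric] by blast
  also have "\<dots> = 8 * sqrt 2 * k * sqrt k / sqrt \<alpha>"
    using k by (simp add: real_sqrt_mult)
  finally have "m * (4 * sqrt \<kappa> * sqrt k) \<le> (2 * sqrt 2 / (sqrt \<alpha> * sqrt \<kappa>) * k) * (4 * sqrt \<kappa> * sqrt k)"
    using \<kappa> by (simp add: field_simps)
  then have "m \<le> 2 * sqrt 2 / (sqrt \<alpha> * sqrt \<kappa>) * k"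
    using \<kappa> k by (simp only: mult_le_cancel_right) auto
  also have "2 * sqrt 2 / (sqrt \<alpha> * sqrt \<kappa>) = \<theta>"
  proof -
    have "sqrt 8 = 2 * sqrt 2" using real_sqrt_mult[of 4 2] by simp
    then show ?thesis by (simp add: \<theta>_def real_sqrt_divide real_sqrt_mult)
  qed
  finally have "(1 - 1 / rad p) * k \<le> \<theta> * k"
    using mixed_coeff_ge[OF r] by (simp add: k_def m_def)
  then have "1 - \<theta> \<le> 1 / rad p" using k by simp
  moreover have "1 / rad p < 1 - \<theta>" using p(3) \<theta> r by (simp add: field_simps)
  ultimately show False by simp
qed

text \<open>
  For \<open>u\<close> with \<open>a = 1\<close> and \<open>k * P = 2\<close>, the equality case of \<open>cubic_amgm\<close>, the condition becomes
  \<open>2 * m - k' \<le> 2 * \<theta> * k\<close>, where \<open>\<theta> < 1\<close> if \<open>\<alpha> > 27 / (2 * \<kappa>)\<close>. This fails for large \<open>r\<close>.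
\<close>

lemma self_concordant_along_geodesics_sharp:
  assumes dim: "DIM('a) \<ge> 2" and sc: "self_concordant_along_geodesics (ball 0 1) G \<alpha> f"
  shows "\<alpha> \<le> 27 / (2 * \<kappa>)"
proof (rule ccontr)
  assume "\<not> \<alpha> \<le> 27 / (2 * \<kappa>)"
  then have \<alpha>: "27 < 2 * \<alpha> * \<kappa>" using \<kappa> by (simp add: field_simps)
  then have \<alpha>0: "\<alpha> > 0" using sc by (simp add: self_concordant_along_geodesics_def)
  define \<theta> where "\<theta> = sqrt (27 / (2 * \<alpha> * \<kappa>))"
  have \<theta>: "\<theta> < 1" using \<alpha> by (simp add: \<theta>_def)
  then obtain p where p: "p \<in> ball 0 1" "p \<noteq> q" "3 / (2 * (1 - \<theta>)) < rad p"
    using exists_far_point[OF q, of "3 / (2 * (1 - \<theta>))"] by auto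
  note r = far_from_center(1)[OF \<kappa> q p(1,2)]
  define k where "k = rcoth (rad p)"
  define d where "d = 2 * mixed_coeff (rad p) - rcoth_deriv (rad p)"
  have k: "k > 0" using rcoth_ge_1[OF r] by (simp add: k_def)
  obtain u where u: "radial \<kappa> q p u = 1" "transversal \<kappa> q p u u = (sqrt (2 / k))\<^sup>2"
    by (rule adapted_vectors[OF \<kappa> q p(1,2) dim])
  have u2: "transversal \<kappa> q p u u = 2 / k" using u(2) k by simp
  have H: "hessian G f p u u = 6"
    using hessian_radial[OF \<kappa> q p(1,2) f, of u] k by (simp add: u(1) u2 k_def[symmetric])
  have "nabla3 G f p u u u = - (4 * sqrt \<kappa> * (d / k))"
    using nabla3_radial[OF \<kappa> q p(1,2) f, of u u] k by (simp add: u(1) u2 d_def field_simps)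
  then have "4 * sqrt \<kappa> * (d / k) \<le> \<bar>nabla3 G f p u u u\<bar>"
    using abs_ge_minus_self[of "nabla3 G f p u u u"] by simp
  also have "\<dots> \<le> 2 / sqrt \<alpha> * 6 powr (3 / 2)"
    using sc p(1) unfolding self_concordant_along_geodesics_def H[symmetric] by blast
  also have "\<dots> = 12 * sqrt 6 / sqrt \<alpha>" by (simp add: powr_three_halves)
  finally have le: "4 * sqrt \<kappa> * (d / k) \<le> 12 * sqrt 6 / sqrt \<alpha>" .
  have "x \<le> 3 * s / (A * K)" if "4 * K * x \<le> 12 * s / A" "0 < A" "0 < K" for x s A K :: real
  proof -
    have "4 * (x * (A * K)) \<le> 12 * s" using that by (simp add: pos_le_divide_eq mult_ac)
    then show ?thesis using that by (simp add: pos_le_divide_eq mult_ac)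
  qed
  from this[OF le] have "d / k \<le> 3 * sqrt 6 / (sqrt \<alpha> * sqrt \<kappa>)" using \<kappa> \<alpha>0 by simp
  also have "\<dots> = 2 * \<theta>"
  proof -
    have "2 * \<theta> = sqrt (4 * (27 / (2 * \<alpha> * \<kappa>)))" unfolding \<theta>_def real_sqrt_mult[of 4] by simp
    also have "4 * (27 / (2 * \<alpha> * \<kappa>)) = 9 * 6 / (\<alpha> * \<kappa>)" by simp
    also have "sqrt \<dots> = 3 * sqrt 6 / (sqrt \<alpha> * sqrt \<kappa>)"
      unfolding real_sqrt_divide real_sqrt_mult by simp
    finally show ?thesis by simp
  qed
  finally have "d \<le> 2 * \<theta> * k" using k by (simp add: pos_divide_le_eq)
  moreover have "(2 - 3 / rad p) * k \<le> d"
    using mixed_coeff_ge[OF r] rcoth_deriv_le_div[OF r] by (simp add: d_def k_def algebra_simps)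
  ultimately have "(2 - 3 / rad p) * k \<le> 2 * \<theta> * k" by linarith
  then have "2 - 3 / rad p \<le> 2 * \<theta>" using k by simp
  moreover have "3 / rad p < 2 * (1 - \<theta>)" using p(3) \<theta> r by (simp add: field_simps)
  ultimately show False by simp
qed

text \<open>
  The triangle inequality, with \<open>k' \<le> 2 * z * k\<close> in the first term and \<open>m \<le> k\<close> and
  \<open>\<bar>X\<bar> \<le> sqrt (P * Q)\<close> in the second. The weaker bound follows since \<open>radial\<close> has norm at most 1.
\<close>

lemma radial_transversal_bound:
  assumes p: "p \<in> ball 0 1" "p \<noteq> q"
    and z: "\<forall>x::real. x \<noteq> 0 \<longrightarrow> \<bar>1 / sinh x - 1 / x\<bar> \<le> z"
  defines "H \<equiv> \<lambda>u. hessian G f p u u" and "a \<equiv> radial \<kappa> q p"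
  shows "\<bar>nabla3 G f p w u u\<bar> \<le> 2 * z * sqrt \<kappa> * \<bar>a w\<bar> * (H u - 2 * (a u)\<^sup>2)
      + 2 * sqrt \<kappa> * \<bar>a u\<bar> * sqrt (H u - 2 * (a u)\<^sup>2) * sqrt (H w - 2 * (a w)\<^sup>2)"
    and "2 * z * sqrt \<kappa> * \<bar>a w\<bar> * (H u - 2 * (a u)\<^sup>2)
      + 2 * sqrt \<kappa> * \<bar>a u\<bar> * sqrt (H u - 2 * (a u)\<^sup>2) * sqrt (H w - 2 * (a w)\<^sup>2)
      \<le> 2 * z * sqrt \<kappa> * riem_norm G p w * H u
        + 2 * sqrt \<kappa> * riem_norm G p u * sqrt (H u) * sqrt (H w)"
proof -
  note r = far_from_center(1)[OF \<kappa> q p]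
  define k k' m where "k = rcoth (rad p)" and "k' = rcoth_deriv (rad p)" and "m = mixed_coeff (rad p)"
  define P Q X where "P = transversal \<kappa> q p u u" and "Q = transversal \<kappa> q p w w"
    and "X = transversal \<kappa> q p w u"
  have PQ: "0 \<le> P" "0 \<le> Q" unfolding P_def Q_def by (rule transversal_nonneg[OF \<kappa> q p])+
  have k: "1 \<le> k" unfolding k_def by (rule rcoth_ge_1[OF r])
  have H: "H u - 2 * (a u)\<^sup>2 = 2 * k * P" "H w - 2 * (a w)\<^sup>2 = 2 * k * Q"
    using hessian_radial[OF \<kappa> q p f] by (simp_all add: H_def a_def k_def P_def Q_def)
  have z0: "0 \<le> z" using z[rule_format, of 1] by linarith
  have "\<bar>X\<bar> \<le> sqrt (P * Q)"
    using transversal_Cauchy_Schwarz[OF \<kappa> q p, of w u]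
    by (intro real_le_rsqrt) (simp add: P_def Q_def X_def mult.commute)
  then have X: "2 * k * \<bar>X\<bar> \<le> sqrt (2 * k * P) * sqrt (2 * k * Q)"
  proof -
    assume "\<bar>X\<bar> \<le> sqrt (P * Q)"
    then have "2 * k * \<bar>X\<bar> \<le> 2 * k * sqrt (P * Q)" using k by simp
    also have "\<dots> = sqrt ((2 * k)\<^sup>2) * sqrt (P * Q)" using k by (simp only: real_sqrt_abs)
    also have "\<dots> = sqrt (2 * k * P) * sqrt (2 * k * Q)"
      unfolding real_sqrt_mult[symmetric] by (simp add: power2_eq_square mult_ac)
    finally show ?thesis .
  qed
  have k': "0 \<le> k'" "k' \<le> 2 * z * k"
    unfolding k'_def k_def by (rule rcoth_deriv_nonneg[OF r], rule rcoth_deriv_le_gap[OF r z[rule_format]])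
  have m: "0 \<le> m" "m \<le> k"
    unfolding m_def k_def by (rule mixed_coeff_nonneg[OF r], rule mixed_coeff_le[OF r])
  have "nabla3 G f p w u u = 2 * sqrt \<kappa> * (k' * a w * P - 2 * m * a u * X)"
    using nabla3_radial[OF \<kappa> q p f, of w u] by (simp add: k'_def m_def a_def P_def X_def)
  then have "\<bar>nabla3 G f p w u u\<bar> = 2 * sqrt \<kappa> * \<bar>k' * a w * P - 2 * m * a u * X\<bar>"
    using \<kappa> by (simp add: abs_mult)
  also have "\<dots> \<le> 2 * sqrt \<kappa> * (k' * (\<bar>a w\<bar> * P) + m * (2 * (\<bar>a u\<bar> * \<bar>X\<bar>)))"
  proof -
    have "\<bar>k' * a w * P - 2 * m * a u * X\<bar> \<le> \<bar>k' * a w * P\<bar> + \<bar>2 * m * a u * X\<bar>"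
      by (rule abs_triangle_ineq4)
    also have "\<dots> = k' * (\<bar>a w\<bar> * P) + m * (2 * (\<bar>a u\<bar> * \<bar>X\<bar>))"
      using k' m PQ by (simp add: abs_mult)
    finally show ?thesis using \<kappa> by (intro mult_left_mono) auto
  qed
  also have "\<dots> \<le> 2 * sqrt \<kappa> * (2 * z * k * (\<bar>a w\<bar> * P) + k * (2 * (\<bar>a u\<bar> * \<bar>X\<bar>)))"
    using k' m PQ \<kappa> by (intro mult_left_mono add_mono mult_right_mono) auto
  also have "\<dots> = 2 * z * sqrt \<kappa> * \<bar>a w\<bar> * (2 * k * P) + 2 * sqrt \<kappa> * \<bar>a u\<bar> * (2 * k * \<bar>X\<bar>)"
    by (simp add: algebra_simps)
  also have "\<dots> \<le> 2 * z * sqrt \<kappa> * \<bar>a w\<bar> * (2 * k * P)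
      + 2 * sqrt \<kappa> * \<bar>a u\<bar> * (sqrt (2 * k * P) * sqrt (2 * k * Q))"
    using X \<kappa> by (intro add_left_mono mult_left_mono) auto
  finally show "\<bar>nabla3 G f p w u u\<bar> \<le> 2 * z * sqrt \<kappa> * \<bar>a w\<bar> * (H u - 2 * (a u)\<^sup>2)
      + 2 * sqrt \<kappa> * \<bar>a u\<bar> * sqrt (H u - 2 * (a u)\<^sup>2) * sqrt (H w - 2 * (a w)\<^sup>2)"
    unfolding H by (simp add: mult.assoc)
  have a: "\<bar>a v\<bar> \<le> riem_norm G p v" for v unfolding a_def by (rule radial_le_riem_norm[OF \<kappa> q p])
  have n0: "0 \<le> riem_norm G p v" for v using a[of v] by linarith
  have le: "H u - 2 * (a u)\<^sup>2 \<le> H u" "H w - 2 * (a w)\<^sup>2 \<le> H w" by simp_all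
  have pos: "0 \<le> H u - 2 * (a u)\<^sup>2" "0 \<le> H w - 2 * (a w)\<^sup>2" using H k PQ by simp_all
  have pos': "0 \<le> H u" "0 \<le> H w" unfolding H_def by (rule hessian_nonneg[OF p(1)])+
  show "2 * z * sqrt \<kappa> * \<bar>a w\<bar> * (H u - 2 * (a u)\<^sup>2)
      + 2 * sqrt \<kappa> * \<bar>a u\<bar> * sqrt (H u - 2 * (a u)\<^sup>2) * sqrt (H w - 2 * (a w)\<^sup>2)
      \<le> 2 * z * sqrt \<kappa> * riem_norm G p w * H u
        + 2 * sqrt \<kappa> * riem_norm G p u * sqrt (H u) * sqrt (H w)"
    using a le pos pos' z0 \<kappa> n0
    by (intro add_mono mult_mono mult_nonneg_nonneg real_sqrt_le_mono order_refl) auto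
qed

end

theorem theorem5p16:
  fixes \<kappa> :: real and p0 :: "'a::euclidean_space"
    and M :: "'a set" and G :: "'a metric_tensor" and f g :: "'a \<Rightarrow> real" and \<zeta> :: real
  assumes dim: "DIM('a) \<ge> 2"
    and kappa: "\<kappa> > 0"
    and M: "M = model_carrier"
    and G: "G = model_metric \<kappa>"
    and p0: "p0 \<in> M"
    and f: "f = (\<lambda>p. (riem_dist M G p p0)\<^sup>2)"
    and g: "g = (\<lambda>p. riem_dist M G p p0)"
    and zeta: "\<zeta> = (SUP x\<in>UNIV - {0::real}. \<bar>1 / sinh x - 1 / x\<bar>)"
  shows
    "(\<comment> \<open>(i)\<close>
      (\<forall>p\<in>M. \<forall>u w. \<bar>nabla3 G f p w u u\<bar> \<le> sqrt (\<kappa> / 2) * sqrt (hessian G f p w w) * hessian G f p u u) \<and>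
      self_concordant M G (8 / \<kappa>) f \<and>
      (\<forall>\<alpha>>8 / \<kappa>. \<not> self_concordant M G \<alpha> f)) \<and>
     (\<comment> \<open>(ii)\<close>
      (\<forall>p\<in>M. \<forall>u. \<bar>nabla3 G f p u u u\<bar> \<le> sqrt (8 * \<kappa> / 27) * hessian G f p u u powr (3/2)) \<and>
      self_concordant_along_geodesics M G (27 / (2 * \<kappa>)) f \<and>
      (\<forall>\<alpha>>27 / (2 * \<kappa>). \<not> self_concordant_along_geodesics M G \<alpha> f)) \<and>
     (\<comment> \<open>(iii)\<close>
      (\<forall>p\<in>M - {p0}. g differentiable (at p)) \<and>
      (\<forall>p\<in>M - {p0}. \<forall>u w.
        \<bar>nabla3 G f p w u u\<bar>
          \<le> 2 * \<zeta> * sqrt \<kappa> * \<bar>diff_form g p w\<bar> * (hessian G f p u u - 2 * (diff_form g p u)\<^sup>2)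
            + 2 * sqrt \<kappa> * \<bar>diff_form g p u\<bar> * sqrt (hessian G f p u u - 2 * (diff_form g p u)\<^sup>2)
              * sqrt (hessian G f p w w - 2 * (diff_form g p w)\<^sup>2) \<and>
        2 * \<zeta> * sqrt \<kappa> * \<bar>diff_form g p w\<bar> * (hessian G f p u u - 2 * (diff_form g p u)\<^sup>2)
            + 2 * sqrt \<kappa> * \<bar>diff_form g p u\<bar> * sqrt (hessian G f p u u - 2 * (diff_form g p u)\<^sup>2)
              * sqrt (hessian G f p w w - 2 * (diff_form g p w)\<^sup>2)
          \<le> 2 * \<zeta> * sqrt \<kappa> * riem_norm G p w * hessian G f p u u
            + 2 * sqrt \<kappa> * riem_norm G p u * sqrt (hessian G f p u u) * sqrt (hessian G f p w w)) \<and>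
      (\<forall>p\<in>M. \<forall>u w.
        \<bar>nabla3 G f p w u u\<bar>
          \<le> 2 * \<zeta> * sqrt \<kappa> * riem_norm G p w * hessian G f p u u
            + 2 * sqrt \<kappa> * riem_norm G p u * sqrt (hessian G f p u u) * sqrt (hessian G f p w w)) \<and>
      bdd_above ((\<lambda>x::real. \<bar>1 / sinh x - 1 / x\<bar>) ` (UNIV - {0})) \<and>
      \<zeta> \<le> 1 / 2)"
proof -
  have M': "M = ball 0 1" using M by (simp add: model_carrier_def)
  have q: "p0 \<in> ball 0 1" using p0 M' by simp
  have d: "riem_dist M G p p0 = arcosh (cosh_dist p0 p) / sqrt \<kappa>" if "p \<in> ball 0 1" for p
    unfolding M' G by (rule riem_dist_model[OF kappa that q])
  have f': "\<forall>p\<in>ball 0 1. f p = arcosh_sq (cosh_dist p0 p) / \<kappa>"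
    using kappa by (simp add: f d arcosh_sq_def power_divide)
  have g': "(g has_derivative radial \<kappa> p0 p) (at p)" if "p \<in> ball 0 1" "p \<noteq> p0" for p
    by (rule has_derivative_distance[OF kappa q that]) (simp add: g d)
  have dg: "diff_form g p = radial \<kappa> p0 p" if "p \<in> ball 0 1" "p \<noteq> p0" for p
    unfolding diff_form_def using frechet_derivative_at[OF g'[OF that]] by simp
  have bdd: "bdd_above ((\<lambda>x::real. \<bar>1 / sinh x - 1 / x\<bar>) ` (UNIV - {0}))"
    using inverse_sinh_gap by (intro bdd_aboveI2)
  have z: "\<forall>x::real. x \<noteq> 0 \<longrightarrow> \<bar>1 / sinh x - 1 / x\<bar> \<le> \<zeta>"
    unfolding zeta by (auto intro!: cSUP_upper bdd)
  have z_half: "\<zeta> \<le> 1 / 2"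
    unfolding zeta by (intro cSUP_least inverse_sinh_gap) (use zero_neq_one in blast)
  have z0: "0 \<le> \<zeta>" using z[rule_format, of 1] by linarith
  note iii = radial_transversal_bound[OF kappa q f' _ _ z]
  have center: "\<bar>nabla3 G f p0 w u u\<bar> \<le> 2 * \<zeta> * sqrt \<kappa> * riem_norm G p0 w * hessian G f p0 u u
      + 2 * sqrt \<kappa> * riem_norm G p0 u * sqrt (hessian G f p0 u u) * sqrt (hessian G f p0 w w)" for u w
  proof -
    have "nabla3 G f p0 w u u = 0" unfolding G by (rule nabla3_at_center[OF kappa q f'])
    moreover have "0 \<le> hessian G f p0 v v" for v unfolding G by (rule hessian_nonneg[OF kappa q f' q])
    moreover have "0 \<le> riem_norm G p0 v" for v
      unfolding G riem_norm_def using kappa by (simp add: model_metric_conf)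
    ultimately show ?thesis using z0 kappa by simp
  qed
  show ?thesis
  proof (intro conjI ballI allI impI)
    fix p u w assume p: "p \<in> M"
    then have b: "p \<in> ball 0 1" using M' by simp
    show "\<bar>nabla3 G f p w u u\<bar> \<le> sqrt (\<kappa> / 2) * sqrt (hessian G f p w w) * hessian G f p u u"
      unfolding G by (rule mixed_bound[OF kappa q f' b])
    show "\<bar>nabla3 G f p u u u\<bar> \<le> sqrt (8 * \<kappa> / 27) * hessian G f p u u powr (3/2)"
      unfolding G by (rule cubic_bound[OF kappa q f' b])
    show "\<bar>nabla3 G f p w u u\<bar> \<le> 2 * \<zeta> * sqrt \<kappa> * riem_norm G p w * hessian G f p u u
        + 2 * sqrt \<kappa> * riem_norm G p u * sqrt (hessian G f p u u) * sqrt (hessian G f p w w)"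
    proof (cases "p = p0")
      case False
      show ?thesis unfolding G by (rule order_trans[OF iii[OF b False]])
    qed (use center in simp)
  next
    show "self_concordant M G (8 / \<kappa>) f"
      unfolding M' G by (rule self_concordant_sq_dist[OF kappa q f'])
    show "self_concordant_along_geodesics M G (27 / (2 * \<kappa>)) f"
      unfolding M' G by (rule self_concordant_along_geodesics_sq_dist[OF kappa q f'])
    show "\<not> self_concordant M G \<alpha> f" if "8 / \<kappa> < \<alpha>" for \<alpha>
      using self_concordant_sharp[OF kappa q f' dim, of \<alpha>] that unfolding M' G by auto
    show "\<not> self_concordant_along_geodesics M G \<alpha> f" if "27 / (2 * \<kappa>) < \<alpha>" for \<alpha>
      using self_concordant_along_geodesics_sharp[OF kappa q f' dim, of \<alpha>] that unfolding M' G by auto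
  next
    fix p u w assume p: "p \<in> M - {p0}"
    then have b: "p \<in> ball 0 1" "p \<noteq> p0" using M' by auto
    show "g differentiable (at p)" using g'[OF b] by (rule differentiableI)
    show "\<bar>nabla3 G f p w u u\<bar>
          \<le> 2 * \<zeta> * sqrt \<kappa> * \<bar>diff_form g p w\<bar> * (hessian G f p u u - 2 * (diff_form g p u)\<^sup>2)
            + 2 * sqrt \<kappa> * \<bar>diff_form g p u\<bar> * sqrt (hessian G f p u u - 2 * (diff_form g p u)\<^sup>2)
              * sqrt (hessian G f p w w - 2 * (diff_form g p w)\<^sup>2)"
      unfolding dg[OF b] G by (rule iii(1)[OF b])
    show "2 * \<zeta> * sqrt \<kappa> * \<bar>diff_form g p w\<bar> * (hessian G f p u u - 2 * (diff_form g p u)\<^sup>2)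
            + 2 * sqrt \<kappa> * \<bar>diff_form g p u\<bar> * sqrt (hessian G f p u u - 2 * (diff_form g p u)\<^sup>2)
              * sqrt (hessian G f p w w - 2 * (diff_form g p w)\<^sup>2)
          \<le> 2 * \<zeta> * sqrt \<kappa> * riem_norm G p w * hessian G f p u u
            + 2 * sqrt \<kappa> * riem_norm G p u * sqrt (hessian G f p u u) * sqrt (hessian G f p w w)"
      unfolding dg[OF b] G by (rule iii(2)[OF b])
  next
    show "bdd_above ((\<lambda>x::real. \<bar>1 / sinh x - 1 / x\<bar>) ` (UNIV - {0}))" by (rule bdd)
    show "\<zeta> \<le> 1 / 2" by (rule z_half)
  qed
qed

end
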